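(* Let $\mathbb{F}$ be a field whose characteristic is not $2$. Let $V$ be a vector space over $\mathbb{F}$ with countable dimension, and let $u\in\mathrm{End}(V)$ be locally finite. The following conditions are equivalent: (i) $u$ is the sum of two square-zero endomorphisms of $V$; (ii) $u$ has the exchange property; (iii) $u$ is similar to its opposite $-u$; (iv) for every $p\in\mathrm{Irr}(\mathbb{F})$ and every $\alpha\in\omega_1\cup\{\infty\}$, one has $\kappa_\alpha\bigl(u,H_{-1}(p)\bigr)=\kappa_\alpha(u,p)$.
   Context: "Countable" includes finite. An endomorphism $u$ of $V$ is locally finite if for every $x\in V$ the sequence $(u^k(x))_{k\ge 0}$ is linearly dependent over $\mathbb{F}$. Square-zero: $a^2=0$. Exchange property: there is a splitting $V=V_1\oplus V_2$ into linear subspaces with $u(V_1)\subset V_2$ and $u(V_2)\subset V_1$. Two endomorphisms $u,v$ of $V$ are similar if $v=\varphi u\varphi^{-1}$ for some automorphism $\varphi$ of $V$. $\mathrm{Irr}(\mathbb{F})$ is the set of monic irreducible polynomials of $\mathbb{F}[t]$. For $\lambda\in\mathbb{F}\setminus\{0\}$ and $p\in\mathbb{F}[t]$ monic of degree $d$, $H_\lambda(p):=\lambda^{-d}p(\lambda t)$; so $H_{-1}(p)=(-1)^d p(-t)$. Kaplansky invariants: $\omega_1$ is the first uncountable ordinal and $\infty$ is a symbol that is not an ordinal. Let $u\in\mathrm{End}(V)$ and $p\in\mathrm{Irr}(\mathbb{F})$; $V^u$ denotes $V$ with the $\mathbb{F}[t]$-module structure $r\cdot x=r(u)[x]$. Define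 submodules by transfinite induction: $p^0(V^u):=V$; $p^{\alpha+1}(V^u):=p(u)\bigl(p^\alpha(V^u)\bigr)$; $p^\alpha(V^u):=\bigcap_{\beta<\alpha}p^\beta(V^u)$ for limit $\alpha$. This non-increasing sequence is eventually constant; $p^\infty(V^u)$ is its final value. For an ordinal $\alpha$, $\kappa_\alpha(u,p)$ is the dimension over the field $\mathbb{F}[t]/(p)$ of the kernel of the linear map $p^\alpha(V^u)/p^{\alpha+1}(V^u)\to p^{\alpha+1}(V^u)/p^{\alpha+2}(V^u)$ induced by $p(u)$; and $\kappa_\infty(u,p)$ is the dimension over $\mathbb{F}[t]/(p)$ of $\ker p(u)\cap p^\infty(V^u)$. Dimensions are cardinals. *)

theory Defs
  imports
    "HOL-Library.Countable_Set"
    "HOL-Computational_Algebra.Polynomial"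
    "HOL-Algebra.Module"
    "HOL-Algebra.AbelCoset"
begin

unbundle cardinal_syntax

section \<open>Endomorphisms of a vector space\<close>

text \<open>
  The space \<open>V\<close> is a whole type \<open>'v\<close>, made into a vector space by a scalar multiplication
  \<open>scale\<close> satisfying \<^term>\<open>vector_space scale\<close>.
\<close>

abbreviation endo :: "('f::field \<Rightarrow> 'v::ab_group_add \<Rightarrow> 'v) \<Rightarrow> ('v \<Rightarrow> 'v) \<Rightarrow> bool" where
  "endo scale \<equiv> Vector_Spaces.linear scale scale"

definition countable_dim :: "('f::field \<Rightarrow> 'v::ab_group_add \<Rightarrow> 'v) \<Rightarrow> bool" where
  "countable_dim scale \<longleftrightarrow>
     (\<exists>B. countable B \<and> \<not> module.dependent scale B \<and> module.span scale B = UNIV)"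

text \<open>
  Linear dependence is that of the family \<open>(u\<^sup>k(x))\<^sub>k\<close>, not of its set of values:
  a repeated value makes the family dependent.
\<close>
definition locally_finite :: "('f::field \<Rightarrow> 'v::ab_group_add \<Rightarrow> 'v) \<Rightarrow> ('v \<Rightarrow> 'v) \<Rightarrow> bool" where
  "locally_finite scale u \<longleftrightarrow>
     (\<forall>x. \<exists>c :: nat \<Rightarrow> 'f. finite {k. c k \<noteq> 0} \<and> (\<exists>k. c k \<noteq> 0) \<and>
          (\<Sum>k | c k \<noteq> 0. scale (c k) ((u ^^ k) x)) = 0)"

definition square_zero :: "('v \<Rightarrow> 'v::ab_group_add) \<Rightarrow> bool" where
  "square_zero a \<longleftrightarrow> (\<forall>x. a (a x) = 0)"

definition sum_of_two_square_zero ::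
    "('f::field \<Rightarrow> 'v::ab_group_add \<Rightarrow> 'v) \<Rightarrow> ('v \<Rightarrow> 'v) \<Rightarrow> bool" where
  "sum_of_two_square_zero scale u \<longleftrightarrow>
     (\<exists>a b. endo scale a \<and> endo scale b \<and> square_zero a \<and> square_zero b \<and>
            u = (\<lambda>x. a x + b x))"

definition exchange_property ::
    "('f::field \<Rightarrow> 'v::ab_group_add \<Rightarrow> 'v) \<Rightarrow> ('v \<Rightarrow> 'v) \<Rightarrow> bool" where
  "exchange_property scale u \<longleftrightarrow>
     (\<exists>V1 V2. module.subspace scale V1 \<and> module.subspace scale V2 \<and>
        V1 \<inter> V2 = {0} \<and> {x + y | x y. x \<in> V1 \<and> y \<in> V2} = UNIV \<and>
        u ` V1 \<subseteq> V2 \<and> u ` V2 \<subseteq> V1)"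

definition similar ::
    "('f::field \<Rightarrow> 'v::ab_group_add \<Rightarrow> 'v) \<Rightarrow> ('v \<Rightarrow> 'v) \<Rightarrow> ('v \<Rightarrow> 'v) \<Rightarrow> bool" where
  "similar scale u v \<longleftrightarrow>
     (\<exists>\<phi>. endo scale \<phi> \<and> bij \<phi> \<and> v = \<phi> \<circ> u \<circ> inv_into UNIV \<phi>)"


section \<open>Polynomials\<close>

definition Irr :: "'f::field poly set" where
  "Irr = {p. lead_coeff p = 1 \<and> irreducible p}"

definition H_poly :: "'f::field \<Rightarrow> 'f poly \<Rightarrow> 'f poly" where
  "H_poly l p = Polynomial.smult (inverse l ^ degree p) (pcompose p [:0, l:])"


section \<open>Modules over the polynomial ring\<close>

text \<open>
  Modules are HOL-Algebra records whose scalars are the elements of the type \<^typ>\<open>'f poly\<close>.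
  The ring fields \<open>mult\<close> and \<open>one\<close> that the record type also has play no role.
\<close>

definition end_module ::
    "('f::field \<Rightarrow> 'v::ab_group_add \<Rightarrow> 'v) \<Rightarrow> ('v \<Rightarrow> 'v) \<Rightarrow> ('f poly, 'v) module" where
  "end_module scale u =
     \<lparr>carrier = UNIV, mult = undefined, one = undefined, zero = 0, add = (+),
      smult = (\<lambda>r x. \<Sum>i\<le>degree r. scale (coeff r i) ((u ^^ i) x))\<rparr>"

definition submodule_of :: "('a, 'm) module \<Rightarrow> 'm set \<Rightarrow> ('a, 'm) module" where
  "submodule_of M W = M\<lparr>carrier := W\<rparr>"

definition quotient_module :: "('a, 'm) module \<Rightarrow> 'm set \<Rightarrow> ('a, 'm set) module" where
  "quotient_module M N =
     \<lparr>carrier = a_rcosets\<^bsub>M\<^esub> N, mult = undefined, one = undefined, zero = N, add = set_add M,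
      smult = (\<lambda>r X. \<Union>x\<in>X. N +>\<^bsub>M\<^esub> (r \<odot>\<^bsub>M\<^esub> x))\<rparr>"

text \<open>
  Let \<open>M\<close> be annihilated by \<open>p\<close>. The field \<open>F[t]/(p)\<close> acts on \<open>M\<close> through representatives,
  and the class of \<open>r\<close> is zero in it exactly when \<open>p\<close> divides \<open>r\<close>. So in a basis of \<open>M\<close>
  over \<open>F[t]/(p)\<close> the coefficients can be given by polynomials, independence saying that
  those of a vanishing combination are divisible by \<open>p\<close>.
\<close>
definition residue_basis :: "('f::field poly, 'm) module \<Rightarrow> 'f poly \<Rightarrow> 'm set \<Rightarrow> bool" where
  "residue_basis M p B \<longleftrightarrow>
     B \<subseteq> carrier M \<and>
     (\<forall>S r. finite S \<and> S \<subseteq> B \<and> (\<Oplus>\<^bsub>M\<^esub>b\<in>S. r b \<odot>\<^bsub>M\<^esub> b) = \<zero>\<^bsub>M\<^esub> \<longrightarrow> (\<forall>b\<in>S. p dvd r b)) \<and>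
     (\<forall>x\<in>carrier M. \<exists>S r. finite S \<and> S \<subseteq> B \<and> x = (\<Oplus>\<^bsub>M\<^esub>b\<in>S. r b \<odot>\<^bsub>M\<^esub> b))"

text \<open>
  Cardinals are cardinal-order relations, to be compared by \<open>=o\<close>.
\<close>
definition residue_dim :: "('f::field poly, 'm) module \<Rightarrow> 'f poly \<Rightarrow> 'm rel" where
  "residue_dim M p = |SOME B. residue_basis M p B|"


section \<open>Kaplansky invariants\<close>

text \<open>
  Ordinals are the elements of (the field of) a well-order \<open>r\<close>, an element standing for the
  order type of the set of its strict predecessors; \<open>wo_rel.suc r {\<alpha>}\<close> is \<open>\<alpha> + 1\<close>.
\<close>

definition p_power_step ::
    "'i rel \<Rightarrow> ('a, 'm) module \<Rightarrow> 'a \<Rightarrow> ('i \<Rightarrow> 'm set) \<Rightarrow> 'i \<Rightarrow> 'm set" where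
  "p_power_step r M p f \<alpha> =
     (if underS r \<alpha> = {} then carrier M
      else if \<exists>\<beta>\<in>underS r \<alpha>. \<alpha> = wo_rel.suc r {\<beta>}
           then (\<lambda>x. p \<odot>\<^bsub>M\<^esub> x) ` f (THE \<beta>. \<beta> \<in> underS r \<alpha> \<and> \<alpha> = wo_rel.suc r {\<beta>})
      else (\<Inter>\<beta>\<in>underS r \<alpha>. f \<beta>))"

definition p_power :: "'i rel \<Rightarrow> ('a, 'm) module \<Rightarrow> 'a \<Rightarrow> 'i \<Rightarrow> 'm set" where
  "p_power r M p = wo_rel.worec r (p_power_step r M p)"

lemma wo_suc_inj:
  assumes r: "Well_order r" and b: "\<beta> \<in> underS r \<alpha>" "\<alpha> = wo_rel.suc r {\<beta>}"
    and c: "\<gamma> \<in> underS r \<alpha>" "\<alpha> = wo_rel.suc r {\<gamma>}"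
  shows "\<gamma> = \<beta>"
proof -
  interpret wo_rel r by unfold_locales (rule r)
  have le: "y = x" if x: "x \<in> underS \<alpha>" "\<alpha> = suc {x}" and y: "y \<in> underS \<alpha>"
      and xy: "(x, y) \<in> r" for x y
  proof (rule ccontr)
    assume "y \<noteq> x"
    then have "y \<in> AboveS {x}"
      using xy by (auto simp: AboveS_def Field_def)
    then have "(\<alpha>, y) \<in> r"
      using suc_least_AboveS x(2) by blast
    moreover have "(y, \<alpha>) \<in> r" "y \<noteq> \<alpha>"
      using y by (auto simp: underS_def)
    ultimately show False
      using ANTISYM by (auto simp: antisym_def)
  qed
  have "\<beta> \<in> Field r" "\<gamma> \<in> Field r"
    using b(1) c(1) by (auto simp: underS_def Field_def)
  then have "(\<beta>, \<gamma>) \<in> r \<or> (\<gamma>, \<beta>) \<in> r"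
    using TOTALS by blast
  then show ?thesis
    using le b c by metis
qed

lemma p_power_unfold:
  assumes "Well_order r"
  shows "p_power r M p \<alpha> = p_power_step r M p (p_power r M p) \<alpha>"
proof -
  interpret wo_rel r by unfold_locales (rule assms)
  have "p_power_step r M p f x = p_power_step r M p g x"
    if eq: "\<forall>y\<in>underS x. f y = g y" for f g x
  proof (cases "\<exists>\<beta>\<in>underS x. x = suc {\<beta>}")
    case True
    then obtain b where b: "b \<in> underS x" "x = suc {b}"
      by blast
    then have "(THE \<beta>. \<beta> \<in> underS x \<and> x = suc {\<beta>}) = b"
      using wo_suc_inj[OF assms] by (intro the_equality) blast+
    then show ?thesis
      using b(1) eq by (simp add: p_power_step_def)
  next
    case False
    then show ?thesis
      using eq unfolding p_power_step_def by simp
  qed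
  then have "adm_wo (p_power_step r M p)"
    unfolding adm_wo_def by blast
  then show ?thesis
    unfolding p_power_def using worec_fixpoint by metis
qed

lemma p_power_zero:
  assumes "Well_order r" "underS r \<alpha> = {}"
  shows "p_power r M p \<alpha> = carrier M"
  using assms by (subst p_power_unfold) (simp_all add: p_power_step_def)

lemma p_power_suc:
  assumes r: "Well_order r" and a: "aboveS r \<alpha> \<noteq> {}"
  shows "p_power r M p (wo_rel.suc r {\<alpha>}) = (\<lambda>x. p \<odot>\<^bsub>M\<^esub> x) ` p_power r M p \<alpha>"
proof -
  interpret wo_rel r by unfold_locales (rule r)
  have F: "\<alpha> \<in> Field r"
    using a by (auto simp: aboveS_def Field_def)
  have "AboveS {\<alpha>} \<noteq> {}"
    using a by (auto simp: AboveS_def aboveS_def Field_def)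
  then have u: "\<alpha> \<in> underS (suc {\<alpha>})"
    using suc_greater[of "{\<alpha>}" \<alpha>] F by (auto simp: underS_def)
  then have "(THE \<beta>. \<beta> \<in> underS (suc {\<alpha>}) \<and> suc {\<alpha>} = suc {\<beta>}) = \<alpha>"
    using wo_suc_inj[OF r] by (intro the_equality) blast+
  then show ?thesis
    using u by (subst p_power_unfold[OF r]) (auto simp: p_power_step_def)
qed

lemma p_power_limit:
  assumes "Well_order r" "underS r \<alpha> \<noteq> {}" "\<nexists>\<beta>. \<beta> \<in> underS r \<alpha> \<and> \<alpha> = wo_rel.suc r {\<beta>}"
  shows "p_power r M p \<alpha> = (\<Inter>\<beta>\<in>underS r \<alpha>. p_power r M p \<beta>)"
  using assms by (subst p_power_unfold) (auto simp: p_power_step_def)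

text \<open>
  A strictly decreasing sequence of subsets of \<open>'m\<close> has fewer than \<open>max(\<aleph>\<^sub>0, |'m|)\<^sup>+\<close> terms,
  so the sequence of the \<open>p\<^sup>\<alpha>(M)\<close>, \<open>\<alpha>\<close> ranging over all ordinals, reaches its final value
  before that initial ordinal.
\<close>
definition p_power_inf :: "('a, 'm) module \<Rightarrow> 'a \<Rightarrow> 'm set" where
  "p_power_inf M p =
     (let r = cardSuc |UNIV :: (nat + 'm) set|
      in THE W. \<exists>\<alpha>\<in>Field r. \<forall>\<beta>. (\<alpha>, \<beta>) \<in> r \<longrightarrow> p_power r M p \<beta> = W)"

text \<open>
  \<open>kernel_module r M p \<alpha>\<close> is the kernel of
  \<open>p\<^sup>\<alpha>(M) / p\<^sup>\<alpha>\<^sup>+\<^sup>1(M) \<rightarrow> p\<^sup>\<alpha>\<^sup>+\<^sup>1(M) / p\<^sup>\<alpha>\<^sup>+\<^sup>2(M)\<close>.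
\<close>
definition kernel_module ::
    "'i rel \<Rightarrow> ('a, 'm) module \<Rightarrow> 'a \<Rightarrow> 'i \<Rightarrow> ('a, 'm set) module" where
  "kernel_module r M p \<alpha> =
     (let W0 = p_power r M p \<alpha>;
          W1 = p_power r M p (wo_rel.suc r {\<alpha>});
          W2 = p_power r M p (wo_rel.suc r {wo_rel.suc r {\<alpha>}});
          Q0 = quotient_module (submodule_of M W0) W1;
          Q1 = quotient_module (submodule_of M W1) W2
      in submodule_of Q0 (a_kernel Q0 Q1 (\<lambda>X. \<Union>x\<in>X. W2 +>\<^bsub>M\<^esub> (p \<odot>\<^bsub>M\<^esub> x))))"

definition omega1 :: "nat set rel" where
  "omega1 = cardSuc natLeq"

definition kappa ::
    "('f::field \<Rightarrow> 'v::ab_group_add \<Rightarrow> 'v) \<Rightarrow> nat set \<Rightarrow> ('v \<Rightarrow> 'v) \<Rightarrow> 'f poly \<Rightarrow> 'v set rel" where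
  "kappa scale \<alpha> u p = residue_dim (kernel_module omega1 (end_module scale u) p \<alpha>) p"

definition kappa_inf ::
    "('f::field \<Rightarrow> 'v::ab_group_add \<Rightarrow> 'v) \<Rightarrow> ('v \<Rightarrow> 'v) \<Rightarrow> 'f poly \<Rightarrow> 'v rel" where
  "kappa_inf scale u p =
     (let M = end_module scale u
      in residue_dim (submodule_of M {x \<in> p_power_inf M p. p \<odot>\<^bsub>M\<^esub> x = \<zero>\<^bsub>M\<^esub>}) p)"

end

(*
  The implications from (ii) to (i) and (iii) are immediate from the splitting. A similarity phi of
  u with -u, and likewise a - b when u = a + b with a and b square-zero, maps the F[t]-module V to
  its twist by t |-> -t, isomorphically at every prime concerned, and so gives (iv).

  For (iv) ==> (ii) an involution sigma of V with sigma u = - u sigma is built by back-and-forth;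
  V1 and V2 are its eigenspaces. At each stage sigma lives on a finite-dimensional submodule S and
  respects, for every prime p, the transfinite heights of elements (in V) at p and at p(-t). One has
  to enlarge S so that it contains a given x with p x in S.
  If p(-t) is not associated to p, this is the step in the Kaplansky-Mackey proof of Ulm's theorem:
  x and a partner w with p(-t) w = sigma(p x) are adjoined and swapped, and the equality of the
  invariants is what provides w.
  If p(-t) = e p with e = 1 or e = -1, no condition is needed. Here S is graded by the eigenvalue of
  sigma, and x is adjoined through homogeneous elements that have maximal height modulo S.
*)
theory Submission
  imports Defs
begin

section \<open>Polynomials\<close>

text \<open>Only vectors x with p x in S have to be adjoined because, by local finiteness, every
  vector has a nonzero annihilator, whose prime factors can be peeled off one at a time. Polynomials
  prime to q change no height at q, so such a step is delicate only at p and p(-t). S is kept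
  finite-dimensional for two reasons: a coset of S then contains an element of maximal height, and a
  count of dimensions turns equality of the invariants into the existence of elements outside S.
  When p(-t) is not associated to p, the vectors x and w belong to different primes and do not
  interfere. At a self-dual prime they would, so eigenvectors of sigma are adjoined instead. The
  obstacle is that p x is in general not homogeneous, and that preimages of its components have to
  be found without losing the maximality of heights. Characteristic different from 2 is what splits
  S into eigenspaces. Countable dimension enters three times: a sequence of steps exhausts V, the
  filtrations become constant before \<open>omega1\<close>, and all infinite dimensions over a
  residue field are equal.\<close>

abbreviation smultp :: "'f::comm_semiring_0 \<Rightarrow> 'f poly \<Rightarrow> 'f poly" where
  "smultp \<equiv> Polynomial.smult"

text \<open>A nonzero element of least degree in the ideal generated by \<open>r\<close> and
  \<open>p\<close> divides both, by division with remainder. If it were not a unit, it would be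
  associated to \<open>p\<close>, and then \<open>p\<close> would divide \<open>r\<close>.\<close>

lemma irreducible_bezout:
  fixes p r :: "'f::field poly"
  assumes "irreducible p" "\<not> p dvd r"
  obtains a b where "a * r + b * p = 1"
proof -
  define I where "I = {a * r + b * p | a b. a * r + b * p \<noteq> 0}"
  have "1 * r + 0 * p \<in> I"
    unfolding I_def using assms(2) by (metis (mono_tags, lifting) add.right_neutral
        dvd_0_right mem_Collect_eq mult_1 mult_zero_left)
  then obtain d where d: "d \<in> I" and dmin: "\<And>e. e \<in> I \<Longrightarrow> degree d \<le> degree e"
    using ex_has_least_nat[of "\<lambda>e. e \<in> I" _ degree] by blast
  obtain a b where ab: "d = a * r + b * p" and d0: "d \<noteq> 0"
    using d unfolding I_def by blast
  have dv: "d dvd x * r + y * p" for x y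
  proof (rule ccontr)
    assume nd: "\<not> d dvd x * r + y * p"
    let ?m = "(x * r + y * p) mod d"
    let ?q = "(x * r + y * p) div d"
    have m0: "?m \<noteq> 0" using nd by (simp add: dvd_eq_mod_eq_0)
    have "?m = (x * r + y * p) - ?q * d"
      by (simp add: minus_div_mult_eq_mod)
    also have "\<dots> = (x - ?q * a) * r + (y - ?q * b) * p"
      by (simp add: ab algebra_simps)
    finally have "?m \<in> I" using m0 unfolding I_def
      by (intro CollectI exI[of _ "x - ?q * a"] exI[of _ "y - ?q * b"]) simp
    then have "degree d \<le> degree ?m" by (rule dmin)
    moreover have "degree ?m < degree d"
      using m0 d0 degree_mod_less[of d "x * r + y * p"] by auto
    ultimately show False by simp
  qed
  have "d dvd p" "d dvd r" using dv[of 0 1] dv[of 1 0] by auto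
  then obtain e where e: "p = d * e" by (auto elim: dvdE)
  have "is_unit d"
  proof (rule ccontr)
    assume "\<not> is_unit d"
    then have "is_unit e" using irreducibleD[OF assms(1) e] by simp
    then obtain f where "1 = e * f" by (auto elim: dvdE)
    then have "d = p * f" using e by (metis mult.assoc mult.right_neutral)
    then show False using \<open>d dvd r\<close> assms(2) by (metis dvd_mult_left)
  qed
  then obtain c where "1 = d * c" by (auto elim: dvdE)
  then have "(c * a) * r + (c * b) * p = 1" by (simp add: ab algebra_simps)
  then show ?thesis by (rule that)
qed

lemma irreducible_not_dvd_one:
  fixes p :: "'f::field poly"
  shows "irreducible p \<Longrightarrow> \<not> p dvd 1"
  by (simp add: irreducible_def)

lemma irreducible_smult:
  fixes p :: "'f::field poly"
  assumes "c \<noteq> 0" "irreducible p"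
  shows "irreducible (smultp c p)"
proof -
  have "smultp c p = [:c:] * p" by simp
  moreover have "is_unit [:c:]" using assms(1) by (simp add: is_unit_const_poly_iff dvd_field_iff)
  ultimately show ?thesis using irreducible_mult_unit_left[of "[:c:]" p] assms(2) by simp
qed

lemma ex_irreducible_factor:
  fixes p :: "'f::field poly"
  assumes "degree p > 0"
  obtains q where "irreducible q" "q dvd p"
proof -
  have "\<exists>q. irreducible q \<and> q dvd p"
    using assms
  proof (induction "degree p" arbitrary: p rule: less_induct)
    case less
    show ?case
    proof (cases "irreducible p")
      case False
      have p0: "p \<noteq> 0" using less.prems by auto
      then have "\<not> is_unit p" using is_unit_iff_degree[OF p0] less.prems by simp
      then obtain a b where ab: "p = a * b" "\<not> is_unit a" "\<not> is_unit b"
        using False p0 unfolding irreducible_def by blast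
      then have "a \<noteq> 0" "b \<noteq> 0" using p0 by auto
      moreover from this have "degree a > 0" "degree b > 0"
        using ab is_unit_iff_degree[of a] is_unit_iff_degree[of b] by auto
      ultimately have "degree a < degree p" using ab \<open>a \<noteq> 0\<close> \<open>b \<noteq> 0\<close> by (simp add: degree_mult_eq)
      then show ?thesis using less.hyps[of a] \<open>degree a > 0\<close> ab(1) dvd_mult2[of _ a b] by blast
    qed auto
  qed
  then show ?thesis using that by blast
qed

text \<open>The automorphism of F[t] for which maps anticommuting with \<open>u\<close> are
  semilinear. Being a ring automorphism, it is easier to handle than \<open>H_poly (- 1)\<close>,
  from which it differs by the sign \<open>(- 1) ^ degree p\<close>.\<close>

definition tw :: "'f::field poly \<Rightarrow> 'f poly" where
  "tw r = pcompose r [:0, -1:]"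

lemma tw_add: "tw (r + s) = tw r + tw s"
  and tw_diff: "tw (r - s) = tw r - tw s"
  and tw_mult: "tw (r * s) = tw r * tw s"
  and tw_0 [simp]: "tw 0 = 0"
  and tw_1 [simp]: "tw 1 = 1"
  and tw_const [simp]: "tw [:c:] = [:c:]"
  and tw_smult: "tw (smultp c r) = smultp c (tw r)"
  and tw_pCons: "tw (pCons c r) = [:c:] - pCons 0 (tw r)"
  and tw_minus: "tw (- r) = - tw r"
  by (simp_all add: tw_def pcompose_add pcompose_diff pcompose_mult pcompose_smult pcompose_pCons
      pcompose_uminus pcompose_1)

lemma tw_tw [simp]: "tw (tw r) = r"
  by (induction r) (simp_all add: tw_pCons tw_diff tw_minus)

lemma tw_eq_0_iff [simp]: "tw r = 0 \<longleftrightarrow> r = 0"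
  by (metis tw_0 tw_tw)

lemma tw_dvd: "p dvd r \<Longrightarrow> tw p dvd tw r"
  by (auto simp: dvd_def tw_mult)

lemma tw_dvd_iff: "tw p dvd r \<longleftrightarrow> p dvd tw r"
  by (metis tw_dvd tw_tw)

lemma irreducible_tw: "irreducible p \<Longrightarrow> irreducible (tw p)"
proof (rule irreducibleI)
  assume p: "irreducible p"
  then show "tw p \<noteq> 0" by auto
  show "\<not> tw p dvd 1" using p by (simp add: tw_dvd_iff irreducible_not_dvd_one)
  fix a b assume "tw p = a * b"
  then have "p = tw a * tw b" by (metis tw_mult tw_tw)
  then have "tw a dvd 1 \<or> tw b dvd 1" using p by (simp add: irreducible_def)
  then show "a dvd 1 \<or> b dvd 1" by (simp add: tw_dvd_iff)
qed

lemma degree_tw [simp]: "degree (tw r) = degree r"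
proof -
  have "degree (tw s) \<le> degree s" for s :: "'a poly"
    using degree_pcompose_le[of s "[:0, -1:]"] by (simp add: tw_def)
  from this[of r] this[of "tw r"] show ?thesis by simp
qed

text \<open>Equal degrees make the cofactor a constant \<open>e\<close>, and applying
  \<open>tw\<close> twice gives \<open>e * e = 1\<close>.\<close>

lemma irreducible_dvd_tw_cases:
  fixes p :: "'f::field poly"
  assumes "irreducible p" "p dvd tw p"
  obtains e where "tw p = smultp e p" "e * e = 1"
proof -
  obtain k where k: "tw p = p * k" using assms(2) by (auto elim: dvdE)
  have p0: "p \<noteq> 0" using assms by auto
  then have "k \<noteq> 0" using k by auto
  then have "degree k = 0"
    using k p0 degree_tw[of p] by (metis add_cancel_right_right degree_mult_eq)
  then obtain e where e: "k = [:e:]" by (rule degree_eq_zeroE)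
  have "p = tw (smultp e p)" using k e by (metis mult.commute mult_pCons_left pCons_0_0 add.right_neutral mult_zero_left tw_tw)
  then have "p = smultp (e * e) p" using k e by (simp add: tw_smult)
  then have "smultp (e * e - 1) p = 0" by (metis diff_self smult_1_left smult_diff_left)
  then have "e * e = 1" using p0 by simp
  then show ?thesis using that[of e] k e by simp
qed

lemma H_poly_tw: "H_poly (- 1) p = smultp ((- 1) ^ degree p) (tw p)"
  by (simp add: H_poly_def tw_def)

lemma irreducible_degree_pos: "irreducible (p :: 'f::field poly) \<Longrightarrow> 0 < degree p"
  using is_unit_iff_degree[of p] by (auto simp: irreducible_def)

text \<open>A monic irreducible divisor of t is t itself. This is the one prime at which the
  difference of two square-zero summands of \<open>u\<close> may fail to be invertible.\<close>

lemma H_poly_divisor_of_X: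
  fixes p :: "'f::field poly"
  assumes "p \<in> Irr" "p dvd [:0, 1:]"
  shows "H_poly (- 1) p = p"
proof -
  have p: "irreducible p" "lead_coeff p = 1" using assms(1) by (auto simp: Irr_def)
  obtain k where k: "[:0, 1:] = p * k" using assms(2) by (rule dvdE)
  have nz: "p \<noteq> 0" "k \<noteq> 0" using k by auto
  have "degree p + degree k = 1" using degree_mult_eq[OF nz] k by (metis degree_pCons_eq_if one_neq_zero degree_1 one_pCons plus_1_eq_Suc add.right_neutral One_nat_def pCons_0_0)
  moreover have "degree p > 0" by (rule irreducible_degree_pos[OF p(1)])
  ultimately have "degree p = 1" "degree k = 0" by auto
  then obtain c where c: "k = [:c:]" using degree_eq_zeroE by blast
  have e: "[:0, 1:] = smultp c p" using k c by simp
  then have "lead_coeff (smultp c p) = 1" by (metis lead_coeff_pCons(1) lead_coeff_1 one_neq_zero one_pCons)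
  then have "c = 1" using p(2) nz(2) c by simp
  then have "p = [:0, 1:]" using e by simp
  then show ?thesis by (simp add: H_poly_tw tw_pCons)
qed

section \<open>The module over the polynomial ring\<close>

locale endo_space = vector_space scale
  for scale :: "'f::field \<Rightarrow> 'v::ab_group_add \<Rightarrow> 'v" +
  fixes u :: "'v \<Rightarrow> 'v"
  assumes linear_u: "endo scale u"
begin

lemma u_add: "u (x + y) = u x + u y"
  and u_scale: "u (scale c x) = scale c (u x)"
  using linear_u unfolding Vector_Spaces.linear_iff by auto

lemma u_0 [simp]: "u 0 = 0"
  using u_scale[of 0 0] by simp

lemma u_minus: "u (- x) = - u x"
  using u_scale[of "- 1" x] by simp

lemma u_diff: "u (x - y) = u x - u y"
  using u_add[of "x - y" y] by (simp add: algebra_simps)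

lemma u_sum: "u (sum f A) = (\<Sum>i\<in>A. u (f i))"
  by (induction A rule: infinite_finite_induct) (simp_all add: u_add)

definition act :: "'f poly \<Rightarrow> 'v \<Rightarrow> 'v" (infixr "\<cdot>" 75) where
  "r \<cdot> x = (\<Sum>i\<le>degree r. scale (coeff r i) ((u ^^ i) x))"

lemma act_eq_sum: "degree r \<le> n \<Longrightarrow> r \<cdot> x = (\<Sum>i\<le>n. scale (coeff r i) ((u ^^ i) x))"
  unfolding act_def by (rule sum.mono_neutral_left) (auto simp: coeff_eq_0)

lemma act_pCons: "pCons c r \<cdot> x = scale c x + u (r \<cdot> x)"
proof -
  have "pCons c r \<cdot> x = (\<Sum>i\<le>Suc (degree r). scale (coeff (pCons c r) i) ((u ^^ i) x))"
    by (rule act_eq_sum) (simp add: degree_pCons_le)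
  also have "\<dots> = scale c x + (\<Sum>i\<le>degree r. scale (coeff r i) (u ((u ^^ i) x)))"
    by (subst sum.atMost_Suc_shift) simp
  also have "\<dots> = scale c x + u (r \<cdot> x)"
    by (simp add: act_def u_sum u_scale)
  finally show ?thesis .
qed

lemma act_0 [simp]: "0 \<cdot> x = 0"
  by (simp add: act_def)

lemma act_const [simp]: "[:c:] \<cdot> x = scale c x"
  by (simp add: act_pCons)

lemma act_one [simp]: "1 \<cdot> x = x"
  unfolding one_pCons by (simp only: act_const scale_one)

lemma act_add_right: "r \<cdot> (x + y) = r \<cdot> x + r \<cdot> y"
  by (induction r) (simp_all add: act_pCons u_add scale_right_distrib ac_simps)

lemma act_add_left: "(r + s) \<cdot> x = r \<cdot> x + s \<cdot> x"
proof -
  let ?n = "max (degree r) (degree s)"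
  have "degree (r + s) \<le> ?n" by (rule degree_add_le_max)
  then show ?thesis
    by (simp add: act_eq_sum[of _ ?n] scale_left_distrib sum.distrib)
qed

lemma act_smult: "smultp c r \<cdot> x = scale c (r \<cdot> x)"
  by (induction r) (simp_all add: act_pCons u_scale scale_right_distrib)

lemma act_mult: "(r * s) \<cdot> x = r \<cdot> s \<cdot> x"
  by (induction r) (simp_all add: act_pCons act_add_left act_smult)

text \<open>From here on \<open>m.subspace\<close> means F[t]-submodule, whereas plain
  \<open>subspace\<close> means F-linear subspace.\<close>

sublocale m: Modules.module act
  by unfold_locales (simp_all add: act_add_right act_add_left act_mult)

declare m.scale_scale [simp del]

lemma end_module_simps [simp]:
  "carrier (end_module scale u) = UNIV"
  "module.smult (end_module scale u) = act"
  "zero (end_module scale u) = 0"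
  "add (end_module scale u) = (+)"
  by (simp_all add: end_module_def act_def fun_eq_iff)

lemma act_commute: "r \<cdot> s \<cdot> x = s \<cdot> r \<cdot> x"
  by (simp only: act_mult[symmetric] mult.commute)

lemma act_X: "[:0, 1:] \<cdot> x = u x"
  by (simp add: act_pCons)

lemma subspace_pm: "m.subspace W \<Longrightarrow> subspace W"
  using m.subspace_scale[of W _ "[:_:]"]
  by (intro subspaceI) (auto intro: m.subspace_0 m.subspace_add)

lemma act_scale: "r \<cdot> scale c x = scale c (r \<cdot> x)"
  by (metis act_commute act_const)

lemma pm_subspace_act_image: "m.subspace W \<Longrightarrow> m.subspace (act r ` W)"
  by (intro m.subspaceI)
    (auto simp: m.subspace_0 m.subspace_add m.subspace_scale act_commute[of _ r]
      simp flip: act_add_right intro!: imageI image_eqI[of 0 _ 0])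

lemma bezout_act: "a * r + b * p = 1 \<Longrightarrow> a \<cdot> r \<cdot> x + b \<cdot> p \<cdot> x = x"
  unfolding act_mult[symmetric] act_add_left[symmetric] by simp

end

section \<open>Transfinite powers\<close>

text \<open>The span of a finite subset of the basis contains only finitely many members of
  \<open>I\<close>, and a countable set has countably many finite subsets.\<close>

lemma (in vector_space) independent_countable:
  assumes "countable_dim scale" "independent I"
  shows "countable I"
proof -
  obtain B where B: "countable B" "span B = UNIV"
    using assms(1) unfolding countable_dim_def by blast
  have fin: "finite (I \<inter> span F)" if "finite F" for F
    using independent_span_bound[of F "I \<inter> span F"] that independent_mono[OF assms(2)] by auto
  have "I \<subseteq> (\<Union>F\<in>{F. finite F \<and> F \<subseteq> B}. I \<inter> span F)"
  proof
    fix x assume x: "x \<in> I"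
    have "x \<in> span B" using B by simp
    then obtain F c where "finite F" "F \<subseteq> B" "x = (\<Sum>a\<in>F. scale (c a) a)"
      unfolding span_explicit by blast
    moreover from this have "x \<in> span F" by (auto intro: span_sum span_scale span_base)
    ultimately show "x \<in> (\<Union>F\<in>{F. finite F \<and> F \<subseteq> B}. I \<inter> span F)" using x by blast
  qed
  moreover have "countable (\<Union>F\<in>{F. finite F \<and> F \<subseteq> B}. I \<inter> span F)"
    by (intro countable_UN) (use B(1) countable_Collect_finite_subset[of B] fin in
        \<open>auto intro: countable_finite\<close>)
  ultimately show ?thesis by (rule countable_subset)
qed

text \<open>The filtration is needed along two well-orders, \<open>omega1\<close> and the cardinal
  used in \<open>p_power_inf\<close>. An infinite cardinal has no last element, so every ordinal
  below it has its true successor there.\<close>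

locale limit_card =
  fixes r :: "'i rel"
  assumes card_r: "Card_order r" and inf_r: "infinite (Field r)"
begin

lemma well_r: "Well_order r"
  using card_r by (simp add: card_order_on_well_order_on)

sublocale wo_rel r
  by unfold_locales (rule well_r)

abbreviation sc :: "'i \<Rightarrow> 'i" where
  "sc \<alpha> \<equiv> suc {\<alpha>}"

lemma above_nonempty: "\<alpha> \<in> Field r \<Longrightarrow> aboveS \<alpha> \<noteq> {}"
  using infinite_Card_order_limit[OF card_r inf_r] by (fastforce simp: aboveS_def)

lemma AboveS_nonempty: "\<alpha> \<in> Field r \<Longrightarrow> AboveS {\<alpha>} \<noteq> {}"
  using infinite_Card_order_limit[OF card_r inf_r] by (fastforce simp: AboveS_def)

lemma sc_Field [simp]: "\<alpha> \<in> Field r \<Longrightarrow> sc \<alpha> \<in> Field r"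
  using suc_inField[of "{\<alpha>}"] AboveS_nonempty by blast

lemma sc_greater: "\<alpha> \<in> Field r \<Longrightarrow> (\<alpha>, sc \<alpha>) \<in> r" "\<alpha> \<in> Field r \<Longrightarrow> sc \<alpha> \<noteq> \<alpha>"
  using suc_greater[of "{\<alpha>}" \<alpha>] AboveS_nonempty[of \<alpha>] by auto

lemma sc_least: "(\<alpha>, \<beta>) \<in> r \<Longrightarrow> \<alpha> \<noteq> \<beta> \<Longrightarrow> (sc \<alpha>, \<beta>) \<in> r"
  by (rule suc_least_AboveS) (auto simp: AboveS_def Field_def)

lemma not_below: "\<alpha> \<in> Field r \<Longrightarrow> \<beta> \<in> Field r \<Longrightarrow> (\<alpha>, \<beta>) \<notin> r \<Longrightarrow> (sc \<beta>, \<alpha>) \<in> r"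
  using TOTALS sc_least by (metis)

end

lemma limit_card_omega1: "limit_card omega1"
proof
  have n: "Card_order natLeq" by (rule natLeq_Card_order)
  show "Card_order omega1" unfolding omega1_def by (rule cardSuc_Card_order[OF n])
  show "infinite (Field omega1)"
    unfolding omega1_def using cardSuc_finite[OF n] by (simp add: Field_natLeq)
qed

lemma uncountable_omega1: "uncountable (Field omega1)"
proof
  assume "countable (Field omega1)"
  then obtain f :: "_ \<Rightarrow> nat" where "inj_on f (Field omega1)"
    unfolding countable_def by blast
  then have "|Field omega1| \<le>o |UNIV :: nat set|"
    by (rule card_of_ordLeqI) simp
  then have "|Field omega1| \<le>o natLeq"
    using card_of_nat by (rule ordLeq_ordIso_trans)
  moreover have "|Field omega1| =o omega1"
    by (rule card_of_Field_ordIso[OF limit_card.card_r[OF limit_card_omega1]])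
  ultimately have "omega1 \<le>o natLeq"
    using ordIso_ordLeq_trans ordIso_symmetric by blast
  then show False
    unfolding omega1_def using cardSuc_greater[OF natLeq_Card_order] not_ordLess_ordLeq by blast
qed

locale endo_filtration = endo_space scale u + limit_card r
  for scale :: "'f::field \<Rightarrow> 'v::ab_group_add \<Rightarrow> 'v" and u :: "'v \<Rightarrow> 'v" and r :: "'i rel"
begin

definition P :: "'f poly \<Rightarrow> 'i \<Rightarrow> 'v set" where
  "P p \<alpha> = p_power r (end_module scale u) p \<alpha>"

text \<open>Whether \<alpha> is a successor or a limit does not depend on the polynomial. The last
  two alternatives are therefore stated for all \<open>q\<close>, which lets one induction compare
  the filtrations of two polynomials.\<close>

lemma P_cases:
  obtains "P p \<alpha> = UNIV" "underS \<alpha> = {}"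
    | \<beta> where "\<beta> \<in> underS \<alpha>" "\<alpha> = sc \<beta>" "\<And>q. P q \<alpha> = act q ` P q \<beta>"
    | "\<And>q. P q \<alpha> = (\<Inter>\<beta>\<in>underS \<alpha>. P q \<beta>)" "underS \<alpha> \<noteq> {}"
proof (cases "underS \<alpha> = {}")
  case True
  then show ?thesis using that(1) True by (simp add: P_def p_power_zero[OF well_r True])
next
  case False
  show ?thesis
  proof (cases "\<exists>\<beta>. \<beta> \<in> underS \<alpha> \<and> \<alpha> = sc \<beta>")
    case True
    then obtain \<beta> where b: "\<beta> \<in> underS \<alpha>" "\<alpha> = sc \<beta>" by blast
    then have "\<beta> \<in> Field r" by (auto simp: underS_def Field_def)
    then have "P q \<alpha> = act q ` P q \<beta>" for q
      unfolding P_def b(2) by (subst p_power_suc[OF well_r above_nonempty]) simp_all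
    then show ?thesis using that(2) b by blast
  next
    case False
    then have "P q \<alpha> = (\<Inter>\<beta>\<in>underS \<alpha>. P q \<beta>)" for q
      unfolding P_def using \<open>underS \<alpha> \<noteq> {}\<close> by (intro p_power_limit[OF well_r]) auto
    then show ?thesis using that(3) \<open>underS \<alpha> \<noteq> {}\<close> by blast
  qed
qed

lemma P_zero: "underS \<alpha> = {} \<Longrightarrow> P p \<alpha> = UNIV"
  by (simp add: P_def p_power_zero[OF well_r])

lemma P_suc: "\<alpha> \<in> Field r \<Longrightarrow> P p (sc \<alpha>) = act p ` P p \<alpha>"
  unfolding P_def by (subst p_power_suc[OF well_r above_nonempty]) simp_all

lemma P_induct:
  assumes "Q UNIV" "\<And>W. Q W \<Longrightarrow> Q (act p ` W)" "\<And>F. F \<noteq> {} \<Longrightarrow> (\<And>W. W \<in> F \<Longrightarrow> Q W) \<Longrightarrow> Q (\<Inter>F)"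
  shows "Q (P p \<alpha>)"
proof (induction \<alpha> rule: well_order_induct)
  case (1 \<alpha>)
  then have IH: "Q (P p \<beta>)" if "\<beta> \<in> underS \<alpha>" for \<beta>
    using that by (auto simp: underS_def)
  show ?case
  proof (cases rule: P_cases[of p \<alpha>])
    case 1 then show ?thesis using assms(1) by simp
  next
    case (2 \<beta>) then show ?thesis using IH[of \<beta>] assms(2) by metis
  next
    case 3
    then show ?thesis using IH assms(3)[of "P p ` underS \<alpha>"] by auto
  qed
qed

lemma P_subspace: "m.subspace (P p \<alpha>)"
  by (rule P_induct) (auto intro: pm_subspace_act_image m.subspace_Inter)

lemma P_zero_mem [simp]: "0 \<in> P p \<alpha>"
  by (rule m.subspace_0[OF P_subspace])

lemma act_image_subset: "m.subspace W \<Longrightarrow> act q ` W \<subseteq> W"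
  by (auto intro: m.subspace_scale)

lemma P_antimono: "(\<alpha>, \<beta>) \<in> r \<Longrightarrow> P p \<beta> \<subseteq> P p \<alpha>"
proof (induction \<beta> arbitrary: \<alpha> rule: well_order_induct)
  case (1 \<beta>)
  show ?case
  proof (cases "\<alpha> = \<beta>")
    case False
    then have a: "\<alpha> \<in> underS \<beta>" using "1.prems" by (auto simp: underS_def)
    show ?thesis
    proof (cases rule: P_cases[of p \<beta>])
      case 1 then show ?thesis using a by blast
    next
      case (2 \<gamma>)
      then have g: "\<gamma> \<noteq> \<beta>" "(\<gamma>, \<beta>) \<in> r" "\<gamma> \<in> Field r" by (auto simp: underS_def Field_def)
      have "(\<alpha>, \<gamma>) \<in> r"
      proof (rule ccontr)
        assume "(\<alpha>, \<gamma>) \<notin> r"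
        then have "(sc \<gamma>, \<alpha>) \<in> r"
          using not_below "1.prems" g by (auto simp: Field_def)
        then show False using "1.prems" \<open>\<beta> = sc \<gamma>\<close> False ANTISYM by (auto simp: antisym_def)
      qed
      then have "P p \<gamma> \<subseteq> P p \<alpha>" using "1.IH" g by auto
      then show ?thesis using 2(3) act_image_subset[OF P_subspace] by blast
    next
      case 3 then show ?thesis using a by blast
    qed
  qed auto
qed

lemma P_suc_subset: "\<alpha> \<in> Field r \<Longrightarrow> P p (sc \<alpha>) \<subseteq> P p \<alpha>"
  by (intro P_antimono sc_greater)

lemma P_chain: "\<alpha> \<in> Field r \<Longrightarrow> \<beta> \<in> Field r \<Longrightarrow> P p \<alpha> \<subseteq> P p \<beta> \<or> P p \<beta> \<subseteq> P p \<alpha>"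
  using TOTALS P_antimono by metis

text \<open>\<open>\<delta>\<close> is the height of \<open>x\<close> at \<open>p\<close>: the first
  ordinal at which \<open>x\<close> has dropped out is neither zero nor a limit, hence a
  successor.\<close>

lemma P_height:
  assumes "\<gamma> \<in> Field r" "x \<notin> P p \<gamma>"
  obtains \<delta> where "\<delta> \<in> Field r" "x \<in> P p \<delta>" "x \<notin> P p (sc \<delta>)"
proof -
  have "\<exists>\<delta>\<in>Field r. x \<in> P p \<delta> \<and> x \<notin> P p (sc \<delta>)"
    using assms
  proof (induction \<gamma> rule: well_order_induct)
    case (1 \<gamma>)
    show ?case
    proof (cases rule: P_cases[of p \<gamma>])
      case 1 then show ?thesis using \<open>x \<notin> P p \<gamma>\<close> by simp
    next
      case (2 \<beta>)
      then have b: "\<beta> \<noteq> \<gamma>" "(\<beta>, \<gamma>) \<in> r" "\<beta> \<in> Field r" by (auto simp: underS_def Field_def)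
      show ?thesis
      proof (cases "x \<in> P p \<beta>")
        case True
        then show ?thesis using b \<open>x \<notin> P p \<gamma>\<close> 2(2) by blast
      next
        case False
        then show ?thesis using "1.IH" b by blast
      qed
    next
      case 3
      then obtain \<beta> where "\<beta> \<in> underS \<gamma>" "x \<notin> P p \<beta>" using "1.prems" by blast
      then show ?thesis using "1.IH" by (auto simp: underS_def Field_def)
    qed
  qed
  then show ?thesis using that by blast
qed

lemma P_above:
  assumes "\<alpha> \<in> Field r" "\<delta> \<in> Field r" "x \<in> P p \<delta>" "x \<notin> P p \<alpha>"
  shows "P p \<alpha> \<subseteq> P p (sc \<delta>)"
proof -
  have "(\<alpha>, \<delta>) \<notin> r" using P_antimono assms by blast
  then show ?thesis using not_below assms P_antimono by blast
qed

text \<open>If q y = p w with w and y in one stage, then y = p (a w + b y) lies in the next. So a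
  polynomial prime to \<open>p\<close> changes no height at \<open>p\<close>, which keeps the primes
  apart in all extension steps.\<close>

lemma P_coprime:
  assumes "a * q + b * p = 1" "q \<cdot> y \<in> P p \<alpha>"
  shows "y \<in> P p \<alpha>"
proof -
  have "m.subspace (P p \<alpha>) \<and> (\<forall>y. q \<cdot> y \<in> P p \<alpha> \<longrightarrow> y \<in> P p \<alpha>)"
  proof (rule P_induct, goal_cases)
    case (2 W)
    then have W: "m.subspace W" by blast
    have "y \<in> act p ` W" if y: "q \<cdot> y \<in> act p ` W" for y
    proof -
      obtain w where w: "q \<cdot> y = p \<cdot> w" "w \<in> W" using y by blast
      then have "y \<in> W" using 2 m.subspace_scale[OF W] by metis
      have "y = a \<cdot> q \<cdot> y + b \<cdot> p \<cdot> y" using bezout_act[OF assms(1)] by simp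
      also have "\<dots> = p \<cdot> (a \<cdot> w + b \<cdot> y)"
        by (simp add: w act_add_right act_commute[of p])
      finally show ?thesis
        using W w \<open>y \<in> W\<close> by (auto intro: m.subspace_add m.subspace_scale)
    qed
    then show ?case using W pm_subspace_act_image by blast
  next
    case (3 F)
    then show ?case by (auto intro: m.subspace_Inter)
  qed auto
  then show ?thesis using assms(2) by blast
qed

lemma act_smult_image:
  assumes "m.subspace W" "c \<noteq> 0"
  shows "act (smultp c p) ` W = act p ` W"
proof -
  have "act (smultp c p) x = act p (scale c x)" for x by (simp add: act_smult act_scale)
  moreover have "scale c ` W = W"
  proof
    show "scale c ` W \<subseteq> W" using subspace_pm[OF assms(1)] by (auto intro: subspace_scale)
    show "W \<subseteq> scale c ` W"
    proof
      fix x assume "x \<in> W"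
      then have "scale (inverse c) x \<in> W" using subspace_pm[OF assms(1)] by (auto intro: subspace_scale)
      moreover have "x = scale c (scale (inverse c) x)" using assms(2) by simp
      ultimately show "x \<in> scale c ` W" by blast
    qed
  qed
  ultimately show ?thesis by (metis (no_types, lifting) image_cong image_image)
qed

lemma P_smult: "c \<noteq> 0 \<Longrightarrow> P (smultp c p) \<alpha> = P p \<alpha>"
proof (induction \<alpha> rule: well_order_induct)
  case (1 \<alpha>)
  then have IH: "P (smultp c p) \<beta> = P p \<beta>" if "\<beta> \<in> underS \<alpha>" for \<beta>
    using that by (auto simp: underS_def)
  show ?case
  proof (cases rule: P_cases[of p \<alpha>])
    case 1 then show ?thesis using P_zero by simp
  next
    case (2 \<beta>)
    then show ?thesis using IH[of \<beta>] act_smult_image[OF P_subspace \<open>c \<noteq> 0\<close>] by metis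
  next
    case 3 then show ?thesis using IH by simp
  qed
qed

lemma P_skew:
  assumes "\<And>s x. w (s \<cdot> x) = tw s \<cdot> w x" "x \<in> P p \<alpha>"
  shows "w x \<in> P (tw p) \<alpha>"
  using assms(2)
proof (induction \<alpha> arbitrary: x rule: well_order_induct)
  case (1 \<alpha>)
  have IH: "\<And>x. x \<in> P p \<beta> \<Longrightarrow> w x \<in> P (tw p) \<beta>" if "\<beta> \<in> underS \<alpha>" for \<beta>
    using that "1.IH" by (auto simp: underS_def)
  show ?case
  proof (cases rule: P_cases[of p \<alpha>])
    case 1 then show ?thesis using P_zero by simp
  next
    case (2 \<beta>)
    then obtain y where "x = p \<cdot> y" "y \<in> P p \<beta>" using "1.prems" by auto
    then show ?thesis using IH[of \<beta> y] 2 assms(1) by auto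
  next
    case 3 then show ?thesis using IH "1.prems" by auto
  qed
qed

text \<open>In a vanishing combination, the term of least height would be a combination of members
  of the next stage. The number of strict drops of the filtration is thereby bounded by the
  dimension of V.\<close>

lemma P_independent:
  assumes A: "A \<subseteq> Field r" and x: "\<And>\<alpha>. \<alpha> \<in> A \<Longrightarrow> x \<alpha> \<in> P p \<alpha> \<and> x \<alpha> \<notin> P p (sc \<alpha>)"
  shows "inj_on x A" "independent (x ` A)"
proof -
  have less: "x \<beta> \<in> P p (sc \<alpha>)" if "\<alpha> \<in> A" "\<beta> \<in> A" "\<alpha> \<noteq> \<beta>" "(\<alpha>, \<beta>) \<in> r" for \<alpha> \<beta>
    using P_antimono[OF sc_least[of \<alpha> \<beta>]] that x by blast
  show inj: "inj_on x A"
  proof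
    fix \<alpha> \<beta> assume ab: "\<alpha> \<in> A" "\<beta> \<in> A" "x \<alpha> = x \<beta>"
    then have "(\<alpha>, \<beta>) \<in> r \<or> (\<beta>, \<alpha>) \<in> r" using TOTALS A by blast
    then show "\<alpha> = \<beta>" using less[of \<alpha> \<beta>] less[of \<beta> \<alpha>] ab x by metis
  qed
  show "independent (x ` A)"
    unfolding independent_explicit_module
  proof (intro allI impI, rule ccontr)
    fix T c v assume T: "finite T" "T \<subseteq> x ` A" and s: "(\<Sum>v\<in>T. scale (c v) v) = 0"
      and v: "v \<in> T" "c v \<noteq> 0"
    define I where "I = {\<alpha>\<in>A. x \<alpha> \<in> T \<and> c (x \<alpha>) \<noteq> 0}"
    have "I \<subseteq> Field r" "I \<noteq> {}" using A v T unfolding I_def by auto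
    then have m: "minim I \<in> I" "\<And>\<beta>. \<beta> \<in> I \<Longrightarrow> (minim I, \<beta>) \<in> r"
      using minim_in minim_least by auto
    define \<alpha> where "\<alpha> = minim I"
    have a: "\<alpha> \<in> A" "x \<alpha> \<in> T" "c (x \<alpha>) \<noteq> 0" using m(1) by (auto simp: \<alpha>_def I_def)
    have S: "subspace (P p (sc \<alpha>))" by (rule subspace_pm[OF P_subspace])
    have "scale (c (x \<alpha>)) (x \<alpha>) + (\<Sum>v\<in>T - {x \<alpha>}. scale (c v) v) = 0"
      using s a T by (simp add: sum.remove)
    then have "scale (c (x \<alpha>)) (x \<alpha>) = - (\<Sum>v\<in>T - {x \<alpha>}. scale (c v) v)"
      by (simp add: eq_neg_iff_add_eq_0)
    moreover have "(\<Sum>v\<in>T - {x \<alpha>}. scale (c v) v) \<in> P p (sc \<alpha>)"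
    proof (rule subspace_sum[OF S])
      fix v assume v: "v \<in> T - {x \<alpha>}"
      show "scale (c v) v \<in> P p (sc \<alpha>)"
      proof (cases "c v = 0")
        case True then show ?thesis by simp
      next
        case False
        obtain \<beta> where b: "\<beta> \<in> A" "v = x \<beta>" using v T by blast
        then have "\<beta> \<in> I" using False v by (auto simp: I_def)
        then have "(\<alpha>, \<beta>) \<in> r" using m by (simp add: \<alpha>_def)
        moreover have "\<alpha> \<noteq> \<beta>" using b v by auto
        ultimately show ?thesis using less a b by (simp add: subspace_scale[OF S])
      qed
    qed
    ultimately have "scale (c (x \<alpha>)) (x \<alpha>) \<in> P p (sc \<alpha>)" by (simp add: subspace_neg[OF S])
    then have "scale (inverse (c (x \<alpha>))) (scale (c (x \<alpha>)) (x \<alpha>)) \<in> P p (sc \<alpha>)"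
      by (rule subspace_scale[OF S])
    then show False using a x by simp
  qed
qed

lemma P_stable_above:
  assumes a: "\<alpha> \<in> Field r" "P p (sc \<alpha>) = P p \<alpha>" and b: "(\<alpha>, \<beta>) \<in> r"
  shows "P p \<beta> = P p \<alpha>"
  using b
proof (induction \<beta> rule: well_order_induct)
  case (1 \<gamma>)
  show ?case
  proof (cases "\<gamma> = \<alpha>")
    case False
    then have ag: "\<alpha> \<in> underS \<gamma>" using "1.prems" by (auto simp: underS_def)
    show ?thesis
    proof (cases rule: P_cases[of p \<gamma>])
      case 1 then show ?thesis using ag by blast
    next
      case (2 \<beta>)
      then have bf: "\<beta> \<in> Field r" "\<beta> \<noteq> \<gamma>" "(\<beta>, \<gamma>) \<in> r" by (auto simp: underS_def Field_def)
      have "(\<alpha>, \<beta>) \<in> r"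
      proof (rule ccontr)
        assume "(\<alpha>, \<beta>) \<notin> r"
        then have "(sc \<beta>, \<alpha>) \<in> r" using not_below a bf by blast
        then show False using "1.prems" 2 False ANTISYM by (auto simp: antisym_def)
      qed
      then have "P p \<beta> = P p \<alpha>" using "1.IH" bf by auto
      then show ?thesis using 2(2) P_suc[OF bf(1)] P_suc[OF a(1)] a(2) by simp
    next
      case 3
      have "P p \<alpha> \<subseteq> P p \<beta>" if "\<beta> \<in> underS \<gamma>" for \<beta>
      proof (cases "(\<alpha>, \<beta>) \<in> r")
        case True then show ?thesis using "1.IH" that by (auto simp: underS_def)
      next
        case False
        then have "(\<beta>, \<alpha>) \<in> r" using TOTALS a(1) that by (auto simp: underS_def Field_def)
        then show ?thesis by (rule P_antimono)
      qed
      then show ?thesis using 3(1)[of p] ag by blast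
    qed
  qed simp
qed

text \<open>The final value of the filtration is thus the largest set contained in its own image
  under p, a description in which the well-order does not occur.\<close>

lemma P_greatest:
  assumes "W \<subseteq> act p ` W"
  shows "W \<subseteq> P p \<alpha>"
proof (rule P_induct[where Q = "\<lambda>X. W \<subseteq> X"])
  fix X assume "W \<subseteq> X"
  then have "act p ` W \<subseteq> act p ` X" by (rule image_mono)
  then show "W \<subseteq> act p ` X" using assms by (rule order_trans[rotated])
qed (auto intro: Inter_greatest)

end

section \<open>Heights in a space of countable dimension\<close>

lemma (in vector_space) double_eq_scale: "x + x = scale 2 x"
  by (metis one_add_one scale_left_distrib scale_one)

definition (in vector_space) fin_span :: "'b set \<Rightarrow> bool" where
  "fin_span S \<longleftrightarrow> (\<exists>F. finite F \<and> S \<subseteq> span F)"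

lemma (in vector_space) dim_strict_mono:
  assumes "subspace A" "A \<subset> B" "fin_span B"
  shows "dim A < dim B"
proof -
  obtain F where F: "finite F" "B \<subseteq> span F" using assms(3) unfolding fin_span_def by blast
  obtain C where C: "C \<subseteq> A" "independent C" "A \<subseteq> span C" "card C = dim A"
    by (rule basis_exists)
  obtain E where E: "E \<subseteq> B" "independent E" "B \<subseteq> span E" "card E = dim B"
    by (rule basis_exists)
  have "finite E" using independent_span_bound[OF F(1) E(2)] E F by blast
  obtain x where x: "x \<in> B" "x \<notin> A" using assms(2) by blast
  have "span C \<subseteq> A" using C assms(1) by (simp add: span_minimal)
  then have "x \<notin> span C" using x by blast
  then have i: "independent (insert x C)" "x \<notin> C" using C span_base by (auto simp: independent_insertI)
  have "insert x C \<subseteq> span E" using x C E assms(2) by blast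
  from independent_span_bound[OF \<open>finite E\<close> i(1) this]
  have "finite C" "card (insert x C) \<le> card E" by auto
  then show ?thesis using C E \<open>x \<notin> C\<close> by simp
qed

lemma (in vector_space) fin_span_mono: "fin_span B \<Longrightarrow> A \<subseteq> B \<Longrightarrow> fin_span A"
  unfolding fin_span_def by blast

locale countable_endo = endo_space +
  assumes countable_dim: "countable_dim scale"
begin

sublocale endo_filtration scale u omega1
  by (simp add: endo_filtration_def endo_space_axioms limit_card_omega1)

definition D :: "'a poly \<Rightarrow> 'b set" where
  "D p = (\<Inter>\<alpha>\<in>Field omega1. P p \<alpha>)"

text \<open>Strict drops at all ordinals below \<open>omega1\<close> would produce uncountably many
  independent vectors.\<close>

lemma P_stabilizes: "\<exists>\<alpha>\<in>Field omega1. P p (sc \<alpha>) = P p \<alpha>"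
proof (rule ccontr)
  assume "\<not> ?thesis"
  then have "\<forall>\<alpha>\<in>Field omega1. \<exists>x. x \<in> P p \<alpha> \<and> x \<notin> P p (sc \<alpha>)"
    using P_suc_subset by blast
  then obtain x where "\<And>\<alpha>. \<alpha> \<in> Field omega1 \<Longrightarrow> x \<alpha> \<in> P p \<alpha> \<and> x \<alpha> \<notin> P p (sc \<alpha>)"
    by metis
  then have x: "inj_on x (Field omega1)" "independent (x ` Field omega1)"
    using P_independent[of "Field omega1" x p] by blast+
  then have "countable (x ` Field omega1)"
    using independent_countable[OF countable_dim] by blast
  then show False using uncountable_omega1 x(1) countable_image_inj_on by blast
qed

lemma D_eq_P:
  obtains \<alpha> where "\<alpha> \<in> Field omega1" "D p = P p \<alpha>" "P p (sc \<alpha>) = P p \<alpha>"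
proof -
  obtain \<alpha> where a: "\<alpha> \<in> Field omega1" "P p (sc \<alpha>) = P p \<alpha>" using P_stabilizes by blast
  have "P p \<alpha> \<subseteq> P p \<beta>" if "\<beta> \<in> Field omega1" for \<beta>
  proof (cases "(\<alpha>, \<beta>) \<in> omega1")
    case True then show ?thesis using P_stable_above[OF a] by simp
  next
    case False
    then have "(\<beta>, \<alpha>) \<in> omega1" using TOTALS a that by blast
    then show ?thesis by (rule P_antimono)
  qed
  then have "D p = P p \<alpha>" using a by (auto simp: D_def)
  then show ?thesis using that a by blast
qed

lemma D_act: "act p ` D p = D p"
proof (rule D_eq_P[of p])
  fix \<alpha> assume "\<alpha> \<in> Field omega1" "D p = P p \<alpha>" "P p (sc \<alpha>) = P p \<alpha>"
  then show ?thesis using P_suc[of \<alpha> p] by metis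
qed

lemma D_subspace: "m.subspace (D p)"
proof (rule D_eq_P[of p])
  fix \<alpha> assume "D p = P p \<alpha>"
  then show ?thesis by (simp only: P_subspace)
qed

lemma D_subset: "\<alpha> \<in> Field omega1 \<Longrightarrow> D p \<subseteq> P p \<alpha>"
  by (auto simp: D_def)

lemma D_height:
  assumes "x \<notin> D p"
  obtains \<delta> where "\<delta> \<in> Field omega1" "x \<in> P p \<delta>" "x \<notin> P p (sc \<delta>)"
proof -
  obtain \<gamma> where "\<gamma> \<in> Field omega1" "x \<notin> P p \<gamma>" using assms unfolding D_def by blast
  then show ?thesis by (rule P_height) (rule that)
qed

lemma D_smult: "c \<noteq> 0 \<Longrightarrow> D (smultp c p) = D p"
  by (simp add: D_def P_smult)

text \<open>Along either well-order the filtration becomes constant. Each final value is its own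
  image under p and is therefore contained in every stage of the other filtration.\<close>

lemma p_power_inf_eq: "p_power_inf (end_module scale u) p = D p"
proof -
  define r where "r = cardSuc |UNIV :: (nat + 'b) set|"
  have "limit_card r"
  proof
    show "Card_order r" unfolding r_def by (rule cardSuc_Card_order[OF card_of_Card_order])
    show "infinite (Field r)"
      unfolding r_def by (simp add: cardSuc_finite[OF card_of_Card_order] Field_card_of)
  qed
  then interpret r: limit_card r .
  interpret rf: endo_filtration scale u r by unfold_locales
  have "\<exists>\<alpha>\<in>Field r. rf.P p (r.sc \<alpha>) = rf.P p \<alpha>"
  proof (rule ccontr)
    assume "\<not> ?thesis"
    then have "\<forall>\<alpha>\<in>Field r. \<exists>x. x \<in> rf.P p \<alpha> \<and> x \<notin> rf.P p (r.sc \<alpha>)"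
      using rf.P_suc_subset by blast
    then obtain x where "\<And>\<alpha>. \<alpha> \<in> Field r \<Longrightarrow> x \<alpha> \<in> rf.P p \<alpha> \<and> x \<alpha> \<notin> rf.P p (r.sc \<alpha>)"
      by metis
    then have "inj_on x (Field r)" using rf.P_independent[of "Field r" x p] by blast
    then have "inj_on (Inr \<circ> x :: _ \<Rightarrow> nat + 'b) (Field r)" by (auto simp: inj_on_def)
    then have "|Field r| \<le>o |UNIV :: (nat + 'b) set|" by (rule card_of_ordLeqI) simp
    then have "r \<le>o |UNIV :: (nat + 'b) set|"
      using card_of_Field_ordIso[OF r.card_r] ordIso_ordLeq_trans ordIso_symmetric by blast
    then show False
      unfolding r_def using cardSuc_greater[OF card_of_Card_order] not_ordLess_ordLeq by blast
  qed
  then obtain \<alpha> where a: "\<alpha> \<in> Field r" "rf.P p (r.sc \<alpha>) = rf.P p \<alpha>" by blast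
  have aD: "rf.P p \<alpha> = D p"
  proof
    have "rf.P p \<alpha> = act p ` rf.P p \<alpha>" using a rf.P_suc by metis
    then show "rf.P p \<alpha> \<subseteq> D p" using P_greatest[of "rf.P p \<alpha>" p] by (auto simp: D_def)
    show "D p \<subseteq> rf.P p \<alpha>" by (rule rf.P_greatest) (simp add: D_act)
  qed
  have st: "\<forall>\<beta>. (\<alpha>, \<beta>) \<in> r \<longrightarrow> rf.P p \<beta> = D p"
    using rf.P_stable_above[OF a] aD by simp
  have "(THE W. \<exists>\<alpha>\<in>Field r. \<forall>\<beta>. (\<alpha>, \<beta>) \<in> r \<longrightarrow> rf.P p \<beta> = W) = D p"
  proof (rule the_equality)
    show "\<exists>\<alpha>\<in>Field r. \<forall>\<beta>. (\<alpha>, \<beta>) \<in> r \<longrightarrow> rf.P p \<beta> = D p" using st a by blast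
    fix W assume "\<exists>\<alpha>\<in>Field r. \<forall>\<beta>. (\<alpha>, \<beta>) \<in> r \<longrightarrow> rf.P p \<beta> = W"
    then obtain \<gamma> where g: "\<gamma> \<in> Field r" "\<And>\<beta>. (\<gamma>, \<beta>) \<in> r \<Longrightarrow> rf.P p \<beta> = W" by blast
    have refl: "(\<alpha>, \<alpha>) \<in> r" "(\<gamma>, \<gamma>) \<in> r"
      using r.REFL a g by (auto simp: refl_on_def)
    have "(\<alpha>, \<gamma>) \<in> r \<or> (\<gamma>, \<alpha>) \<in> r" using r.TOTALS a g by blast
    then show "W = D p" using g(2) st refl by metis
  qed
  then show ?thesis unfolding rf.P_def unfolding r_def p_power_inf_def Let_def .
qed

section \<open>Heights encoded as submodules, and elements of maximal height\<close>

definition level :: "'a poly \<Rightarrow> 'b set \<Rightarrow> bool" where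
  "level p L \<longleftrightarrow> L = D p \<or> (\<exists>\<alpha>\<in>Field omega1. L = P p \<alpha>)"

lemma level_subspace: "level p L \<Longrightarrow> m.subspace L"
  unfolding level_def by (auto simp: D_subspace P_subspace)

text \<open>If \<open>y\<close> has height \<delta> at \<open>p\<close>, this is
  \<open>P p \<delta>\<close>; if \<open>y\<close> lies in \<open>D p\<close>, it is
  \<open>D p\<close>. Heights, infinity included, are thus compared as submodules.\<close>

definition hull_level :: "'a poly \<Rightarrow> 'b \<Rightarrow> 'b set" where
  "hull_level p y = \<Inter>{P p \<alpha> | \<alpha>. \<alpha> \<in> Field omega1 \<and> y \<in> P p \<alpha>}"

lemma subspace_hull_level: "m.subspace (hull_level p y)"
  unfolding hull_level_def by (auto intro!: m.subspace_Inter P_subspace)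

lemma mem_hull_level: "y \<in> hull_level p y"
  unfolding hull_level_def by blast

lemma hull_level_subset: "\<alpha> \<in> Field omega1 \<Longrightarrow> y \<in> P p \<alpha> \<Longrightarrow> hull_level p y \<subseteq> P p \<alpha>"
  unfolding hull_level_def by blast

lemma hull_level_superset:
  assumes "\<alpha> \<in> Field omega1" "y \<notin> P p \<alpha>"
  shows "P p \<alpha> \<subseteq> hull_level p y"
proof -
  have "P p \<alpha> \<subseteq> P p \<beta>" if "\<beta> \<in> Field omega1" "y \<in> P p \<beta>" for \<beta>
    using P_chain[OF assms(1) that(1), of p] assms(2) that(2) by auto
  then show ?thesis unfolding hull_level_def by auto
qed

text \<open>The heights occurring in \<open>Y\<close> need not have a maximum, but their traces on
  the finite-dimensional \<open>Z\<close> have only finitely many dimensions. An element whose trace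
  has least dimension is as high as \<open>Z\<close> can tell; if \<open>Y\<close> is contained in
  \<open>Z\<close>, its height is a true maximum.\<close>

lemma ex_level_minimal:
  assumes Y: "Y \<noteq> {}" and Z: "subspace Z" "fin_span Z"
  obtains y where "y \<in> Y"
    "\<And>y' \<alpha>. y' \<in> Y \<Longrightarrow> \<alpha> \<in> Field omega1 \<Longrightarrow> y' \<in> P p \<alpha> \<Longrightarrow> Z \<inter> hull_level p y \<subseteq> P p \<alpha>"
proof -
  obtain y where y: "y \<in> Y" "\<And>y'. y' \<in> Y \<Longrightarrow> dim (Z \<inter> hull_level p y) \<le> dim (Z \<inter> hull_level p y')"
    using ex_has_least_nat[of "\<lambda>y. y \<in> Y" _ "\<lambda>y. dim (Z \<inter> hull_level p y)"] Y by blast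
  have "Z \<inter> hull_level p y \<subseteq> P p \<alpha>" if a: "y' \<in> Y" "\<alpha> \<in> Field omega1" "y' \<in> P p \<alpha>" for y' \<alpha>
  proof (rule ccontr)
    assume n: "\<not> Z \<inter> hull_level p y \<subseteq> P p \<alpha>"
    then have "y \<notin> P p \<alpha>" using hull_level_subset a by blast
    then have "P p \<alpha> \<subseteq> hull_level p y" using hull_level_superset a by blast
    moreover have "hull_level p y' \<subseteq> P p \<alpha>" using hull_level_subset a by blast
    ultimately have "Z \<inter> hull_level p y' \<subset> Z \<inter> hull_level p y" using n by blast
    moreover have "subspace (Z \<inter> hull_level p y')"
      by (intro subspace_inter Z subspace_pm subspace_hull_level)
    moreover have "fin_span (Z \<inter> hull_level p y)" by (rule fin_span_mono[OF Z(2)]) blast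
    ultimately have "dim (Z \<inter> hull_level p y') < dim (Z \<inter> hull_level p y)"
      by (intro dim_strict_mono)
    then show False using y(2)[OF a(1)] by simp
  qed
  then show ?thesis using that y by blast
qed

lemma ex_max_height:
  assumes Y: "Y \<noteq> {}" "Y \<subseteq> Z" and Z: "subspace Z" "fin_span Z"
  obtains y where "y \<in> Y"
    "\<And>y' \<alpha>. y' \<in> Y \<Longrightarrow> \<alpha> \<in> Field omega1 \<Longrightarrow> y' \<in> P p \<alpha> \<Longrightarrow> y \<in> P p \<alpha>"
proof -
  obtain y where "y \<in> Y"
    "\<And>y' \<alpha>. y' \<in> Y \<Longrightarrow> \<alpha> \<in> Field omega1 \<Longrightarrow> y' \<in> P p \<alpha> \<Longrightarrow> Z \<inter> hull_level p y \<subseteq> P p \<alpha>"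
    by (rule ex_level_minimal[OF Y(1) Z, where p = p]) blast
  then show ?thesis using that mem_hull_level Y by blast
qed

end

section \<open>Dimensions over the residue field\<close>

context vector_space
begin

text \<open>Subtract from the identity a projection \<open>h\<close> onto \<open>N\<close>. The
  image of \<open>g\<close> is a copy of V/N inside V, in which dimensions of quotients can be
  counted.\<close>

lemma linear_with_kernel:
  assumes "subspace N"
  obtains g where "endo scale g" "\<forall>x. g x = 0 \<longleftrightarrow> x \<in> N"
proof -
  interpret vp: vector_space_pair scale scale by unfold_locales
  obtain C where C: "C \<subseteq> N" "independent C" "N \<subseteq> span C" by (rule basis_exists)
  have CN: "span C = N" using C assms by (simp add: span_subspace)
  obtain h where h: "endo scale h" "\<And>x. x \<in> C \<Longrightarrow> h x = x" "range h = span (id ` C)"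
    using vp.linear_independent_extend_subspace[OF C(2), of id] by auto
  have hN: "h x = x" if "x \<in> N" for x
    using vp.linear_eq_on[OF h(1) linear_id[unfolded id_def], of x C] h(2) that CN by simp
  have hR: "h x \<in> N" for x using h(3) CN by auto
  have lin: "endo scale (\<lambda>x. x - h x)"
    using vp.linear_compose_sub[OF linear_id[unfolded id_def] h(1)] .
  have "\<forall>x. x - h x = 0 \<longleftrightarrow> x \<in> N" using hN hR by (metis right_minus_eq)
  with lin show ?thesis by (rule that)
qed

lemma independent_family:
  assumes "\<And>J c. finite J \<Longrightarrow> J \<subseteq> I \<Longrightarrow> (\<Sum>j\<in>J. scale (c j) (f j)) = 0 \<Longrightarrow> \<forall>j\<in>J. c j = 0"
  shows "inj_on f I" "independent (f ` I)"
proof -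
  show inj: "inj_on f I"
  proof (rule inj_onI, rule ccontr)
    fix j k assume jk: "j \<in> I" "k \<in> I" "f j = f k" "j \<noteq> k"
    have "(\<Sum>i\<in>{j, k}. scale (if i = j then 1 else - 1) (f i)) = 0" using jk by simp
    then show False using assms[of "{j, k}" "\<lambda>i. if i = j then 1 else - 1"] jk by auto
  qed
  show "independent (f ` I)"
    unfolding independent_explicit_module
  proof (intro allI impI)
    fix T c v assume T: "finite T" "T \<subseteq> f ` I" "(\<Sum>v\<in>T. scale (c v) v) = 0" "v \<in> T"
    obtain J where J: "J \<subseteq> I" "finite J" "T = f ` J" using finite_subset_image[OF T(1,2)] by blast
    have "inj_on f J" using inj J inj_on_subset by blast
    then have "(\<Sum>j\<in>J. scale (c (f j)) (f j)) = 0" using T(3) J by (simp add: sum.reindex)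
    then have "\<forall>j\<in>J. c (f j) = 0" using assms[OF J(2,1), of "c \<circ> f"] by simp
    then show "c v = 0" using T J by blast
  qed
qed

end

context endo_space
begin

text \<open>Representatives in V of a basis of U/N over F[t]/(p), for submodules with p U contained
  in N. Cosets are avoided in this way until the invariants have to be compared with their
  definitions.\<close>

definition basis_mod :: "'v set \<Rightarrow> 'v set \<Rightarrow> 'f poly \<Rightarrow> 'v set \<Rightarrow> bool" where
  "basis_mod U N p B \<longleftrightarrow> B \<subseteq> U \<and>
     (\<forall>S r. finite S \<longrightarrow> S \<subseteq> B \<longrightarrow> (\<Sum>b\<in>S. r b \<cdot> b) \<in> N \<longrightarrow> (\<forall>b\<in>S. p dvd r b)) \<and>
     (\<forall>x\<in>U. \<exists>S r. finite S \<and> S \<subseteq> B \<and> x - (\<Sum>b\<in>S. r b \<cdot> b) \<in> N)"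

lemma basis_modD:
  assumes "basis_mod U N p B"
  shows "B \<subseteq> U" "\<And>S r b. finite S \<Longrightarrow> S \<subseteq> B \<Longrightarrow> (\<Sum>b\<in>S. r b \<cdot> b) \<in> N \<Longrightarrow> b \<in> S \<Longrightarrow> p dvd r b"
    "\<And>x. x \<in> U \<Longrightarrow> \<exists>S r. finite S \<and> S \<subseteq> B \<and> x - (\<Sum>b\<in>S. r b \<cdot> b) \<in> N"
  using assms unfolding basis_mod_def by blast+

lemma basis_mod_distinct:
  assumes "irreducible p" "basis_mod U N p B" "b \<in> B" "c \<in> B" "b - c \<in> N"
  shows "b = c"
proof (rule ccontr)
  assume bc: "b \<noteq> c"
  have "(\<Sum>x\<in>{b, c}. (if x = b then 1 else - 1) \<cdot> x) \<in> N" using bc assms(5) by simp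
  from basis_modD(2)[OF assms(2) _ _ this, of b] have "p dvd 1" using assms(3,4) by simp
  then show False using irreducible_not_dvd_one[OF assms(1)] by blast
qed

lemma basis_mod_smult:
  "c \<noteq> 0 \<Longrightarrow> basis_mod U N (smultp c p) B \<longleftrightarrow> basis_mod U N p B"
  by (simp add: basis_mod_def smult_dvd_iff)

text \<open>Zorn's lemma gives a maximal independent \<open>M\<close>. In a relation that involves a
  further \<open>x\<close>, the coefficient of \<open>x\<close> is prime to \<open>p\<close>, since
  otherwise its term lies in \<open>N\<close> and a relation inside \<open>M\<close> remains; Bezout
  then solves for \<open>x\<close> modulo \<open>N\<close>.\<close>

lemma ex_basis_mod:
  assumes p: "irreducible p" and U: "m.subspace U" and N: "m.subspace N"
    and pU: "\<And>x. x \<in> U \<Longrightarrow> p \<cdot> x \<in> N"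
  obtains B where "basis_mod U N p B"
proof -
  define indep where "indep B \<longleftrightarrow>
    (\<forall>S r. finite S \<longrightarrow> S \<subseteq> B \<longrightarrow> (\<Sum>b\<in>S. r b \<cdot> b) \<in> N \<longrightarrow> (\<forall>b\<in>S. p dvd r b))" for B
  define \<A> where "\<A> = {B. B \<subseteq> U \<and> indep B}"
  have "{} \<in> \<A>" unfolding \<A>_def indep_def by auto
  then have "\<A> \<noteq> {}" by blast
  moreover have "\<Union>C \<in> \<A>" if C: "C \<noteq> {}" "subset.chain \<A> C" for C
  proof -
    have sub: "C \<subseteq> \<A>" using C(2) by (simp add: subset_chain_def)
    have "\<forall>b\<in>S. p dvd r b" if S: "finite S" "S \<subseteq> \<Union>C" "(\<Sum>b\<in>S. r b \<cdot> b) \<in> N" for S r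
    proof -
      obtain B where "B \<in> C" "S \<subseteq> B" by (rule finite_subset_Union_chain[OF S(1,2) C])
      then show ?thesis using sub S unfolding \<A>_def indep_def by blast
    qed
    then show ?thesis using sub unfolding \<A>_def indep_def by blast
  qed
  ultimately obtain M where M: "M \<in> \<A>" "\<forall>X\<in>\<A>. M \<subseteq> X \<longrightarrow> X = M"
    using subset_Zorn_nonempty[of \<A>] by blast
  have MU: "M \<subseteq> U" and Mi: "indep M" using M(1) unfolding \<A>_def by auto
  have "\<exists>S r. finite S \<and> S \<subseteq> M \<and> x - (\<Sum>b\<in>S. r b \<cdot> b) \<in> N" if x: "x \<in> U" for x
  proof (cases "x \<in> M")
    case True
    then show ?thesis using m.subspace_0[OF N]
      by (intro exI[of _ "{x}"] exI[of _ "\<lambda>_. 1"]) simp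
  next
    case False
    then have "insert x M \<notin> \<A>" using M(2) by blast
    then have "\<not> indep (insert x M)" using MU x unfolding \<A>_def by blast
    then obtain S r b where S: "finite S" "S \<subseteq> insert x M" "(\<Sum>b\<in>S. r b \<cdot> b) \<in> N" "b \<in> S" "\<not> p dvd r b"
      unfolding indep_def by blast
    have xS: "x \<in> S"
    proof (rule ccontr)
      assume "x \<notin> S"
      then have "S \<subseteq> M" using S(2) by blast
      then show False using Mi S unfolding indep_def by blast
    qed
    have S': "finite (S - {x})" "S - {x} \<subseteq> M" using S by auto
    have sum: "(\<Sum>b\<in>S. r b \<cdot> b) = r x \<cdot> x + (\<Sum>b\<in>S - {x}. r b \<cdot> b)" by (rule sum.remove[OF S(1) xS])
    have nd: "\<not> p dvd r x"
    proof
      assume d: "p dvd r x"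
      then obtain k where "r x = p * k" by (auto elim: dvdE)
      then have "r x \<cdot> x \<in> N" using pU[OF m.subspace_scale[OF U x, of k]] by (simp add: act_mult)
      then have "(\<Sum>b\<in>S - {x}. r b \<cdot> b) \<in> N"
        using m.subspace_diff[OF N S(3), of "r x \<cdot> x"] unfolding sum by simp
      then have "\<forall>b\<in>S - {x}. p dvd r b" using Mi S' unfolding indep_def by blast
      then show False using S d by blast
    qed
    obtain A B where AB: "A * r x + B * p = 1" by (rule irreducible_bezout[OF p nd])
    have "x - (\<Sum>b\<in>S - {x}. (- (A * r b)) \<cdot> b) = A \<cdot> (\<Sum>b\<in>S. r b \<cdot> b) + B \<cdot> p \<cdot> x"
      using bezout_act[OF AB, of x]
      by (simp add: sum act_add_right m.scale_sum_right act_mult sum_negf algebra_simps)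
    also have "\<dots> \<in> N"
      by (rule m.subspace_add[OF N m.subspace_scale[OF N S(3)] m.subspace_scale[OF N pU[OF x]]])
    finally show ?thesis using S' by (intro exI[of _ "S - {x}"] exI[of _ "\<lambda>b. - (A * r b)"]) auto
  qed
  then have "basis_mod U N p M"
    using MU Mi unfolding basis_mod_def indep_def by blast
  then show ?thesis by (rule that)
qed

lemma act_monom: "monom c k \<cdot> x = scale c ((u ^^ k) x)"
  by (induction k) (simp_all add: monom_0 monom_Suc act_pCons u_scale)

text \<open>The field F[t]/(p) has the F-basis 1, t, ..., t^(d-1), where d is the degree of p. Hence
  the vectors u^i b with i < d yield an F-basis of the image of \<open>U\<close> under
  \<open>g\<close>, and bases over the residue field can be compared by linear algebra over
  F.\<close>

lemma basis_mod_family: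
  assumes p: "irreducible p" and N: "m.subspace N" and pU: "\<And>x. x \<in> U \<Longrightarrow> p \<cdot> x \<in> N"
    and B: "basis_mod U N p B" and U: "m.subspace U"
    and g: "endo scale g" "\<forall>x. g x = 0 \<longleftrightarrow> x \<in> N"
  defines "f \<equiv> \<lambda>(b, i). g ((u ^^ i) b)"
  shows "inj_on f (B \<times> {..<degree p})" "independent (f ` (B \<times> {..<degree p}))"
    "f ` (B \<times> {..<degree p}) \<subseteq> g ` U" "g ` U \<subseteq> span (f ` (B \<times> {..<degree p}))"
proof -
  note BD = basis_modD[OF B]
  interpret g: Vector_Spaces.linear scale scale g by (rule g(1))
  have key: "\<forall>j\<in>J. c j = 0"
    if J: "finite J" "J \<subseteq> B \<times> {..<degree p}" and s: "(\<Sum>j\<in>J. scale (c j) (f j)) = 0" for J c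
  proof
    fix j assume jJ: "j \<in> J"
    \<comment> \<open>\<open>r b\<close> gathers the coefficients at the powers of \<open>u\<close>
      applied to \<open>b\<close>. Its degree is less than that of \<open>p\<close>, so divisibility
      by \<open>p\<close> will force it to vanish.\<close>
    define r where "r b = (\<Sum>i | (b, i) \<in> J. monom (c (b, i)) i)" for b
    have finJ: "finite {i. (b, i) \<in> J}" for b
      by (rule finite_subset[of _ "snd ` J"]) (use J(1) in force)+
    have JS: "J = Sigma (fst ` J) (\<lambda>b. {i. (b, i) \<in> J})" by force
    have "0 = (\<Sum>(b, i)\<in>J. scale (c (b, i)) (g ((u ^^ i) b)))" using s by (simp add: f_def case_prod_unfold)
    also have "\<dots> = (\<Sum>b\<in>fst ` J. \<Sum>i | (b, i) \<in> J. scale (c (b, i)) (g ((u ^^ i) b)))"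
      by (subst JS, subst sum.Sigma) (use J(1) finJ in auto)
    also have "\<dots> = g (\<Sum>b\<in>fst ` J. r b \<cdot> b)"
      by (simp add: r_def g.sum g.scale m.scale_sum_left act_monom)
    finally have "(\<Sum>b\<in>fst ` J. r b \<cdot> b) \<in> N" using g(2) by simp
    moreover have "finite (fst ` J)" "fst ` J \<subseteq> B" using J by auto
    ultimately have d: "p dvd r b" if "b \<in> fst ` J" for b using BD(2) that by blast
    obtain b i where j: "j = (b, i)" by (cases j)
    have "degree (r b) < degree p"
    proof -
      have "degree p > 0" using J jJ by force
      then show ?thesis unfolding r_def
        using J by (intro degree_sum_less) (auto intro: le_less_trans[OF degree_monom_le])
    qed
    moreover have "p dvd r b" using d jJ j by force
    ultimately have "r b = 0" using dvd_imp_degree_le[of p "r b"] by fastforce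
    then have "coeff (r b) i = 0" by simp
    then show "c j = 0" using finJ[of b] jJ j by (simp add: r_def coeff_sum)
  qed
  show "inj_on f (B \<times> {..<degree p})" "independent (f ` (B \<times> {..<degree p}))"
    using independent_family[OF key] by blast+
  have uU: "(u ^^ i) b \<in> U" if "b \<in> U" for b i
    using m.subspace_scale[OF U that, of "monom 1 i"] by (simp add: act_monom)
  show "f ` (B \<times> {..<degree p}) \<subseteq> g ` U" using uU BD(1) by (auto simp: f_def)
  show "g ` U \<subseteq> span (f ` (B \<times> {..<degree p}))"
  proof
    fix y assume "y \<in> g ` U"
    then obtain x where x: "x \<in> U" "y = g x" by blast
    then obtain S r where S: "finite S" "S \<subseteq> B" "x - (\<Sum>b\<in>S. r b \<cdot> b) \<in> N" using BD(3) by blast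
    have "g (r b \<cdot> b) \<in> span (f ` (B \<times> {..<degree p}))" if b: "b \<in> S" for b
    proof -
      \<comment> \<open>Only the remainder of \<open>r b\<close> modulo \<open>p\<close> matters,
        because \<open>p \<cdot> b\<close> lies in \<open>N\<close>.\<close>
      have "r b \<cdot> b = (r b div p) \<cdot> p \<cdot> b + (r b mod p) \<cdot> b"
        unfolding act_mult[symmetric] act_add_left[symmetric] by simp
      moreover have "(r b div p) \<cdot> p \<cdot> b \<in> N"
        using m.subspace_scale[OF N pU] b S(2) BD(1) by blast
      ultimately have e: "g (r b \<cdot> b) = g ((r b mod p) \<cdot> b)" using g(2) by (simp add: g.add)
      show ?thesis
      proof (cases "r b mod p = 0")
        case True
        then show ?thesis using e g.zero span_zero by simp
      next
        case False
        have dm: "degree (r b mod p) < degree p"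
          using degree_mod_less[of p "r b"] False p by (auto simp: irreducible_def)
        have "g ((r b mod p) \<cdot> b) = (\<Sum>i\<le>degree (r b mod p). scale (coeff (r b mod p) i) (f (b, i)))"
          by (simp add: act_def g.sum g.scale f_def)
        also have "\<dots> \<in> span (f ` (B \<times> {..<degree p}))"
          using dm b S(2) by (intro span_sum span_scale span_base imageI) auto
        finally show ?thesis unfolding e .
      qed
    qed
    then have "g (\<Sum>b\<in>S. r b \<cdot> b) \<in> span (f ` (B \<times> {..<degree p}))"
      unfolding g.sum by (rule span_sum)
    moreover have "y = g (\<Sum>b\<in>S. r b \<cdot> b)" using S(3) x by (simp add: g.diff flip: spec[OF g(2)])
    ultimately show "y \<in> span (f ` (B \<times> {..<degree p}))" by simp
  qed
qed

lemma finite_times_index: "0 < (n::nat) \<Longrightarrow> finite (B \<times> {..<n}) \<longleftrightarrow> finite B"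
  by (auto simp: finite_cartesian_product_iff lessThan_empty_iff)

lemma basis_mod_countable:
  assumes "countable_dim scale" "irreducible p" "m.subspace N" "\<And>x. x \<in> U \<Longrightarrow> p \<cdot> x \<in> N"
    "basis_mod U N p B" "m.subspace U"
  shows "countable B"
proof -
  obtain g where g: "endo scale g" "\<forall>x. g x = 0 \<longleftrightarrow> x \<in> N"
    by (rule linear_with_kernel[OF subspace_pm[OF assms(3)]])
  define f where "f = (\<lambda>(b, i). g ((u ^^ i) b))"
  note F = basis_mod_family[OF assms(2-6) g, folded f_def]
  have "countable (f ` (B \<times> {..<degree p}))" by (rule independent_countable[OF assms(1) F(2)])
  then have "countable (B \<times> {..<degree p})" using F(1) by (rule countable_image_inj_on)
  then have "countable (fst ` (B \<times> {..<degree p}))" by (rule countable_image)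
  moreover have "fst ` (B \<times> {..<degree p}) = B"
    using irreducible_degree_pos[OF assms(2)] by force
  ultimately show ?thesis by simp
qed

lemma basis_mod_card_le:
  assumes p: "irreducible p" and N: "m.subspace N" and pU: "\<And>x. x \<in> U \<Longrightarrow> p \<cdot> x \<in> N"
    and U: "m.subspace U"
    and B: "basis_mod U N p B" and B': "basis_mod U N p B'" and fin: "finite B"
  shows "finite B' \<and> card B' \<le> card B"
proof -
  obtain g where g: "endo scale g" "\<forall>x. g x = 0 \<longleftrightarrow> x \<in> N"
    by (rule linear_with_kernel[OF subspace_pm[OF N]])
  define f where "f = (\<lambda>(b, i). g ((u ^^ i) b))"
  note F = basis_mod_family[OF p N pU B U g, folded f_def]
  note F' = basis_mod_family[OF p N pU B' U g, folded f_def]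
  let ?I = "\<lambda>B. B \<times> {..<degree p}"
  have finI: "finite (f ` ?I B)" using fin by simp
  have "f ` ?I B' \<subseteq> span (f ` ?I B)" using F(4) F'(3) by blast
  from independent_span_bound[OF finI F'(2) this]
  have c: "finite (f ` ?I B')" "card (f ` ?I B') \<le> card (f ` ?I B)" by auto
  then have "finite (?I B')" using F'(1) finite_image_iff by blast
  then have "finite B'" using finite_times_index[OF irreducible_degree_pos[OF p]] by blast
  moreover have "card B' * degree p \<le> card B * degree p"
    using c(2) F(1) F'(1) by (simp add: card_image card_cartesian_product)
  then have "card B' \<le> card B" using irreducible_degree_pos[OF p] by simp
  ultimately show ?thesis by blast
qed

text \<open>Finite bases have equal size by counting dimensions over F; infinite ones are countable,
  hence equipotent.\<close>

lemma basis_mod_unique: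
  assumes cd: "countable_dim scale"
    and p: "irreducible p" and N: "m.subspace N" and pU: "\<And>x. x \<in> U \<Longrightarrow> p \<cdot> x \<in> N"
    and U: "m.subspace U"
    and B: "basis_mod U N p B" and B': "basis_mod U N p B'"
  shows "|B| =o |B'|"
proof (cases "finite B")
  case True
  then have 1: "finite B'" "card B' \<le> card B" using basis_mod_card_le[OF p N pU U B B'] by auto
  then have "card B = card B'" using basis_mod_card_le[OF p N pU U B' B] by auto
  then have "\<exists>h. bij_betw h B B'" using True 1 by (simp add: finite_same_card_bij)
  then show ?thesis by (simp add: card_of_ordIso)
next
  case False
  then have inf: "infinite B'" using basis_mod_card_le[OF p N pU U B' B] by auto
  have "countable B" "countable B'"
    using basis_mod_countable[OF cd p N pU] B B' U by auto
  then have "bij_betw (from_nat_into B) UNIV B" "bij_betw (from_nat_into B') UNIV B'"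
    using False inf bij_betw_from_nat_into by blast+
  then have "\<exists>h. bij_betw h B B'" by (meson bij_betw_inv bij_betw_trans)
  then show ?thesis by (simp add: card_of_ordIso)
qed

end

section \<open>Partial skew isomorphisms\<close>

context countable_endo
begin

lemma P_coprime_iff: "a * q + b * p = 1 \<Longrightarrow> q \<cdot> y \<in> P p \<alpha> \<longleftrightarrow> y \<in> P p \<alpha>"
  by (auto intro: P_coprime m.subspace_scale[OF P_subspace])

lemma tw_bezout: "a * r + b * p = 1 \<Longrightarrow> tw a * tw r + tw b * tw p = 1"
  by (metis tw_1 tw_add tw_mult)

text \<open>
  \<open>G\<close> is the graph of an isomorphism \<open>\<sigma>\<close> between finite-dimensional submodules with
  \<open>\<sigma> u = - u \<sigma>\<close> that preserves heights.
\<close>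

definition partial_skew :: "('b \<times> 'b) set \<Rightarrow> bool" where
  "partial_skew G \<longleftrightarrow>
     (0, 0) \<in> G \<and>
     (\<forall>a b c d. (a, b) \<in> G \<longrightarrow> (c, d) \<in> G \<longrightarrow> (a + c, b + d) \<in> G) \<and>
     (\<forall>r a b. (a, b) \<in> G \<longrightarrow> (r \<cdot> a, tw r \<cdot> b) \<in> G) \<and>
     (\<forall>b. (0, b) \<in> G \<longrightarrow> b = 0) \<and> (\<forall>a. (a, 0) \<in> G \<longrightarrow> a = 0) \<and>
     (\<forall>p \<alpha> a b. irreducible p \<longrightarrow> \<alpha> \<in> Field omega1 \<longrightarrow> (a, b) \<in> G \<longrightarrow>
        (a \<in> P p \<alpha> \<longleftrightarrow> b \<in> P (tw p) \<alpha>)) \<and>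
     fin_span (Domain G)"

lemma partial_skewD:
  assumes "partial_skew G"
  shows "(0, 0) \<in> G"
    "(a, b) \<in> G \<Longrightarrow> (c, d) \<in> G \<Longrightarrow> (a + c, b + d) \<in> G"
    "(a, b) \<in> G \<Longrightarrow> (r \<cdot> a, tw r \<cdot> b) \<in> G"
    "(0, b) \<in> G \<Longrightarrow> b = 0" "(a, 0) \<in> G \<Longrightarrow> a = 0"
    "irreducible p \<Longrightarrow> \<alpha> \<in> Field omega1 \<Longrightarrow> (a, b) \<in> G \<Longrightarrow> a \<in> P p \<alpha> \<longleftrightarrow> b \<in> P (tw p) \<alpha>"
    "fin_span (Domain G)"
  using assms unfolding partial_skew_def by blast+

lemma partial_skew_scale: "partial_skew G \<Longrightarrow> (a, b) \<in> G \<Longrightarrow> (scale c a, scale c b) \<in> G"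
  using partial_skewD(3)[of G a b "[:c:]"] by simp

lemma partial_skew_diff:
  assumes "partial_skew G" "(a, b) \<in> G" "(c, d) \<in> G"
  shows "(a - c, b - d) \<in> G"
  using partial_skewD(2)[OF assms(1,2) partial_skew_scale[OF assms(1,3), of "- 1"]] by simp

lemma partial_skew_unique:
  assumes "partial_skew G" "(a, b) \<in> G" "(a, c) \<in> G"
  shows "b = c"
  using partial_skewD(4)[OF assms(1), of "b - c"] partial_skew_diff[OF assms] by simp

lemma partial_skew_Domain: "partial_skew G \<Longrightarrow> m.subspace (Domain G)"
  by (intro m.subspaceI) (blast intro: partial_skewD(1-3))+

lemma partial_skew_Range: "partial_skew G \<Longrightarrow> m.subspace (Range G)"
proof (intro m.subspaceI)
  assume G: "partial_skew G"
  show "0 \<in> Range G" using partial_skewD(1)[OF G] by blast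
  show "x + y \<in> Range G" if "x \<in> Range G" "y \<in> Range G" for x y
    using that partial_skewD(2)[OF G] by blast
  show "c \<cdot> x \<in> Range G" if "x \<in> Range G" for x c
    using that partial_skewD(3)[OF G, of _ x "tw c"] by auto
qed

lemma partial_skew_D:
  assumes "partial_skew G" "irreducible p" "(a, b) \<in> G"
  shows "a \<in> D p \<longleftrightarrow> b \<in> D (tw p)"
  unfolding D_def using partial_skewD(6)[OF assms(1,2) _ assms(3)] by auto

definition adjoin :: "('b \<times> 'b) set \<Rightarrow> 'b \<Rightarrow> 'b \<Rightarrow> ('b \<times> 'b) set" where
  "adjoin G x w = {(a + r \<cdot> x, b + tw r \<cdot> w) | a b r. (a, b) \<in> G}"

lemma adjoinI: "(a, b) \<in> G \<Longrightarrow> (a + r \<cdot> x, b + tw r \<cdot> w) \<in> adjoin G x w"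
  unfolding adjoin_def by blast

lemma adjoinE:
  assumes "(y, z) \<in> adjoin G x w"
  obtains a b r where "(a, b) \<in> G" "y = a + r \<cdot> x" "z = b + tw r \<cdot> w"
  using assms unfolding adjoin_def by blast

lemma Domain_adjoin: "Domain (adjoin G x w) = {a + r \<cdot> x | a r. a \<in> Domain G}"
  unfolding adjoin_def by blast

lemma adjoin_superset: "G \<subseteq> adjoin G x w"
proof
  fix z assume "z \<in> G"
  then show "z \<in> adjoin G x w" using adjoinI[of "fst z" "snd z" G 0 x w] by simp
qed

lemma adjoin_mem: "partial_skew G \<Longrightarrow> (x, w) \<in> adjoin G x w"
  using adjoinI[OF partial_skewD(1), of G 1 x w] by simp

text \<open>The conditions \<open>px\<close> and \<open>pw\<close> say that \<open>x\<close> and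
  \<open>w\<close> are proper, that is, of maximal height in their cosets modulo the domain and the
  range. The height of \<open>x + s\<close> is then the smaller of the heights of \<open>x\<close>
  and \<open>s\<close>, likewise for \<open>w\<close>, so matching heights of \<open>x\<close> and
  \<open>w\<close> suffice. At primes not associated to \<open>p\<close>, multiplication by
  \<open>p\<close> reduces everything to \<open>G\<close>.\<close>

lemma partial_skew_adjoin:
  assumes G: "partial_skew G" and p: "irreducible p"
    and x: "x \<notin> Domain G" and w: "w \<notin> Range G" and xw: "(p \<cdot> x, tw p \<cdot> w) \<in> G"
    and ht: "\<And>\<alpha>. \<alpha> \<in> Field omega1 \<Longrightarrow> x \<in> P p \<alpha> \<longleftrightarrow> w \<in> P (tw p) \<alpha>"
    and px: "\<And>s \<alpha>. s \<in> Domain G \<Longrightarrow> \<alpha> \<in> Field omega1 \<Longrightarrow> x + s \<in> P p \<alpha> \<Longrightarrow> x \<in> P p \<alpha>"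
    and pw: "\<And>s \<alpha>. s \<in> Range G \<Longrightarrow> \<alpha> \<in> Field omega1 \<Longrightarrow> w + s \<in> P (tw p) \<alpha> \<Longrightarrow> w \<in> P (tw p) \<alpha>"
  shows "partial_skew (adjoin G x w)"
proof -
  note GD = partial_skewD[OF G]
  note SD = partial_skew_Domain[OF G] and SR = partial_skew_Range[OF G]
  have dvd: "(a + r \<cdot> x, b + tw r \<cdot> w) \<in> G" if pr: "p dvd r" and ab: "(a, b) \<in> G" for a b r
  proof -
    obtain c where "r = p * c" using pr by (rule dvdE)
    then have "r = c * p" by (simp only: mult.commute)
    then have "(r \<cdot> x, tw r \<cdot> w) \<in> G"
      using GD(3)[OF xw, of c] by (simp only: act_mult tw_mult)
    then show ?thesis by (rule GD(2)[OF ab])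
  qed
  have nz1: "a + r \<cdot> x \<noteq> 0" if nd: "\<not> p dvd r" and ab: "(a, b) \<in> G" for a b r
  proof
    assume z: "a + r \<cdot> x = 0"
    obtain A B where AB: "A * r + B * p = 1" using irreducible_bezout[OF p nd] .
    have "x = A \<cdot> r \<cdot> x + B \<cdot> p \<cdot> x" using bezout_act[OF AB] by simp
    moreover have "r \<cdot> x = - a" using z by (metis add.commute eq_neg_iff_add_eq_0)
    moreover have "a \<in> Domain G" "p \<cdot> x \<in> Domain G" using ab xw by blast+
    ultimately have "x \<in> Domain G"
      using m.subspace_add[OF SD] m.subspace_scale[OF SD] m.subspace_neg[OF SD] by metis
    then show False using x by blast
  qed
  have nz2: "b + tw r \<cdot> w \<noteq> 0" if nd: "\<not> p dvd r" and ab: "(a, b) \<in> G" for a b r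
  proof
    assume z: "b + tw r \<cdot> w = 0"
    obtain A B where AB: "A * r + B * p = 1" using irreducible_bezout[OF p nd] .
    have "w = tw A \<cdot> tw r \<cdot> w + tw B \<cdot> tw p \<cdot> w" using bezout_act[OF tw_bezout[OF AB]] by simp
    moreover have "tw r \<cdot> w = - b" using z by (metis add.commute eq_neg_iff_add_eq_0)
    moreover have "b \<in> Range G" "tw p \<cdot> w \<in> Range G" using ab xw by blast+
    ultimately have "w \<in> Range G"
      using m.subspace_add[OF SR] m.subspace_scale[OF SR] m.subspace_neg[OF SR] by metis
    then show False using w by blast
  qed
  have hts: "a + r \<cdot> x \<in> P q \<alpha> \<longleftrightarrow> b + tw r \<cdot> w \<in> P (tw q) \<alpha>"
    if q: "irreducible q" and \<alpha>: "\<alpha> \<in> Field omega1" and ab: "(a, b) \<in> G" for q \<alpha> a b r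
  proof (cases "p dvd r")
    case True
    then show ?thesis using dvd GD(6) q \<alpha> ab by blast
  next
    case False
    obtain A B where AB: "A * r + B * p = 1" using irreducible_bezout[OF p False] .
    show ?thesis
    proof (cases "q dvd p")
      case True
      then obtain k where k: "p = q * k" by (auto simp: dvd_def)
      then have "is_unit k" using p q by (auto simp: irreducible_def)
      then obtain c where c: "k = [:c:]" "c \<noteq> 0" by (auto simp: is_unit_poly_iff dvd_field_iff)
      have Pq: "P q \<alpha> = P p \<alpha>" "P (tw q) \<alpha> = P (tw p) \<alpha>"
        using k c P_smult[of c q \<alpha>] P_smult[of c "tw q" \<alpha>] by (simp_all add: tw_mult tw_smult)
      \<comment> \<open>\<open>A\<close> inverts \<open>r\<close> modulo \<open>p\<close>.
        Multiplication by it turns the two elements into \<open>x + s\<close> and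
        \<open>w + t\<close> with \<open>(s, t)\<close> in \<open>G\<close>, and changes no height
        at \<open>p\<close> or \<open>tw p\<close>.\<close>
      define s where "s = A \<cdot> a - B \<cdot> p \<cdot> x"
      define t where "t = tw A \<cdot> b - tw B \<cdot> tw p \<cdot> w"
      have st: "(s, t) \<in> G"
        unfolding s_def t_def by (intro partial_skew_diff[OF G] GD(3) xw ab)
      have A1: "r * A + B * p = 1" "tw r * tw A + tw B * tw p = 1"
        using AB tw_bezout[OF AB] by (simp_all add: mult.commute)
      have "A \<cdot> (a + r \<cdot> x) = x + s"
        using bezout_act[OF AB, of x, symmetric, unfolded diff_eq_eq[symmetric]]
        by (simp add: s_def act_add_right algebra_simps)
      then have 1: "a + r \<cdot> x \<in> P p \<alpha> \<longleftrightarrow> x + s \<in> P p \<alpha>" using P_coprime_iff[OF A1(1)] by metis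
      have "tw A \<cdot> (b + tw r \<cdot> w) = w + t"
        using bezout_act[OF tw_bezout[OF AB], of w, symmetric, unfolded diff_eq_eq[symmetric]]
        by (simp add: t_def act_add_right algebra_simps)
      then have 2: "b + tw r \<cdot> w \<in> P (tw p) \<alpha> \<longleftrightarrow> w + t \<in> P (tw p) \<alpha>" using P_coprime_iff[OF A1(2)] by metis
      have hs: "s \<in> P p \<alpha> \<longleftrightarrow> t \<in> P (tw p) \<alpha>" using GD(6)[OF p \<alpha> st] .
      \<comment> \<open>Together with \<open>px\<close>, this places \<open>x + s\<close> in a stage
        exactly when \<open>x\<close> and \<open>s\<close> both lie there.\<close>
      have sum_iff: "y + v \<in> P q \<alpha> \<longleftrightarrow> v \<in> P q \<alpha>" if "y \<in> P q \<alpha>" for y v q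
        using m.subspace_diff[OF P_subspace _ that, of "y + v"] m.subspace_add[OF P_subspace that, of v] by auto
      have "s \<in> Domain G" "t \<in> Range G" using st by blast+
      then show ?thesis unfolding Pq 1 2
        using px[OF _ \<alpha>, of s] pw[OF _ \<alpha>, of t] ht[OF \<alpha>] hs sum_iff by metis
    next
      case False
      \<comment> \<open>Here \<open>p\<close> is prime to \<open>q\<close>, so multiplying by
        \<open>p\<close> keeps heights at \<open>q\<close> and moves both elements into
        \<open>G\<close>.\<close>
      obtain a' b' where ab': "a' * p + b' * q = 1" using irreducible_bezout[OF q False] .
      have "(p \<cdot> (a + r \<cdot> x), tw p \<cdot> (b + tw r \<cdot> w)) \<in> G"
        using GD(2)[OF GD(3)[OF ab, of p] GD(3)[OF xw, of r]]
        by (simp add: act_add_right act_commute[of p] act_commute[of "tw p"])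
      then have "p \<cdot> (a + r \<cdot> x) \<in> P q \<alpha> \<longleftrightarrow> tw p \<cdot> (b + tw r \<cdot> w) \<in> P (tw q) \<alpha>"
        using GD(6)[OF q \<alpha>] by blast
      then show ?thesis using P_coprime_iff[OF ab'] P_coprime_iff[OF tw_bezout[OF ab']] by blast
    qed
  qed
  have fin: "fin_span (Domain (adjoin G x w))"
  proof -
    obtain F where F: "finite F" "Domain G \<subseteq> span F" using GD(7) unfolding fin_span_def by blast
    define F' where "F' = F \<union> (\<lambda>i. (u ^^ i) x) ` {..degree p}"
    have "span F \<subseteq> span F'" by (rule span_mono) (simp add: F'_def)
    have "Domain (adjoin G x w) \<subseteq> span F'"
    proof
      fix y assume "y \<in> Domain (adjoin G x w)"
      then obtain a r where y: "y = a + r \<cdot> x" "a \<in> Domain G" unfolding Domain_adjoin by blast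
      have "r \<cdot> x = (r div p) \<cdot> p \<cdot> x + (r mod p) \<cdot> x"
        unfolding act_mult[symmetric] act_add_left[symmetric] by simp
      moreover have "(r div p) \<cdot> p \<cdot> x \<in> Domain G" using xw m.subspace_scale[OF SD] by blast
      moreover have "(r mod p) \<cdot> x \<in> span F'"
      proof -
        have "degree (r mod p) \<le> degree p"
          using degree_mod_less[of p r] irreducible_not_dvd_one[OF p] p
          by (cases "r mod p = 0") (auto simp: irreducible_def)
        then have "(r mod p) \<cdot> x = (\<Sum>i\<le>degree p. scale (coeff (r mod p) i) ((u ^^ i) x))"
          by (rule act_eq_sum)
        then show ?thesis by (auto simp: F'_def intro!: span_sum span_scale intro: span_base)
      qed
      moreover have "Domain G \<subseteq> span F'" using F \<open>span F \<subseteq> span F'\<close> by blast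
      ultimately show "y \<in> span F'" using y by (auto intro!: span_add)
    qed
    moreover have "finite F'" using F by (simp add: F'_def)
    ultimately show ?thesis unfolding fin_span_def by blast
  qed
  show ?thesis
    unfolding partial_skew_def
  proof (intro conjI allI impI)
    show "(0, 0) \<in> adjoin G x w" using GD(1) adjoin_superset by blast
    show "(a + c, b + d) \<in> adjoin G x w" if "(a, b) \<in> adjoin G x w" "(c, d) \<in> adjoin G x w" for a b c d
    proof -
      obtain a1 b1 r1 where 1: "(a1, b1) \<in> G" "a = a1 + r1 \<cdot> x" "b = b1 + tw r1 \<cdot> w"
        using \<open>(a, b) \<in> adjoin G x w\<close> by (rule adjoinE)
      obtain a2 b2 r2 where 2: "(a2, b2) \<in> G" "c = a2 + r2 \<cdot> x" "d = b2 + tw r2 \<cdot> w"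
        using \<open>(c, d) \<in> adjoin G x w\<close> by (rule adjoinE)
      show ?thesis using adjoinI[OF GD(2)[OF 1(1) 2(1)], of "r1 + r2" x w]
        by (simp add: 1 2 act_add_left tw_add ac_simps)
    qed
    show "(r \<cdot> a, tw r \<cdot> b) \<in> adjoin G x w" if "(a, b) \<in> adjoin G x w" for r a b
    proof -
      obtain a1 b1 r1 where 1: "(a1, b1) \<in> G" "a = a1 + r1 \<cdot> x" "b = b1 + tw r1 \<cdot> w"
        using \<open>(a, b) \<in> adjoin G x w\<close> by (rule adjoinE)
      show ?thesis using adjoinI[OF GD(3)[OF 1(1), of r], of "r * r1" x w]
        by (simp add: 1 act_add_right act_mult tw_mult)
    qed
    show "b = 0" if "(0, b) \<in> adjoin G x w" for b
    proof -
      obtain a1 b1 r where 1: "(a1, b1) \<in> G" "0 = a1 + r \<cdot> x" "b = b1 + tw r \<cdot> w"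
        using \<open>(0, b) \<in> adjoin G x w\<close> by (rule adjoinE)
      then have "p dvd r" using nz1 by metis
      then show ?thesis using dvd[OF _ 1(1), of r] 1 GD(4) by simp
    qed
    show "a = 0" if "(a, 0) \<in> adjoin G x w" for a
    proof -
      obtain a1 b1 r where 1: "(a1, b1) \<in> G" "a = a1 + r \<cdot> x" "0 = b1 + tw r \<cdot> w"
        using \<open>(a, 0) \<in> adjoin G x w\<close> by (rule adjoinE)
      then have "p dvd r" using nz2 by metis
      then show ?thesis using dvd[OF _ 1(1), of r] 1 GD(5) by simp
    qed
    show "(a \<in> P q \<alpha>) = (b \<in> P (tw q) \<alpha>)"
      if "irreducible q" "\<alpha> \<in> Field omega1" "(a, b) \<in> adjoin G x w" for q \<alpha> a b
      using hts that by (metis adjoinE)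
    show "fin_span (Domain (adjoin G x w))" by (rule fin)
  qed
qed

section \<open>Height-preserving involutions of finite-dimensional submodules\<close>

definition skew_inv :: "('b \<times> 'b) set \<Rightarrow> bool" where
  "skew_inv G \<longleftrightarrow> partial_skew G \<and> sym G"

lemma skew_invD: "skew_inv G \<Longrightarrow> partial_skew G" "skew_inv G \<Longrightarrow> (a, b) \<in> G \<Longrightarrow> (b, a) \<in> G"
  unfolding skew_inv_def by (auto dest: symD)

lemma skew_inv_Range: "skew_inv G \<Longrightarrow> Range G = Domain G"
  using skew_invD(2) by blast

text \<open>If \<sigma> is to multiply \<open>x\<close> by \<open>n\<close>, it has to multiply
  \<open>p \<cdot> x\<close> by \<open>e * n\<close>. Properness of \<open>scale n x\<close> is
  inherited from \<open>x\<close>, since scaling changes no height.\<close>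

lemma skew_inv_adjoin_self:
  assumes G: "skew_inv G" and p: "irreducible p" "tw p = smultp e p" "e * e = 1"
    and n: "n * n = 1" and x: "x \<notin> Domain G" and px: "(p \<cdot> x, scale (e * n) (p \<cdot> x)) \<in> G"
    and pr: "\<And>s \<alpha>. s \<in> Domain G \<Longrightarrow> \<alpha> \<in> Field omega1 \<Longrightarrow> x + s \<in> P p \<alpha> \<Longrightarrow> x \<in> P p \<alpha>"
  shows "skew_inv (adjoin G x (scale n x))"
proof -
  have GP: "partial_skew G" by (rule skew_invD[OF G])
  have e0: "e \<noteq> 0" "n \<noteq> 0" using p n by auto
  have Pe: "P (tw p) \<alpha> = P p \<alpha>" for \<alpha> using p e0 by (simp add: P_smult)
  have nn: "scale n (scale n y) = y" for y by (simp add: n)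
  have sP: "scale n y \<in> P p \<alpha> \<longleftrightarrow> y \<in> P p \<alpha>" for y \<alpha>
    using subspace_scale[OF subspace_pm[OF P_subspace]] nn by metis
  have SD: "subspace (Domain G)" by (rule subspace_pm[OF partial_skew_Domain[OF GP]])
  have "partial_skew (adjoin G x (scale n x))"
  proof (rule partial_skew_adjoin[OF GP p(1) x])
    show "scale n x \<notin> Range G"
      unfolding skew_inv_Range[OF G] using x subspace_scale[OF SD] nn by metis
    show "(p \<cdot> x, tw p \<cdot> scale n x) \<in> G" using px by (simp add: p act_smult act_scale mult.commute)
    show "(x \<in> P p \<alpha>) = (scale n x \<in> P (tw p) \<alpha>)" for \<alpha> by (simp add: Pe sP)
    show "x \<in> P p \<alpha>" if "s \<in> Domain G" "\<alpha> \<in> Field omega1" "x + s \<in> P p \<alpha>" for s \<alpha>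
      using pr that .
    show "scale n x \<in> P (tw p) \<alpha>"
      if "s \<in> Range G" "\<alpha> \<in> Field omega1" "scale n x + s \<in> P (tw p) \<alpha>" for s \<alpha>
    proof -
      have "scale n (x + scale n s) = scale n x + s" by (simp add: scale_right_distrib n)
      then have "x + scale n s \<in> P p \<alpha>" using that sP Pe by metis
      moreover have "scale n s \<in> Domain G" using that subspace_scale[OF SD] skew_inv_Range[OF G] by blast
      ultimately show ?thesis using pr that sP Pe by blast
    qed
  qed
  moreover have "sym (adjoin G x (scale n x))"
  proof (rule symI)
    fix y z assume "(y, z) \<in> adjoin G x (scale n x)"
    then obtain a b r where 1: "(a, b) \<in> G" "y = a + r \<cdot> x" "z = b + tw r \<cdot> scale n x" by (rule adjoinE)
    show "(z, y) \<in> adjoin G x (scale n x)"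
      using adjoinI[OF skew_invD(2)[OF G 1(1)], of "smultp n (tw r)" x "scale n x"]
      by (simp add: 1 act_smult act_scale tw_smult n)
  qed
  ultimately show ?thesis by (simp add: skew_inv_def)
qed

text \<open>The pairs \<open>(x, w)\<close> and \<open>(w, x)\<close> are adjoined in turn, so the
  conditions for the second must survive the first. They do because p and p(-t) are coprime: the
  multiple \<open>a * p\<close> of \<open>p\<close>, which is 1 modulo \<open>tw p\<close>, sends
  \<open>x\<close> into the old domain and fixes \<open>w\<close> modulo it.\<close>

lemma skew_inv_adjoin_pair:
  assumes G: "skew_inv G" and p: "irreducible p" "\<not> p dvd tw p"
    and x: "x \<notin> Domain G" and w: "w \<notin> Domain G" and xw: "(p \<cdot> x, tw p \<cdot> w) \<in> G"
    and ht: "\<And>\<alpha>. \<alpha> \<in> Field omega1 \<Longrightarrow> x \<in> P p \<alpha> \<longleftrightarrow> w \<in> P (tw p) \<alpha>"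
    and px: "\<And>s \<alpha>. s \<in> Domain G \<Longrightarrow> \<alpha> \<in> Field omega1 \<Longrightarrow> x + s \<in> P p \<alpha> \<Longrightarrow> x \<in> P p \<alpha>"
    and pw: "\<And>s \<alpha>. s \<in> Domain G \<Longrightarrow> \<alpha> \<in> Field omega1 \<Longrightarrow> w + s \<in> P (tw p) \<alpha> \<Longrightarrow> w \<in> P (tw p) \<alpha>"
  shows "skew_inv (adjoin (adjoin G x w) w x)"
proof -
  obtain b a where ba: "b * tw p + a * p = 1" using irreducible_bezout[OF p] .
  have GP: "partial_skew G" by (rule skew_invD[OF G])
  note RD = skew_inv_Range[OF G]
  note SD = partial_skew_Domain[OF GP]
  have pxD: "p \<cdot> x \<in> Domain G" "tw p \<cdot> w \<in> Domain G" using xw RD by blast+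
  let ?G1 = "adjoin G x w"
  have G1: "partial_skew ?G1"
    by (rule partial_skew_adjoin[OF GP p(1) x _ xw ht px pw]) (use w RD in auto)
  have key1: "a \<cdot> p \<cdot> (w + (s + r \<cdot> x)) = w + (a \<cdot> (p \<cdot> s + r \<cdot> p \<cdot> x) - b \<cdot> tw p \<cdot> w)" for s r
    using bezout_act[OF ba, of w] by (simp add: act_add_right act_commute[of p r] algebra_simps)
  have key2: "b \<cdot> tw p \<cdot> (x + (s + r \<cdot> w)) = x + (b \<cdot> (tw p \<cdot> s + r \<cdot> tw p \<cdot> w) - a \<cdot> p \<cdot> x)" for s r
    using bezout_act[OF ba, of x] by (simp add: act_add_right act_commute[of "tw p" r] algebra_simps)
  have D1: "a \<cdot> (p \<cdot> s + r \<cdot> p \<cdot> x) - b \<cdot> tw p \<cdot> w \<in> Domain G" if "s \<in> Domain G" for s r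
    by (intro m.subspace_diff[OF SD] m.subspace_add[OF SD] m.subspace_scale[OF SD] that pxD)
  have D2: "b \<cdot> (tw p \<cdot> s + r \<cdot> tw p \<cdot> w) - a \<cdot> p \<cdot> x \<in> Domain G" if "s \<in> Domain G" for s r
    by (intro m.subspace_diff[OF SD] m.subspace_add[OF SD] m.subspace_scale[OF SD] that pxD)
  have R1: "\<exists>s r. t = s + r \<cdot> w \<and> s \<in> Domain G" if "t \<in> Range ?G1" for t
    using that RD unfolding adjoin_def by blast
  have "partial_skew (adjoin ?G1 w x)"
  proof (rule partial_skew_adjoin[OF G1 irreducible_tw[OF p(1)]])
    show "w \<notin> Domain ?G1"
    proof
      assume "w \<in> Domain ?G1"
      then obtain s r where s: "w = s + r \<cdot> x" "s \<in> Domain G" unfolding Domain_adjoin by blast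
      have "0 = w + (- s + (- r) \<cdot> x)" using s(1) by simp
      then have "0 = w + (a \<cdot> (p \<cdot> (- s) + (- r) \<cdot> p \<cdot> x) - b \<cdot> tw p \<cdot> w)"
        using key1[of "- s" "- r"] by (metis m.scale_zero_right)
      moreover have "a \<cdot> (p \<cdot> (- s) + (- r) \<cdot> p \<cdot> x) - b \<cdot> tw p \<cdot> w \<in> Domain G"
        using D1 m.subspace_neg[OF SD s(2)] by blast
      ultimately show False using w m.subspace_neg[OF SD] by (metis eq_neg_iff_add_eq_0)
    qed
    show "x \<notin> Range ?G1"
    proof
      assume "x \<in> Range ?G1"
      then obtain s r where s: "x = s + r \<cdot> w" "s \<in> Domain G" using R1 by blast
      have "0 = x + (- s + (- r) \<cdot> w)" using s(1) by simp
      then have "0 = x + (b \<cdot> (tw p \<cdot> (- s) + (- r) \<cdot> tw p \<cdot> w) - a \<cdot> p \<cdot> x)"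
        using key2[of "- s" "- r"] by (metis m.scale_zero_right)
      moreover have "b \<cdot> (tw p \<cdot> (- s) + (- r) \<cdot> tw p \<cdot> w) - a \<cdot> p \<cdot> x \<in> Domain G"
        using D2 m.subspace_neg[OF SD s(2)] by blast
      ultimately show False using x m.subspace_neg[OF SD] by (metis eq_neg_iff_add_eq_0)
    qed
    show "(tw p \<cdot> w, tw (tw p) \<cdot> x) \<in> ?G1"
      using skew_invD(2)[OF G xw] adjoin_superset by (simp add: subset_iff)
    show "(w \<in> P (tw p) \<alpha>) = (x \<in> P (tw (tw p)) \<alpha>)" if "\<alpha> \<in> Field omega1" for \<alpha>
      using ht[OF that] by simp
    show "w \<in> P (tw p) \<alpha>"
      if t: "t \<in> Domain ?G1" and \<alpha>: "\<alpha> \<in> Field omega1" and m: "w + t \<in> P (tw p) \<alpha>" for t \<alpha>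
    proof -
      obtain s r where s: "t = s + r \<cdot> x" "s \<in> Domain G" using t unfolding Domain_adjoin by blast
      have "a \<cdot> p \<cdot> (w + (s + r \<cdot> x)) \<in> P (tw p) \<alpha>"
        using m s by (auto intro: m.subspace_scale[OF P_subspace])
      then show ?thesis unfolding key1 using pw[OF D1[OF s(2)] \<alpha>] by blast
    qed
    show "x \<in> P (tw (tw p)) \<alpha>"
      if t: "t \<in> Range ?G1" and \<alpha>: "\<alpha> \<in> Field omega1" and m: "x + t \<in> P (tw (tw p)) \<alpha>" for t \<alpha>
    proof -
      obtain s r where s: "t = s + r \<cdot> w" "s \<in> Domain G" using R1[OF t] by blast
      have "b \<cdot> tw p \<cdot> (x + (s + r \<cdot> w)) \<in> P p \<alpha>"
        using m s by (auto intro: m.subspace_scale[OF P_subspace])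
      then show ?thesis unfolding key2 tw_tw using px[OF D2[OF s(2)] \<alpha>] by blast
    qed
  qed
  moreover have "sym (adjoin ?G1 w x)"
  proof (rule symI)
    fix y z assume "(y, z) \<in> adjoin ?G1 w x"
    then obtain a1 b1 r1 where 1: "(a1, b1) \<in> ?G1" "y = a1 + r1 \<cdot> w" "z = b1 + tw r1 \<cdot> x" by (rule adjoinE)
    from 1(1) obtain a b r where 2: "(a, b) \<in> G" "a1 = a + r \<cdot> x" "b1 = b + tw r \<cdot> w" by (rule adjoinE)
    show "(z, y) \<in> adjoin ?G1 w x"
      using adjoinI[OF adjoinI[OF skew_invD(2)[OF G 2(1)], of "tw r1" x w], of "tw r" w x]
      by (simp add: 1 2 ac_simps)
  qed
  ultimately show ?thesis by (simp add: skew_inv_def)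
qed

end

section \<open>Extension at a self-dual prime\<close>

locale countable_endo_odd = countable_endo +
  assumes two_nonzero: "(2 :: 'a) \<noteq> 0"
begin

lemma P_suc_subset2: "\<alpha> \<in> Field omega1 \<Longrightarrow> x \<in> P p (sc \<alpha>) \<Longrightarrow> x \<in> P p \<alpha>"
  using P_suc_subset by blast

lemmas P_add = m.subspace_add[OF P_subspace]
  and P_diff = m.subspace_diff[OF P_subspace]
  and P_act = m.subspace_scale[OF P_subspace]
  and P_scale = subspace_scale[OF subspace_pm[OF P_subspace]]

lemma P_suc_act: "\<alpha> \<in> Field omega1 \<Longrightarrow> x \<in> P p \<alpha> \<Longrightarrow> p \<cdot> x \<in> P p (sc \<alpha>)"
  by (simp add: P_suc)

lemma hull_level_height:
  assumes "\<delta> \<in> Field omega1" "v \<notin> P p (sc \<delta>)"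
  shows "P p \<delta> \<subseteq> hull_level p v"
proof -
  have "P p \<delta> \<subseteq> P p \<beta>" if b: "\<beta> \<in> Field omega1" "v \<in> P p \<beta>" for \<beta>
  proof (cases "(\<beta>, \<delta>) \<in> omega1")
    case True then show ?thesis by (rule P_antimono)
  next
    case False
    then have "(sc \<delta>, \<beta>) \<in> omega1" using not_below assms(1) b(1) by blast
    then show ?thesis using P_antimono b assms(2) by blast
  qed
  then show ?thesis unfolding hull_level_def by auto
qed

text \<open>
  For \<open>n = 1\<close> and \<open>n = - 1\<close> this is the component of \<open>s\<close> in the \<open>n\<close>-eigenspace of the involution
  that maps \<open>s\<close> to \<open>b\<close>. The membership \<open>(s, scale n s) \<in> G\<close> says that \<open>s\<close> is homogeneous of
  sign \<open>n\<close>; if \<open>tw p = smultp e p\<close>, then \<open>p \<cdot> s\<close> has sign \<open>e * n\<close>.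
\<close>

definition half :: "'a \<Rightarrow> 'b \<Rightarrow> 'b \<Rightarrow> 'b" where
  "half n s b = scale (1 / 2) (s + scale n b)"

lemma half_mem:
  assumes G: "skew_inv G" and sb: "(s, b) \<in> G" and n: "n * n = 1"
  shows "(half n s b, scale n (half n s b)) \<in> G"
proof -
  note GP = skew_invD(1)[OF G]
  have "(s + scale n b, b + scale n s) \<in> G"
    using partial_skewD(2)[OF GP sb partial_skew_scale[OF GP skew_invD(2)[OF G sb]]] .
  moreover have "b + scale n s = scale n (s + scale n b)"
    using n by (simp add: scale_right_distrib add.commute)
  ultimately have "(scale (1 / 2) (s + scale n b), scale (1 / 2) (scale n (s + scale n b))) \<in> G"
    using partial_skew_scale[OF GP] by metis
  then show ?thesis by (simp add: half_def mult.commute)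
qed

lemma half_self:
  assumes "n * n = 1"
  shows "half n s (scale n s) = s"
proof -
  show ?thesis using assms two_nonzero by (simp add: half_def double_eq_scale)
qed

lemma half_add: "half n (s + s') (b + b') = half n s b + half n s' b'"
  by (simp add: half_def scale_right_distrib algebra_simps)

lemma half_sum: "half 1 s b + half (- 1) s b = s"
proof -
  have "half 1 s b + half (- 1) s b = scale (1 / 2) (s + s)"
    by (simp add: half_def flip: scale_right_distrib)
  then show ?thesis using two_nonzero by (simp add: double_eq_scale)
qed

lemma half_act: "r \<cdot> half n s b = half n (r \<cdot> s) (r \<cdot> b)"
  by (simp add: half_def act_scale act_add_right)

lemma half_scale: "half n s (scale c b) = half (n * c) s b"
  by (simp add: half_def)

text \<open>The whole coset of \<open>x\<close> lies in a finite-dimensional space, where a maximal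
  height is attained, possibly infinite.\<close>

lemma ex_proper:
  assumes GP: "partial_skew G"
  obtains y s0 where "y = x + s0" "s0 \<in> Domain G"
    "\<And>s \<alpha>. s \<in> Domain G \<Longrightarrow> \<alpha> \<in> Field omega1 \<Longrightarrow> y + s \<in> P p \<alpha> \<Longrightarrow> y \<in> P p \<alpha>"
proof -
  let ?S = "Domain G"
  note GD = partial_skewD[OF GP]
  note SD = partial_skew_Domain[OF GP]
  have fs: "fin_span (span (insert x ?S))"
  proof -
    obtain F where F: "finite F" "?S \<subseteq> span F" using GD(7) unfolding fin_span_def by blast
    have "span F \<subseteq> span (insert x F)" by (rule span_mono) blast
    then have "insert x ?S \<subseteq> span (insert x F)" using F by (auto intro: span_base)
    then have "span (insert x ?S) \<subseteq> span (insert x F)" by (simp add: span_minimal)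
    then show ?thesis using F unfolding fin_span_def by blast
  qed
  define Y where "Y = {x + s | s. s \<in> ?S}"
  have "Y \<noteq> {}" using GD(1) unfolding Y_def by blast
  moreover have "Y \<subseteq> span (insert x ?S)" unfolding Y_def by (auto intro!: span_add intro: span_base)
  ultimately obtain y where yY: "y \<in> Y"
    and ymax: "\<And>y' \<alpha>. y' \<in> Y \<Longrightarrow> \<alpha> \<in> Field omega1 \<Longrightarrow> y' \<in> P p \<alpha> \<Longrightarrow> y \<in> P p \<alpha>"
    using ex_max_height[OF _ _ subspace_span fs, of Y p] by metis
  obtain s0 where s0: "y = x + s0" "s0 \<in> ?S" using yY unfolding Y_def by blast
  have yS: "y + s \<in> Y" if "s \<in> ?S" for s
    using m.subspace_add[OF SD s0(2) that] unfolding Y_def s0(1) by (auto simp: add.assoc)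
  show ?thesis
  proof (rule that[OF s0])
    fix s \<alpha> assume "s \<in> ?S" "\<alpha> \<in> Field omega1" "y + s \<in> P p \<alpha>"
    then show "y \<in> P p \<alpha>" using ymax yS by blast
  qed
qed

text \<open>By \<open>far\<close> no element of the coset of \<open>y\<close> is higher than
  \<beta>, and adding an \<open>l\<close> that is higher than \<beta> cannot change this. With
  \<open>l = 0\<close> the conclusion is properness; in general it keeps \<open>y\<close> proper
  when S is enlarged inside the sum of S and \<open>P p (sc \<beta>)\<close>.\<close>

lemma far_levels:
  assumes b: "\<beta> \<in> Field omega1" "y \<in> P p \<beta>" and far: "\<And>s. s \<in> S \<Longrightarrow> y + s \<notin> P p (sc \<beta>)"
    and s: "s \<in> S" "l \<in> P p (sc \<beta>)" and \<alpha>: "\<alpha> \<in> Field omega1" "y + s + l \<in> P p \<alpha>"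
  shows "y \<in> P p \<alpha> \<and> P p (sc \<beta>) \<subseteq> P p \<alpha>"
proof (cases "(\<alpha>, \<beta>) \<in> omega1")
  case True
  then have "P p \<beta> \<subseteq> P p \<alpha>" by (rule P_antimono)
  then show ?thesis using b P_suc_subset by blast
next
  case False
  then have "(sc \<beta>, \<alpha>) \<in> omega1" using not_below b \<alpha> by blast
  then have "P p \<alpha> \<subseteq> P p (sc \<beta>)" by (rule P_antimono)
  then have "y + s + l - l \<in> P p (sc \<beta>)" using \<alpha> s by (intro P_diff) auto
  then show ?thesis using far[OF s(1)] by simp
qed

context
  fixes p :: "'a poly" and e :: 'a
  assumes p: "irreducible p" and pe: "tw p = smultp e p" and ee: "e * e = 1"
begin

lemma P_tw: "P (tw p) \<alpha> = P p \<alpha>"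
  using ee by (subst pe, subst P_smult) auto

lemma skew_inv_P:
  assumes "skew_inv G" "(a, b) \<in> G" "\<alpha> \<in> Field omega1" "a \<in> P p \<alpha>"
  shows "b \<in> P p \<alpha>"
  using partial_skewD(6)[OF skew_invD(1)[OF assms(1)] p assms(3,2)] assms(4) by (simp add: P_tw)

lemma half_P:
  assumes "skew_inv G" "(s, b) \<in> G" "\<alpha> \<in> Field omega1" "s \<in> P p \<alpha>"
  shows "half n s b \<in> P p \<alpha>"
  unfolding half_def using assms(4) skew_inv_P[OF assms] by (intro P_scale P_add)

lemma half_level:
  assumes "skew_inv G" "(s, b) \<in> G" "level p L" "s \<in> L"
  shows "half n s b \<in> L"
  using assms(3)
proof (auto simp: level_def)
  assume "L = D p"
  then show "half n s b \<in> D p" using half_P[OF assms(1,2)] assms(4) by (auto simp: D_def)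
next
  fix \<alpha> assume "\<alpha> \<in> Field omega1" "L = P p \<alpha>"
  then show "half n s b \<in> P p \<alpha>" using half_P[OF assms(1,2)] assms(4) by blast
qed

lemma act_pair:
  assumes "skew_inv G" "(s, scale n s) \<in> G"
  shows "(p \<cdot> s, scale (e * n) (p \<cdot> s)) \<in> G"
  using partial_skewD(3)[OF skew_invD(1)[OF assms(1)] assms(2), of p]
  by (simp add: pe act_smult act_scale mult.commute)

lemma act_pair':
  assumes "skew_inv G" "(s, b) \<in> G"
  shows "(p \<cdot> s, scale e (p \<cdot> b)) \<in> G"
  using partial_skewD(3)[OF skew_invD(1)[OF assms(1)] assms(2), of p]
  by (simp add: pe act_smult)

text \<open>
  The preimage is found in the form \<open>v - s\<^sub>0\<close>, where \<open>s\<^sub>0 \<in> S \<inter> L\<close> is homogeneous and makes the height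
  of \<open>y = z + p s\<^sub>0\<close> maximal, and \<open>v\<close> has \<open>p v = y\<close> and is as high as the heights in \<open>S\<close> can tell.
  If \<open>v\<close> were not of maximal height modulo \<open>S\<close>, one of the two choices could be improved.
\<close>

lemma selfdual_lift:
  assumes G: "skew_inv G" and n: "n * n = 1" and L: "level p L"
    and z: "(z, scale (e * n) z) \<in> G" "z \<in> act p ` L"
  obtains G' v where "skew_inv G'" "G \<subseteq> G'" "v \<in> L" "p \<cdot> v = z" "(v, scale n v) \<in> G'"
    "\<forall>x\<in>Domain G'. \<exists>s\<in>Domain G. \<exists>l\<in>L. x = s + l"
proof -
  note GP = skew_invD(1)[OF G]
  note GD = partial_skewD[OF GP]
  note SL = level_subspace[OF L]
  have "(e * n) * (e * n) = (e * e) * (n * n)" by (simp only: ac_simps)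
  then have en: "(e * n) * (e * n) = 1" by (simp add: ee n)
  have S: "subspace (Domain G)" by (rule subspace_pm[OF partial_skew_Domain[OF GP]])
  define Y1 where "Y1 = {z + p \<cdot> s | s. s \<in> L \<and> (s, scale n s) \<in> G}"
  have Y1G: "(y, scale (e * n) y) \<in> G" if y: "y \<in> Y1" for y
  proof -
    obtain s where s: "y = z + p \<cdot> s" "(s, scale n s) \<in> G" using y unfolding Y1_def by blast
    show ?thesis using GD(2)[OF z(1) act_pair[OF G s(2)]] by (simp add: s(1) scale_right_distrib)
  qed
  have "z + p \<cdot> 0 \<in> Y1" unfolding Y1_def using m.subspace_0[OF SL] GD(1) by force
  then have "Y1 \<noteq> {}" by blast
  moreover have "Y1 \<subseteq> Domain G" using Y1G by blast
  ultimately obtain y where y: "y \<in> Y1"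
    and ymax: "\<And>y' \<alpha>. y' \<in> Y1 \<Longrightarrow> \<alpha> \<in> Field omega1 \<Longrightarrow> y' \<in> P p \<alpha> \<Longrightarrow> y \<in> P p \<alpha>"
    using ex_max_height[OF _ _ S GD(7), of Y1 p] by metis
  obtain s0 where s0: "y = z + p \<cdot> s0" "s0 \<in> L" "(s0, scale n s0) \<in> G" using y unfolding Y1_def by blast
  note yG = Y1G[OF y]
  obtain l0 where l0: "z = p \<cdot> l0" "l0 \<in> L" using z(2) by blast
  define Y2 where "Y2 = {v \<in> L. p \<cdot> v = y}"
  have "l0 + s0 \<in> Y2" unfolding Y2_def using l0 s0 m.subspace_add[OF SL] by (simp add: act_add_right)
  then have "Y2 \<noteq> {}" by blast
  then obtain v where v: "v \<in> Y2"
    and vmin: "\<And>y' \<alpha>. y' \<in> Y2 \<Longrightarrow> \<alpha> \<in> Field omega1 \<Longrightarrow> y' \<in> P p \<alpha> \<Longrightarrow> Domain G \<inter> hull_level p v \<subseteq> P p \<alpha>"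
    using ex_level_minimal[OF _ S GD(7), of Y2 p] by metis
  have vL: "v \<in> L" and pv: "p \<cdot> v = y" using v unfolding Y2_def by blast+
  have fin: "v' - s0 \<in> L" "p \<cdot> (v' - s0) = z" if "v' \<in> L" "p \<cdot> v' = y" for v'
    using that m.subspace_diff[OF SL] s0 by (simp_all add: m.scale_right_diff_distrib)
  show ?thesis
  proof (cases "v \<in> Domain G")
    case True
    then obtain b where b: "(v, b) \<in> G" by blast
    \<comment> \<open>A preimage that already lies in S only has to be made homogeneous.\<close>
    have hv: "half n v b \<in> L" by (rule half_level[OF G b L vL])
    have "scale e (p \<cdot> b) = scale (e * n) y"
      using partial_skew_unique[OF GP act_pair'[OF G b]] yG pv by simp
    then have "scale (e * e) (p \<cdot> b) = scale (e * e * n) y" by (metis mult.assoc scale_scale)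
    then have "p \<cdot> b = scale n y" by (simp add: ee)
    then have ph: "p \<cdot> half n v b = y" using n by (simp add: half_act pv half_self)
    show ?thesis
    proof (rule that[OF G subset_refl])
      show "(half n v b - s0, scale n (half n v b - s0)) \<in> G"
        using partial_skew_diff[OF GP half_mem[OF G b n] s0(3)] by (simp add: scale_right_diff_distrib)
      show "\<forall>x\<in>Domain G. \<exists>s\<in>Domain G. \<exists>l\<in>L. x = s + l"
        using m.subspace_0[OF SL] by force
    qed (use fin hv ph in auto)
  next
    case False
    have pr: "v \<in> P p \<alpha>" if s: "s \<in> Domain G" and \<alpha>: "\<alpha> \<in> Field omega1" and vs: "v + s \<in> P p \<alpha>" for s \<alpha>
    proof (rule ccontr)
      \<comment> \<open>If \<open>v + s\<close> is higher than the height \<delta> of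
        \<open>v\<close>, then y + p s lies in stage \<delta> + 2. Passing to the homogeneous
        component of \<open>s\<close> preserves this and stays in \<open>Y1\<close>, so by
        maximality \<open>y\<close> lies there too and has a preimage \<open>v2\<close> in stage
        \<delta> + 1. The choice of \<open>v\<close> then puts \<open>s\<close> into stage \<delta>
        + 1, and with it \<open>v\<close>.\<close>
      assume nv: "v \<notin> P p \<alpha>"
      then have "v \<notin> D p" using D_subset \<alpha> by blast
      then obtain \<delta> where d: "\<delta> \<in> Field omega1" "v \<in> P p \<delta>" "v \<notin> P p (sc \<delta>)" by (rule D_height)
      let ?Q1 = "P p (sc \<delta>)" and ?Q2 = "P p (sc (sc \<delta>))"
      have vs1: "v + s \<in> ?Q1" using P_above[OF \<alpha> d(1,2) nv] vs by blast
      have sd: "s \<in> P p \<delta>" using P_diff[OF P_suc_subset2[OF d(1) vs1] d(2)] by simp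
      \<comment> \<open>\<open>L\<close> contains \<open>v\<close>, whose height is exactly
        \<delta>, and hence the whole next stage; therefore \<open>s\<close> and \<open>v2\<close>
        are available in \<open>L\<close>.\<close>
      have PL: "?Q1 \<subseteq> L"
        using L unfolding level_def
      proof
        assume "L = D p" then show ?thesis using vL \<open>v \<notin> D p\<close> by blast
      next
        assume "\<exists>\<alpha>\<in>Field omega1. L = P p \<alpha>"
        then show ?thesis using P_chain[OF _ sc_Field[OF d(1)]] vL d(3) by blast
      qed
      have sL: "s \<in> L" using m.subspace_diff[OF SL _ vL, of "v + s"] vs1 PL by auto
      obtain b where b: "(s, b) \<in> G" using s by blast
      let ?s2 = "half n s b"
      have s2: "(?s2, scale n ?s2) \<in> G" "?s2 \<in> L" using half_mem[OF G b n] half_level[OF G b L sL] by auto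
      have ss: "sc (sc \<delta>) \<in> Field omega1" using d(1) by simp
      have a: "y + p \<cdot> s \<in> ?Q2"
        using P_suc_act[OF sc_Field[OF d(1)] vs1] by (simp add: act_add_right pv)
      have aG: "(y + p \<cdot> s, scale (e * n) y + scale e (p \<cdot> b)) \<in> G"
        by (rule GD(2)[OF yG act_pair'[OF G b]])
      have "e * n * e = (e * e) * n" by (simp only: ac_simps)
      then have "e * n * e = n" by (simp add: ee)
      then have "half (e * n) (p \<cdot> s) (scale e (p \<cdot> b)) = p \<cdot> ?s2" by (simp only: half_scale half_act)
      then have "half (e * n) (y + p \<cdot> s) (scale (e * n) y + scale e (p \<cdot> b)) = y + p \<cdot> ?s2"
        by (simp only: half_add half_self[OF en])
      then have "y + p \<cdot> ?s2 \<in> ?Q2" using half_P[OF G aG ss a, of "e * n"] by simp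
      moreover have "y + p \<cdot> ?s2 \<in> Y1"
      proof -
        have "(s0 + ?s2, scale n (s0 + ?s2)) \<in> G"
          using GD(2)[OF s0(3) s2(1)] by (simp add: scale_right_distrib)
        moreover have "y + p \<cdot> ?s2 = z + p \<cdot> (s0 + ?s2)" by (simp add: s0(1) act_add_right add.assoc)
        ultimately show ?thesis unfolding Y1_def using m.subspace_add[OF SL s0(2) s2(2)] by blast
      qed
      ultimately have "y \<in> ?Q2" using ymax ss by blast
      then obtain v2 where v2: "v2 \<in> ?Q1" "p \<cdot> v2 = y" using P_suc[OF sc_Field[OF d(1)]] by auto
      then have "v2 \<in> Y2" using PL unfolding Y2_def by blast
      then have "Domain G \<inter> hull_level p v \<subseteq> ?Q1" using vmin[OF _ sc_Field[OF d(1)] v2(1)] by blast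
      then have "s \<in> ?Q1" using s sd hull_level_height[OF d(1,3)] by blast
      then have "v \<in> ?Q1" using P_diff[OF vs1] by force
      then show False using d by blast
    qed
    let ?G = "adjoin G v (scale n v)"
    have G': "skew_inv ?G"
      by (rule skew_inv_adjoin_self[OF G p pe ee n False]) (use pv yG pr in auto)
    note GP' = skew_invD(1)[OF G']
    show ?thesis
    proof (rule that[OF G' adjoin_superset])
      have "(s0, scale n s0) \<in> ?G" using s0(3) adjoin_superset by blast
      then show "(v - s0, scale n (v - s0)) \<in> ?G"
        using partial_skew_diff[OF GP' adjoin_mem[OF GP]] by (simp add: scale_right_diff_distrib)
      show "\<forall>x\<in>Domain ?G. \<exists>s\<in>Domain G. \<exists>l\<in>L. x = s + l"
        using m.subspace_scale[OF SL vL] unfolding Domain_adjoin by blast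
    qed (use fin vL pv in auto)
  qed
qed

text \<open>A homogeneous \<open>v\<close> in \<open>L\<close> with p v = z2 is adjoined; then p (y
  - v) = z1 is homogeneous, and \<open>y - v\<close> can be adjoined as an eigenvector. The domain
  has meanwhile grown only inside S + L, and \<open>HP\<close> says that \<open>y - v\<close> is
  still proper with respect to it.\<close>

lemma selfdual_absorb:
  assumes G: "skew_inv G" and n: "n * n = 1" and m: "m * m = 1" and L: "level p L"
    and y: "p \<cdot> y = z1 + z2" "(z1, scale (e * n) z1) \<in> G" "(z2, scale (e * m) z2) \<in> G" "z2 \<in> act p ` L"
    and HP: "\<And>s l \<alpha>. s \<in> Domain G \<Longrightarrow> l \<in> L \<Longrightarrow> \<alpha> \<in> Field omega1 \<Longrightarrow> y + s + l \<in> P p \<alpha> \<Longrightarrow>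
      y \<in> P p \<alpha> \<and> L \<subseteq> P p \<alpha>"
  obtains G' where "skew_inv G'" "G \<subseteq> G'" "y \<in> Domain G'"
proof -
  obtain G1 v where G1: "skew_inv G1" "G \<subseteq> G1" and v: "v \<in> L" "p \<cdot> v = z2" "(v, scale m v) \<in> G1"
    and D1: "\<forall>x\<in>Domain G1. \<exists>s\<in>Domain G. \<exists>l\<in>L. x = s + l"
    by (rule selfdual_lift[OF G m L y(3,4)])
  note SL = level_subspace[OF L]
  have px: "p \<cdot> (y - v) = z1" by (simp add: m.scale_right_diff_distrib y v)
  show ?thesis
  proof (cases "y - v \<in> Domain G1")
    case True
    moreover have "v \<in> Domain G1" using v by blast
    ultimately have "(y - v) + v \<in> Domain G1"
      by (rule m.subspace_add[OF partial_skew_Domain[OF skew_invD(1)[OF G1(1)]]])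
    then show ?thesis using that G1 by simp
  next
    case False
    let ?G = "adjoin G1 (y - v) (scale n (y - v))"
    have G': "skew_inv ?G"
    proof (rule skew_inv_adjoin_self[OF G1(1) p pe ee n False])
      show "(p \<cdot> (y - v), scale (e * n) (p \<cdot> (y - v))) \<in> G1" using y G1 by (auto simp: px)
      fix s \<alpha> assume s: "s \<in> Domain G1" and \<alpha>: "\<alpha> \<in> Field omega1" and m: "y - v + s \<in> P p \<alpha>"
      obtain s' l where sl: "s' \<in> Domain G" "l \<in> L" "s = s' + l" using D1 s by blast
      have "y + s' + (l - v) \<in> P p \<alpha>" using m by (simp add: sl(3) algebra_simps)
      then have "y \<in> P p \<alpha> \<and> L \<subseteq> P p \<alpha>"
        using HP[OF sl(1) m.subspace_diff[OF SL sl(2) v(1)] \<alpha>] by blast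
      then show "y - v \<in> P p \<alpha>" using v(1) P_diff by blast
    qed
    note DG = partial_skew_Domain[OF skew_invD(1)[OF G']]
    have "y - v \<in> Domain ?G" using adjoin_mem[OF skew_invD(1)[OF G1(1)]] by blast
    moreover have "v \<in> Domain ?G" using v(3) adjoin_superset by blast
    ultimately have "(y - v) + v \<in> Domain ?G" by (rule m.subspace_add[OF DG])
    moreover have "G \<subseteq> ?G" using G1(2) adjoin_superset by blast
    ultimately show ?thesis using that[OF G'] by simp
  qed
qed

lemma selfdual_absorb_far:
  assumes G: "skew_inv G" and n: "n * n = 1" and m: "m * m = 1"
    and b: "\<beta> \<in> Field omega1" "y \<in> P p \<beta>" and far: "\<And>s. s \<in> Domain G \<Longrightarrow> y + s \<notin> P p (sc \<beta>)"
    and y: "p \<cdot> y = z1 + z2" "(z1, scale (e * n) z1) \<in> G" "(z2, scale (e * m) z2) \<in> G"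
      "z2 \<in> P p (sc (sc \<beta>))"
  obtains G' where "skew_inv G'" "G \<subseteq> G'" "y \<in> Domain G'"
proof (rule selfdual_absorb[OF G n m _ y(1-3)])
  show "level p (P p (sc \<beta>))" unfolding level_def using b by auto
  show "z2 \<in> act p ` P p (sc \<beta>)" using y(4) b by (simp add: P_suc)
  show "y \<in> P p \<alpha> \<and> P p (sc \<beta>) \<subseteq> P p \<alpha>"
    if "s \<in> Domain G" "l \<in> P p (sc \<beta>)" "\<alpha> \<in> Field omega1" "y + s + l \<in> P p \<alpha>" for s l \<alpha>
    using far_levels[OF b far that] by blast
qed (rule that)

text \<open>
  Let \<open>y\<close> have maximal height \<open>\<beta>\<close> in its coset and \<open>p y = z\<^sub>1 + z\<^sub>2\<close> be the homogeneous components. If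
  one of them is higher than \<open>\<beta> + 1\<close> modulo \<open>p (S \<inter> P \<beta>)\<close>, then \<open>y\<close> is absorbed. Otherwise a
  homogeneous \<open>e\<^sub>1\<close> with \<open>p e\<^sub>1 = z\<^sub>1\<close> is adjoined first. This is of no use only if \<open>z\<^sub>2\<close> is congruent
  to \<open>- r\<^sub>0 z\<^sub>1\<close> with \<open>tw r\<^sub>0 = - r\<^sub>0\<close>; then \<open>1 - r\<^sub>0\<close> is a unit modulo \<open>p\<close>, and dividing \<open>y\<close> by
  it reduces to the first case.
\<close>

lemma selfdual_step:
  assumes G: "skew_inv G" and pxG: "p \<cdot> x \<in> Domain G"
  obtains G' where "skew_inv G'" "G \<subseteq> G'" "x \<in> Domain G'"
proof -
  note extended = that
  note GP = skew_invD(1)[OF G]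
  note GD = partial_skewD[OF GP]
  note SD = partial_skew_Domain[OF GP]
  let ?S = "Domain G"
  have me: "(- e) * (- e) = 1" using ee by simp
  obtain y s0 where s0: "y = x + s0" "s0 \<in> ?S"
    and ymax: "\<And>s \<alpha>. s \<in> ?S \<Longrightarrow> \<alpha> \<in> Field omega1 \<Longrightarrow> y + s \<in> P p \<alpha> \<Longrightarrow> y \<in> P p \<alpha>"
    by (rule ex_proper[OF GP, of x p]) blast
  have suff: ?thesis if G': "skew_inv G'" "G \<subseteq> G'" "y \<in> Domain G'" for G'
  proof -
    have "s0 \<in> Domain G'" using s0 G' by blast
    then have "y - s0 \<in> Domain G'"
      using m.subspace_diff[OF partial_skew_Domain[OF skew_invD(1)[OF G'(1)]]] G' by blast
    then show ?thesis using extended G' s0 by simp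
  qed
  have "p \<cdot> y \<in> ?S" using pxG s0 m.subspace_add[OF SD] m.subspace_scale[OF SD] by (simp add: act_add_right)
  then obtain b where zb: "(p \<cdot> y, b) \<in> G" by blast
  \<comment> \<open>The components \<open>z1\<close> and \<open>z2\<close> have signs 1 and -1, so
    homogeneous preimages have signs \<open>e\<close> and \<open>- e\<close>, since
    \<open>e * e = 1\<close>.\<close>
  define z1 where "z1 = half 1 (p \<cdot> y) b"
  define z2 where "z2 = half (- 1) (p \<cdot> y) b"
  have z: "p \<cdot> y = z1 + z2" unfolding z1_def z2_def by (simp add: half_sum)
  have z1: "(z1, scale (e * e) z1) \<in> G" using half_mem[OF G zb, of 1] by (simp add: z1_def ee)
  have z2: "(z2, scale (e * - e) z2) \<in> G" using half_mem[OF G zb, of "- 1"] by (simp add: z2_def ee)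
  have z1': "(z1, z1) \<in> G" and z2': "(z2, - z2) \<in> G" using z1 z2 by (simp_all add: ee)
  show ?thesis
  proof (cases "y \<in> D p")
    case True
    \<comment> \<open>At infinite height \<open>D p\<close> itself serves as the level, as
      multiplication by p maps it onto itself.\<close>
    have D: "level p (D p)" by (simp add: level_def)
    have "p \<cdot> y \<in> D p" using True m.subspace_scale[OF D_subspace] by blast
    then have "z2 \<in> D p" unfolding z2_def by (rule half_level[OF G zb D])
    then have "z2 \<in> act p ` D p" by (simp add: D_act)
    then obtain G' where "skew_inv G'" "G \<subseteq> G'" "y \<in> Domain G'"
      by (rule selfdual_absorb[OF G ee me D z z1 z2]) (use True D_subset in blast)
    then show ?thesis by (rule suff)
  next
    case False
    then obtain \<beta> where \<beta>: "\<beta> \<in> Field omega1" "y \<in> P p \<beta>" "y \<notin> P p (sc \<beta>)" by (rule D_height)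
    let ?Q2 = "P p (sc (sc \<beta>))"
    let ?Q1 = "P p (sc \<beta>)"
    have s1: "sc \<beta> \<in> Field omega1" and s2: "sc (sc \<beta>) \<in> Field omega1" using \<beta> by simp_all
    have far: "y + s \<notin> ?Q1" if "s \<in> ?S" for s
      using ymax[OF that s1] \<beta>(3) by blast
    show ?thesis
    proof (cases "\<exists>s\<in>?S. s \<in> P p \<beta> \<and> z1 + p \<cdot> s \<in> ?Q2")
      case True
      then obtain s c where s: "(s, c) \<in> G" "s \<in> P p \<beta>" "z1 + p \<cdot> s \<in> ?Q2" by blast
      \<comment> \<open>For the component of \<open>s\<close> of sign \<open>e\<close>, the sum of
        \<open>z1\<close> and its multiple by p is the +1 component of z1 + p s, hence still high.
        The absorption then applies with the roles of the two signs exchanged.\<close>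
      let ?s = "half e s c"
      have sG: "(?s, scale e ?s) \<in> G" by (rule half_mem[OF G s(1) ee])
      have pr: "(z1 + p \<cdot> s, z1 + scale e (p \<cdot> c)) \<in> G" by (rule GD(2)[OF z1' act_pair'[OF G s(1)]])
      have "half 1 (z1 + p \<cdot> s) (z1 + scale e (p \<cdot> c)) = z1 + p \<cdot> ?s"
        using half_self[of 1 z1] by (simp add: half_add half_scale half_act)
      then have h: "z1 + p \<cdot> ?s \<in> ?Q2" using half_P[OF G pr s2 s(3), of 1] by simp
      have hG: "(z1 + p \<cdot> ?s, scale (e * e) (z1 + p \<cdot> ?s)) \<in> G"
        using GD(2)[OF z1' act_pair[OF G sG]] by (simp add: ee)
      have y': "p \<cdot> (y + ?s) = z2 + (z1 + p \<cdot> ?s)" by (simp add: act_add_right z add.commute add.left_commute)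
      have "?s \<in> ?S" using sG by blast
      have far': "y + ?s + t \<notin> ?Q1" if "t \<in> ?S" for t
        using far[OF m.subspace_add[OF SD \<open>?s \<in> ?S\<close> that]] by (simp add: add.assoc)
      have yP: "y + ?s \<in> P p \<beta>" using P_add \<beta>(2) half_P[OF G s(1) \<beta>(1) s(2)] by blast
      obtain G' where G': "skew_inv G'" "G \<subseteq> G'" "y + ?s \<in> Domain G'"
        by (rule selfdual_absorb_far[OF G me ee \<beta>(1) yP far' y' z2 hG h])
      have "y + ?s - ?s \<in> Domain G'"
        using G' \<open>?s \<in> ?S\<close> by (intro m.subspace_diff[OF partial_skew_Domain[OF skew_invD(1)[OF G'(1)]]]) auto
      then show ?thesis using suff G' by simp
    next
      case N1: False
      have zP: "p \<cdot> y \<in> ?Q1" by (rule P_suc_act[OF \<beta>(1,2)])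
      then have z1P: "z1 \<in> ?Q1" unfolding z1_def by (rule half_P[OF G zb s1])
      then obtain e1 where e1: "e1 \<in> P p \<beta>" "p \<cdot> e1 = z1" using P_suc[OF \<beta>(1)] by auto
      \<comment> \<open>A preimage \<open>e1\<close> of \<open>z1\<close> is now automatically
        proper: a higher \<open>e1 + s\<close> would provide an \<open>s\<close> excluded by
        \<open>N1\<close>.\<close>
      have far1: "e1 + s \<notin> ?Q1" if s: "s \<in> ?S" for s
      proof
        assume a: "e1 + s \<in> ?Q1"
        then have "s \<in> P p \<beta>" using P_diff[OF P_suc_subset2[OF \<beta>(1) a] e1(1)] by simp
        moreover have "z1 + p \<cdot> s \<in> ?Q2"
          using P_suc_act[OF s1 a] by (simp add: act_add_right e1)
        ultimately show False using N1 s by blast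
      qed
      have e1S: "e1 \<notin> ?S" using far1[of "- e1"] m.subspace_neg[OF SD] by auto
      let ?G1 = "adjoin G e1 (scale e e1)"
      have G1: "skew_inv ?G1"
      proof (rule skew_inv_adjoin_self[OF G p pe ee ee e1S])
        show "(p \<cdot> e1, scale (e * e) (p \<cdot> e1)) \<in> G" using z1 e1 by simp
        show "e1 \<in> P p \<alpha>" if "s \<in> ?S" "\<alpha> \<in> Field omega1" "e1 + s \<in> P p \<alpha>" for s \<alpha>
          using far_levels[OF \<beta>(1) e1(1) far1 that(1) P_zero_mem that(2)] that(3) by simp
      qed
      note GP1 = skew_invD(1)[OF G1]
      note SD1 = partial_skew_Domain[OF GP1]
      have e1G: "e1 \<in> Domain ?G1" using adjoin_mem[OF GP] by blast
      show ?thesis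
      proof (cases "\<exists>s\<in>Domain ?G1. y - e1 + s \<in> ?Q1")
        case False
        \<comment> \<open>\<open>y - e1\<close> is proper for the enlarged domain and is mapped by p
          to \<open>z2\<close>, so it is adjoined with sign \<open>- e\<close>.\<close>
        then have far2: "\<And>s. s \<in> Domain ?G1 \<Longrightarrow> y - e1 + s \<notin> ?Q1" by blast
        have yP: "y - e1 \<in> P p \<beta>" using P_diff \<beta>(2) e1 by blast
        have nS: "y - e1 \<notin> Domain ?G1"
          using far2[of "- (y - e1)"] m.subspace_neg[OF SD1, of "y - e1"] by auto
        let ?G2 = "adjoin ?G1 (y - e1) (scale (- e) (y - e1))"
        have p2: "p \<cdot> (y - e1) = z2" by (simp add: m.scale_right_diff_distrib z e1)
        have G2: "skew_inv ?G2"
        proof (rule skew_inv_adjoin_self[OF G1 p pe ee me nS])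
          show "(p \<cdot> (y - e1), scale (e * - e) (p \<cdot> (y - e1))) \<in> ?G1"
            unfolding p2 using z2 adjoin_superset by blast
          show "y - e1 \<in> P p \<alpha>"
            if "s \<in> Domain ?G1" "\<alpha> \<in> Field omega1" "y - e1 + s \<in> P p \<alpha>" for s \<alpha>
            using far_levels[OF \<beta>(1) yP far2 that(1) P_zero_mem that(2)] that(3) by simp
        qed
        have "y - e1 + e1 \<in> Domain ?G2"
          using adjoin_mem[OF GP1] e1G adjoin_superset
          by (intro m.subspace_add[OF partial_skew_Domain[OF skew_invD(1)[OF G2]]]) blast+
        then have "y \<in> Domain ?G2" by simp
        moreover have "G \<subseteq> ?G2" using adjoin_superset by blast
        ultimately show ?thesis using suff[OF G2] by blast
      next
        case True
        then obtain s r where s: "s \<in> ?S" and a: "y - e1 + (s + r \<cdot> e1) \<in> ?Q1"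
          unfolding Domain_adjoin by blast
        have "s = (y - e1 + (s + r \<cdot> e1)) - y + e1 - r \<cdot> e1" by simp
        also have "\<dots> \<in> P p \<beta>"
          by (intro P_diff P_add P_act P_suc_subset2[OF \<beta>(1) a] \<beta>(2) e1(1))
        finally have sP: "s \<in> P p \<beta>" .
        obtain c where sc: "(s, c) \<in> G" using s by blast
        \<comment> \<open>\<open>g\<close> is p times the element that is too high, and
          \<open>g'\<close> is its image under \<sigma>. Taking the -1 component keeps
          \<open>z2\<close>, turns \<open>s\<close> into its component \<open>t\<close> of sign
          \<open>- e\<close>, and turns \<open>r\<close> into its odd part
          \<open>r0\<close>.\<close>
        define g where "g = z2 + p \<cdot> s + r \<cdot> z1"
        define g' where "g' = - z2 + scale e (p \<cdot> c) + tw r \<cdot> z1"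
        have "p \<cdot> (y - e1 + (s + r \<cdot> e1)) = g"
          by (simp add: g_def act_add_right m.scale_right_diff_distrib z e1 act_commute[of p r] algebra_simps)
        then have g: "g \<in> ?Q2" using P_suc_act[OF s1 a] by simp
        have "(g, g') \<in> G" unfolding g_def g'_def
          by (intro GD(2) z2' act_pair'[OF G sc] GD(3) z1')
        then have hg: "half (- 1) g g' \<in> ?Q2" using half_P[OF G _ s2 g] by blast
        define r0 where "r0 = smultp (1 / 2) (r - tw r)"
        define t where "t = half (- e) s c"
        have t: "(t, scale (- e) t) \<in> G" unfolding t_def by (rule half_mem[OF G sc me])
        then have tS: "t \<in> ?S" by blast
        have tP: "t \<in> P p \<beta>" unfolding t_def by (rule half_P[OF G sc \<beta>(1) sP])
        define d where "d = z2 + p \<cdot> t + r0 \<cdot> z1"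
        have "half (- 1) g g' = half (- 1) z2 (scale (- 1) z2) + half (- 1) (p \<cdot> s) (scale e (p \<cdot> c)) + half (- 1) (r \<cdot> z1) (tw r \<cdot> z1)"
          unfolding g_def g'_def by (simp only: half_add[symmetric]) simp
        also have "half (- 1) z2 (scale (- 1) z2) = z2" by (rule half_self) simp
        also have "half (- 1) (p \<cdot> s) (scale e (p \<cdot> c)) = p \<cdot> t"
          by (simp add: t_def half_act half_scale)
        also have "half (- 1) (r \<cdot> z1) (tw r \<cdot> z1) = r0 \<cdot> z1"
          by (simp add: half_def r0_def act_smult m.scale_left_diff_distrib)
        finally have d: "d \<in> ?Q2" using hg by (simp add: d_def)
        have twr0: "tw r0 = - r0" by (simp add: r0_def tw_smult tw_diff flip: smult_minus_right)
        \<comment> \<open>If \<open>p\<close> divided 1 - r0, it would also divide the twist 1 + r0,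
          hence the sum 2.\<close>
        have nd: "\<not> p dvd 1 - r0"
        proof
          assume a: "p dvd 1 - r0"
          then have "tw p dvd 1 + r0" using tw_dvd[OF a] by (simp add: tw_diff twr0)
          moreover have "p dvd tw p" by (simp add: pe dvd_smult)
          ultimately have "p dvd (1 - r0) + (1 + r0)" using a dvd_trans dvd_add by blast
          also have "(1 - r0) + (1 + r0) = smultp 2 1" by (simp add: one_pCons numeral_poly)
          finally show False using two_nonzero irreducible_not_dvd_one[OF p] dvd_smult_iff by blast
        qed
        obtain A B where AB: "A * (1 - r0) + B * p = 1" using irreducible_bezout[OF p nd] .
        note bz = bezout_act[OF AB]
        \<comment> \<open>Up to \<open>d\<close>, which lies in stage \<beta> + 2, the element p (y
          + t) is (1 - r0) z1. The inverse \<open>A\<close> of 1 - r0 modulo \<open>p\<close> turns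
          this into \<open>z1\<close>, and only the high remainder \<open>d'\<close> contributes a
          component of sign -1.\<close>
        have pyt: "p \<cdot> (y + t) = (1 - r0) \<cdot> z1 + d"
          by (simp add: d_def act_add_right z m.scale_left_diff_distrib algebra_simps)
        define d' where "d' = A \<cdot> d - B \<cdot> p \<cdot> z1"
        have "p \<cdot> A \<cdot> (y + t) = A \<cdot> (1 - r0) \<cdot> z1 + A \<cdot> d"
          by (subst act_commute) (simp only: pyt act_add_right[of A])
        also have "\<dots> = z1 + d'" using bz[of z1] by (simp add: d'_def algebra_simps)
        finally have py2: "p \<cdot> A \<cdot> (y + t) = z1 + d'" .
        have d'P: "d' \<in> ?Q2" unfolding d'_def
          by (intro P_diff P_act d P_suc_act[OF s1 z1P])
        have zS: "z1 \<in> ?S" "z2 \<in> ?S" using z1' z2' by blast+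
        have "d' \<in> ?S" unfolding d'_def d_def
          by (intro m.subspace_diff[OF SD] m.subspace_add[OF SD] m.subspace_scale[OF SD] zS tS)
        then obtain f where f: "(d', f) \<in> G" by blast
        define d1 where "d1 = half 1 d' f"
        define d2 where "d2 = half (- 1) d' f"
        have d1: "(d1, scale 1 d1) \<in> G" and d2: "(d2, scale (- 1) d2) \<in> G"
          unfolding d1_def d2_def by (rule half_mem[OF G f], simp)+
        have d2P: "d2 \<in> ?Q2" unfolding d2_def by (rule half_P[OF G f s2 d'P])
        have zd: "(z1 + d1, scale (e * e) (z1 + d1)) \<in> G" using GD(2)[OF z1' d1] by (simp add: ee)
        have d2': "(d2, scale (e * - e) d2) \<in> G" using d2 by (simp add: ee)
        have py2': "p \<cdot> A \<cdot> (y + t) = (z1 + d1) + d2"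
          unfolding py2 d1_def d2_def using half_sum[of d' f] by (simp add: add.assoc)
        have pytS: "p \<cdot> (y + t) \<in> ?S"
          unfolding pyt d_def by (intro m.subspace_add[OF SD] m.subspace_scale[OF SD] zS tS)
        \<comment> \<open>Multiplication by 1 - r0 undoes \<open>A\<close> modulo S, so an element
          of this coset that is too high would give one in the coset of \<open>y\<close>.\<close>
        have far3: "A \<cdot> (y + t) + s \<notin> ?Q1" if s: "s \<in> ?S" for s
        proof
          assume "A \<cdot> (y + t) + s \<in> ?Q1"
          then have "(1 - r0) \<cdot> (A \<cdot> (y + t) + s) \<in> ?Q1" by (rule P_act)
          also have "(1 - r0) \<cdot> (A \<cdot> (y + t) + s) = y + (t - B \<cdot> p \<cdot> (y + t) + (1 - r0) \<cdot> s)"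
            using bz[of "y + t"] by (simp only: act_add_right[of "1 - r0"] act_commute[of "1 - r0" A]) (simp add: algebra_simps)
          finally show False
            using far[of "t - B \<cdot> p \<cdot> (y + t) + (1 - r0) \<cdot> s"] s tS pytS
            by (simp add: m.subspace_diff[OF SD] m.subspace_add[OF SD] m.subspace_scale[OF SD])
        qed
        have y2P: "A \<cdot> (y + t) \<in> P p \<beta>" by (intro P_act P_add \<beta>(2) tP)
        obtain G' where G': "skew_inv G'" "G \<subseteq> G'" "A \<cdot> (y + t) \<in> Domain G'"
          by (rule selfdual_absorb_far[OF G ee me \<beta>(1) y2P far3 py2' zd d2' d2P])
        note SD' = partial_skew_Domain[OF skew_invD(1)[OF G'(1)]]
        have "y = (1 - r0) \<cdot> A \<cdot> (y + t) + B \<cdot> p \<cdot> (y + t) - t"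
          using bz[of "y + t"] by (simp only: act_commute[of "1 - r0" A]) simp
        also have "\<dots> \<in> Domain G'"
        proof -
          have t: "t \<in> Domain G'" and pt: "p \<cdot> (y + t) \<in> Domain G'" using tS pytS G'(2) by blast+
          show ?thesis
            by (rule m.subspace_diff[OF SD' m.subspace_add[OF SD' m.subspace_scale[OF SD' G'(3)]
                  m.subspace_scale[OF SD' pt]] t])
        qed
        finally show ?thesis using suff G' by blast
      qed
    qed
  qed
qed

end

end

section \<open>Extension at a prime that is not self-dual, and the back-and-forth construction\<close>

context countable_endo_odd
begin

text \<open>Being proper of the same height \<beta>, the elements \<open>y\<close> and
  \<open>w\<close> lie in corresponding stages.\<close>

lemma pair_step_far:
  assumes G: "skew_inv G" and p: "irreducible p" "\<not> p dvd tw p"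
    and b: "\<beta> \<in> Field omega1" and y: "y \<in> P p \<beta>" "\<And>s. s \<in> Domain G \<Longrightarrow> y + s \<notin> P p (sc \<beta>)"
    and w: "w \<in> P (tw p) \<beta>" "\<And>s. s \<in> Domain G \<Longrightarrow> w + s \<notin> P (tw p) (sc \<beta>)"
    and yw: "(p \<cdot> y, tw p \<cdot> w) \<in> G"
  shows "skew_inv (adjoin (adjoin G y w) w y)"
proof (rule skew_inv_adjoin_pair[OF G p _ _ yw])
  note SD = partial_skew_Domain[OF skew_invD(1)[OF G]]
  show "y \<notin> Domain G" using y(2)[of "- y"] m.subspace_neg[OF SD, of y] by auto
  show "w \<notin> Domain G" using w(2)[of "- w"] m.subspace_neg[OF SD, of w] by auto
  have z: "0 \<in> Domain G" by (rule m.subspace_0[OF SD])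
  have iff: "v \<in> P q \<alpha> \<longleftrightarrow> (\<alpha>, \<beta>) \<in> omega1"
    if a: "\<alpha> \<in> Field omega1" and v: "v \<in> P q \<beta>" "v \<notin> P q (sc \<beta>)" for \<alpha> v q
  proof
    assume m: "v \<in> P q \<alpha>"
    show "(\<alpha>, \<beta>) \<in> omega1"
    proof (rule ccontr)
      assume "(\<alpha>, \<beta>) \<notin> omega1"
      then have "(sc \<beta>, \<alpha>) \<in> omega1" using not_below b a by blast
      then show False using P_antimono m v(2) by blast
    qed
  next
    assume "(\<alpha>, \<beta>) \<in> omega1"
    then show "v \<in> P q \<alpha>" using P_antimono v(1) by blast
  qed
  show "(y \<in> P p \<alpha>) = (w \<in> P (tw p) \<alpha>)" if "\<alpha> \<in> Field omega1" for \<alpha>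
    using iff[OF that y(1)] iff[OF that w(1)] y(2)[OF z] w(2)[OF z] by simp
  show "y \<in> P p \<alpha>" if "s \<in> Domain G" "\<alpha> \<in> Field omega1" "y + s \<in> P p \<alpha>" for s \<alpha>
    using far_levels[OF b y that(1) P_zero_mem that(2)] that(3) by simp
  show "w \<in> P (tw p) \<alpha>" if "s \<in> Domain G" "\<alpha> \<in> Field omega1" "w + s \<in> P (tw p) \<alpha>" for s \<alpha>
    using far_levels[OF b w that(1) P_zero_mem that(2)] that(3) by simp
qed

text \<open>Kaplansky's invariants enter the back-and-forth construction only through this condition.\<close>

definition transfer :: "('b \<times> 'b) set \<Rightarrow> 'a poly \<Rightarrow> bool" where
  "transfer G p \<longleftrightarrow>
     (\<forall>\<alpha>\<in>Field omega1. (\<exists>k\<in>P p \<alpha>. p \<cdot> k \<in> P p (sc (sc \<alpha>)) \<and> (\<forall>s\<in>Domain G. k + s \<notin> P p (sc \<alpha>))) \<longrightarrow>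
        (\<exists>k\<in>P (tw p) \<alpha>. tw p \<cdot> k \<in> P (tw p) (sc (sc \<alpha>)) \<and> (\<forall>s\<in>Domain G. k + s \<notin> P (tw p) (sc \<alpha>)))) \<and>
     ((\<exists>k\<in>D p. p \<cdot> k = 0 \<and> k \<notin> Domain G) \<longrightarrow> (\<exists>k\<in>D (tw p). tw p \<cdot> k = 0 \<and> k \<notin> Domain G))"

text \<open>For a proper \<open>y\<close> of height \<beta>, the partner is a proper preimage, again
  of height \<beta>, of \<sigma>(p y) under \<open>tw p\<close>. If no p (y + s), with s in S of
  height at least \<beta>, jumps to stage \<beta> + 2, every preimage in stage \<beta> will do. If
  one jumps, y + s represents a class outside the image of S in the kernel that defines the
  invariant at \<beta>, and \<open>transfer\<close> provides a counterpart.\<close>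

lemma pair_step:
  assumes G: "skew_inv G" and p: "irreducible p" "\<not> p dvd tw p" and tr: "transfer G p"
    and pxG: "p \<cdot> x \<in> Domain G"
  obtains G' where "skew_inv G'" "G \<subseteq> G'" "x \<in> Domain G'"
proof -
  note extended = that
  note GP = skew_invD(1)[OF G]
  note GD = partial_skewD[OF GP]
  note SD = partial_skew_Domain[OF GP]
  let ?S = "Domain G"
  obtain y s0 where s0: "y = x + s0" "s0 \<in> ?S"
    and ymax: "\<And>s \<alpha>. s \<in> ?S \<Longrightarrow> \<alpha> \<in> Field omega1 \<Longrightarrow> y + s \<in> P p \<alpha> \<Longrightarrow> y \<in> P p \<alpha>"
    by (rule ex_proper[OF GP, of x p]) blast
  have suff: ?thesis if G': "skew_inv G'" "G \<subseteq> G'" "y + s \<in> Domain G'" "s \<in> ?S" for G' s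
  proof -
    note SD' = partial_skew_Domain[OF skew_invD(1)[OF G'(1)]]
    have "s0 \<in> Domain G'" "s \<in> Domain G'" using s0 G' by blast+
    then have "y + s - s - s0 \<in> Domain G'"
      using m.subspace_diff[OF SD'] G'(3) by blast
    then show ?thesis using extended G' s0 by simp
  qed
  have zS: "p \<cdot> y \<in> ?S" using pxG s0 m.subspace_add[OF SD] m.subspace_scale[OF SD] by (simp add: act_add_right)
  then obtain b where zb: "(p \<cdot> y, b) \<in> G" by blast
  have pairext: ?thesis
    if e: "skew_inv (adjoin (adjoin G (y + s) w) w (y + s))" and s: "s \<in> ?S" for s w
  proof (rule suff[OF e _ _ s])
    show "G \<subseteq> adjoin (adjoin G (y + s) w) w (y + s)" using adjoin_superset by blast
    show "y + s \<in> Domain (adjoin (adjoin G (y + s) w) w (y + s))"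
      using adjoin_mem[OF GP, of "y + s" w] adjoin_superset by blast
  qed
  have z0: "0 \<in> ?S" by (rule m.subspace_0[OF SD])
  show ?thesis
  proof (cases "y \<in> ?S")
    case True
    then show ?thesis using suff[OF G subset_refl, of 0] z0 by simp
  next
    case yS: False
    show ?thesis
    proof (cases "y \<in> D p")
      case True
      have "p \<cdot> y \<in> D p" using True m.subspace_scale[OF D_subspace] by blast
      then have "b \<in> D (tw p)" using partial_skew_D[OF GP p(1) zb] by blast
      then obtain w0 where w0: "w0 \<in> D (tw p)" "tw p \<cdot> w0 = b" using D_act[of "tw p"] by (metis imageE)
      have "\<exists>w\<in>D (tw p). tw p \<cdot> w = b \<and> w \<notin> ?S"
      proof (cases "w0 \<in> ?S")
        case True
        \<comment> \<open>If \<open>w0\<close> is already in S, its partner \<open>c\<close> differs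
          from \<open>y\<close> by an element of the kernel of p in \<open>D p\<close> outside S.
          The counterpart \<open>k\<close> of that element moves \<open>w0\<close> out of S.\<close>
        then obtain c where "(w0, c) \<in> G" by blast
        then have c: "(c, w0) \<in> G" by (rule skew_invD(2)[OF G])
        have "(p \<cdot> c, b) \<in> G" using GD(3)[OF c, of p] w0 by simp
        then have "p \<cdot> c = p \<cdot> y"
          using partial_skew_unique[OF GP skew_invD(2)[OF G zb] skew_invD(2)[OF G]] by simp
        then have "p \<cdot> (y - c) = 0" by (simp add: m.scale_right_diff_distrib)
        moreover have "c \<in> D p" using partial_skew_D[OF GP p(1) c] w0 by blast
        then have "y - c \<in> D p" using \<open>y \<in> D p\<close> m.subspace_diff[OF D_subspace] by blast
        moreover have "y - c \<notin> ?S"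
        proof
          assume "y - c \<in> ?S"
          then have "y - c + c \<in> ?S" using c m.subspace_add[OF SD] by blast
          then show False using yS by simp
        qed
        ultimately obtain k where k: "k \<in> D (tw p)" "tw p \<cdot> k = 0" "k \<notin> ?S"
          using tr unfolding transfer_def by blast
        have "w0 + k \<notin> ?S"
        proof
          assume "w0 + k \<in> ?S"
          then have "w0 + k - w0 \<in> ?S" using True m.subspace_diff[OF SD] by blast
          then show False using k by simp
        qed
        then show ?thesis using k w0 m.subspace_add[OF D_subspace]
          by (intro bexI[of _ "w0 + k"]) (auto simp: act_add_right)
      next
        case False
        then show ?thesis using w0 by blast
      qed
      then obtain w where w: "w \<in> D (tw p)" "tw p \<cdot> w = b" "w \<notin> ?S" by blast
      have "skew_inv (adjoin (adjoin G y w) w y)"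
        by (rule skew_inv_adjoin_pair[OF G p yS w(3)]) (use zb w True D_subset in auto)
      then show ?thesis using pairext[of 0 w] z0 by simp
    next
      case False
      then obtain \<beta> where \<beta>: "\<beta> \<in> Field omega1" "y \<in> P p \<beta>" "y \<notin> P p (sc \<beta>)" by (rule D_height)
      let ?Q2 = "P p (sc (sc \<beta>))"
      let ?Q1 = "P p (sc \<beta>)"
      let ?R2 = "P (tw p) (sc (sc \<beta>))"
      let ?R1 = "P (tw p) (sc \<beta>)"
      have s1: "sc \<beta> \<in> Field omega1" and s2: "sc (sc \<beta>) \<in> Field omega1" using \<beta> by simp_all
      have far: "y + s \<notin> ?Q1" if "s \<in> ?S" for s
        using ymax[OF that s1] \<beta>(3) by blast
      have ht: "a \<in> P p \<alpha> \<longleftrightarrow> c \<in> P (tw p) \<alpha>" if "\<alpha> \<in> Field omega1" "(a, c) \<in> G" for a c \<alpha>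
        by (rule GD(6)[OF p(1) that])
      show ?thesis
      proof (cases "\<exists>s\<in>?S. s \<in> P p \<beta> \<and> p \<cdot> y + p \<cdot> s \<in> ?Q2")
        case True
        then obtain s where s: "s \<in> ?S" "s \<in> P p \<beta>" "p \<cdot> (y + s) \<in> ?Q2"
          by (auto simp: act_add_right)
        have far': "y + s + t \<notin> ?Q1" if "t \<in> ?S" for t
          using far[OF m.subspace_add[OF SD s(1) that]] by (simp add: add.assoc)
        have yP: "y + s \<in> P p \<beta>" using P_add \<beta>(2) s(2) by blast
        have "p \<cdot> (y + s) \<in> ?S"
          using zS s m.subspace_add[OF SD] m.subspace_scale[OF SD] by (simp add: act_add_right)
        then obtain b1 where b1: "(p \<cdot> (y + s), b1) \<in> G" by blast
        then have b1P: "b1 \<in> ?R2" using ht[OF s2 b1] s(3) by blast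
        obtain k where k: "k \<in> P (tw p) \<beta>" "tw p \<cdot> k \<in> ?R2"
          "\<And>s. s \<in> ?S \<Longrightarrow> k + s \<notin> ?R1"
          using tr \<beta>(1) yP s(3) far' unfolding transfer_def by blast
        \<comment> \<open>Both terms lie in stage \<beta> + 2, so \<open>k\<close> can be corrected
          to a preimage of \<open>b1\<close> by some \<open>v\<close> in stage \<beta> + 1, which is
          too high to affect properness.\<close>
        have "b1 - tw p \<cdot> k \<in> ?R2" by (rule P_diff[OF b1P k(2)])
        then obtain v where v: "v \<in> ?R1" "b1 - tw p \<cdot> k = tw p \<cdot> v"
          using P_suc[OF s1] by auto
        have w: "tw p \<cdot> (k + v) = b1" using v(2) by (simp add: act_add_right algebra_simps)
        have wP: "k + v \<in> P (tw p) \<beta>" using P_add k(1) P_suc_subset2[OF \<beta>(1) v(1)] by blast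
        have wfar: "k + v + t \<notin> ?R1" if t: "t \<in> ?S" for t
        proof
          assume "k + v + t \<in> ?R1"
          then have "k + v + t - v \<in> ?R1" using v(1) P_diff by blast
          then show False using k(3)[OF t] by (simp add: algebra_simps)
        qed
        have "skew_inv (adjoin (adjoin G (y + s) (k + v)) (k + v) (y + s))"
          by (rule pair_step_far[OF G p \<beta>(1) yP far' wP wfar]) (simp_all add: w b1)
        then show ?thesis using pairext s(1) by blast
      next
        case N: False
        have "p \<cdot> y \<in> ?Q1" by (rule P_suc_act[OF \<beta>(1,2)])
        then have "b \<in> ?R1" using ht[OF s1 zb] by blast
        then obtain w where w: "w \<in> P (tw p) \<beta>" "b = tw p \<cdot> w" using P_suc[OF \<beta>(1)] by auto
        have wfar: "w + t \<notin> ?R1" if t: "t \<in> ?S" for t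
        proof
          \<comment> \<open>Pulled back along \<sigma>, such a \<open>t\<close> would make p y + p c
            jump, contrary to \<open>N\<close>.\<close>
          assume a: "w + t \<in> ?R1"
          then have tP: "t \<in> P (tw p) \<beta>" using P_diff[OF P_suc_subset2[OF \<beta>(1) a] w(1)] by simp
          obtain c where "(t, c) \<in> G" using t by blast
          then have c: "(c, t) \<in> G" by (rule skew_invD(2)[OF G])
          have cP: "c \<in> P p \<beta>" using ht[OF \<beta>(1) c] tP by blast
          have "(p \<cdot> y + p \<cdot> c, b + tw p \<cdot> t) \<in> G" by (rule GD(2)[OF zb GD(3)[OF c]])
          moreover have "b + tw p \<cdot> t \<in> ?R2"
            using P_suc_act[OF s1 a] by (simp add: act_add_right w)
          ultimately have "p \<cdot> y + p \<cdot> c \<in> ?Q2" using ht[OF s2] by blast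
          then show False using N c cP by blast
        qed
        have "skew_inv (adjoin (adjoin G y w) w y)"
          by (rule pair_step_far[OF G p \<beta>(1,2) far w(1) wfar]) (use zb w in simp_all)
        then show ?thesis using pairext[of 0 w] z0 by simp
      qed
    qed
  qed
qed

section \<open>Exhausting the space by partial involutions\<close>

lemma skew_inv_zero: "skew_inv {(0, 0)}"
proof -
  have "fin_span {0}" unfolding fin_span_def by (intro exI[of _ "{}"]) simp
  then show ?thesis
    unfolding skew_inv_def partial_skew_def by (auto simp: sym_def)
qed

text \<open>If r = p k with \<open>p\<close> irreducible, one extension step at \<open>p\<close>
  brings \<open>k \<cdot> x\<close> into the domain, and \<open>k\<close> has smaller degree than
  \<open>r\<close>.\<close>

lemma skew_inv_absorb:
  assumes tr: "\<And>G p. skew_inv G \<Longrightarrow> irreducible p \<Longrightarrow> \<not> p dvd tw p \<Longrightarrow> transfer G p"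
    and G: "skew_inv G" and r: "r \<noteq> 0" "r \<cdot> x \<in> Domain G"
  shows "\<exists>G'. skew_inv G' \<and> G \<subseteq> G' \<and> x \<in> Domain G'"
  using G r
proof (induction "degree r" arbitrary: r G rule: less_induct)
  case less
  note SD = partial_skew_Domain[OF skew_invD(1)[OF less.prems(1)]]
  show ?case
  proof (cases "degree r = 0")
    case True
    then obtain c where c: "r = [:c:]" by (rule degree_eq_zeroE)
    then have "c \<noteq> 0" using less.prems by simp
    then have "[:inverse c:] \<cdot> r \<cdot> x = x" by (simp add: c)
    then have "x \<in> Domain G" using m.subspace_scale[OF SD less.prems(3), of "[:inverse c:]"] by simp
    then show ?thesis using less.prems by blast
  next
    case False
    then obtain p where p: "irreducible p" "p dvd r" using ex_irreducible_factor[of r] by blast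
    then obtain k where k: "r = p * k" by (auto elim: dvdE)
    then have nz: "p \<noteq> 0" "k \<noteq> 0" using less.prems by auto
    have "degree p > 0" using irreducible_not_dvd_one[OF p(1)] is_unit_iff_degree[OF nz(1)] by simp
    then have deg: "degree k < degree r" using k nz by (simp add: degree_mult_eq)
    have pk: "p \<cdot> k \<cdot> x \<in> Domain G" using less.prems k by (simp add: act_mult)
    obtain G1 where G1: "skew_inv G1" "G \<subseteq> G1" "k \<cdot> x \<in> Domain G1"
    proof (cases "p dvd tw p")
      case True
      obtain e where "tw p = smultp e p" "e * e = 1" by (rule irreducible_dvd_tw_cases[OF p(1) True])
      then show ?thesis using selfdual_step[OF p(1) _ _ less.prems(1) pk] that by blast
    next
      case False
      show ?thesis
        by (rule pair_step[OF less.prems(1) p(1) False tr[OF less.prems(1) p(1) False] pk]) (rule that)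
    qed
    then show ?thesis using less.hyps[OF deg G1(1) nz(2)] by blast
  qed
qed

lemma locally_finite_torsion:
  assumes "locally_finite scale u"
  obtains r where "r \<noteq> 0" "r \<cdot> x = 0"
proof -
  obtain c k where c: "finite {k. c k \<noteq> 0}" "c k \<noteq> 0"
    "(\<Sum>k | c k \<noteq> 0. scale (c k) ((u ^^ k) x)) = 0"
    using assms unfolding locally_finite_def by blast
  define r where "r = (\<Sum>k | c k \<noteq> 0. monom (c k) k)"
  have "r \<cdot> x = 0" using c(3) by (simp add: r_def m.scale_sum_left act_monom)
  moreover have "coeff r k = c k"
    using c(1,2) by (simp add: r_def coeff_sum sum.delta' if_distrib cong: if_cong)
  then have "r \<noteq> 0" using c(2) by auto
  ultimately show ?thesis using that by blast
qed

text \<open>Since the graphs are symmetric, forth and back are the same move: it is enough to absorb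
  a basis into the domains of an increasing chain. The eigenspaces of the union are exchanged by
  \<open>u\<close> because \<open>tw\<close> changes the sign of t.\<close>

lemma exchange_if_transfer:
  assumes tr: "\<And>G p. skew_inv G \<Longrightarrow> irreducible p \<Longrightarrow> \<not> p dvd tw p \<Longrightarrow> transfer G p"
    and lf: "locally_finite scale u"
  shows "exchange_property scale u"
proof -
  obtain B where B: "countable B" "span B = UNIV"
    using countable_dim unfolding countable_dim_def by blast
  define b where "b = from_nat_into B"
  have Bb: "B \<subseteq> range b" unfolding b_def using B by (simp add: subset_range_from_nat_into)
  have "\<exists>Gs. \<forall>n. skew_inv (Gs n) \<and> (Gs n \<subseteq> Gs (Suc n) \<and> b n \<in> Domain (Gs (Suc n)))"
  proof (rule dependent_nat_choice)
    show "\<exists>G. skew_inv G" using skew_inv_zero by blast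
    fix G n assume G: "skew_inv G"
    obtain r where r: "r \<noteq> 0" "r \<cdot> b n = 0" by (rule locally_finite_torsion[OF lf])
    then have "r \<cdot> b n \<in> Domain G"
      using m.subspace_0[OF partial_skew_Domain[OF skew_invD(1)[OF G]]] by simp
    then show "\<exists>G'. skew_inv G' \<and> G \<subseteq> G' \<and> b n \<in> Domain G'"
      using skew_inv_absorb[OF tr G r(1)] by blast
  qed
  then obtain Gs where Gs: "\<And>n. skew_inv (Gs n)" "\<And>n. Gs n \<subseteq> Gs (Suc n)" "\<And>n. b n \<in> Domain (Gs (Suc n))"
    by blast
  have mono: "Gs m \<subseteq> Gs n" if "m \<le> n" for m n using lift_Suc_mono_le[of Gs m n] Gs(2) that by blast
  define H where "H = (\<Union>n. Gs n)"
  have two: "\<exists>n. z \<in> Gs n \<and> z' \<in> Gs n" if "z \<in> H" "z' \<in> H" for z z'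
  proof -
    obtain m n where "z \<in> Gs m" "z' \<in> Gs n" using \<open>z \<in> H\<close> \<open>z' \<in> H\<close> unfolding H_def by blast
    then have "z \<in> Gs (max m n)" "z' \<in> Gs (max m n)" using mono[of m "max m n"] mono[of n "max m n"] by auto
    then show ?thesis by blast
  qed
  have Hadd: "(x + x', y + y') \<in> H" if "(x, y) \<in> H" "(x', y') \<in> H" for x y x' y'
    using two[OF that] partial_skewD(2)[OF skew_invD(1)[OF Gs(1)]] unfolding H_def by blast
  have Hact: "(r \<cdot> x, tw r \<cdot> y) \<in> H" if "(x, y) \<in> H" for x y r
    using that partial_skewD(3)[OF skew_invD(1)[OF Gs(1)]] unfolding H_def by blast
  have Hscale: "(scale c x, scale c y) \<in> H" if "(x, y) \<in> H" for x y c
    using Hact[OF that, of "[:c:]"] by simp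
  have H0: "(0, 0) \<in> H" using partial_skewD(1)[OF skew_invD(1)[OF Gs(1)]] unfolding H_def by blast
  have "subspace (Domain H)"
  proof (rule subspaceI)
    show "0 \<in> Domain H" using H0 by (rule DomainI)
    show "x + y \<in> Domain H" if xy: "x \<in> Domain H" "y \<in> Domain H" for x y
    proof -
      obtain a b where "(x, a) \<in> H" "(y, b) \<in> H" using xy by blast
      then show ?thesis using Hadd by (intro DomainI)
    qed
    show "scale c x \<in> Domain H" if x: "x \<in> Domain H" for x c
    proof -
      obtain a where "(x, a) \<in> H" using x by blast
      then show ?thesis using Hscale by (intro DomainI)
    qed
  qed
  moreover have "b n \<in> Domain H" for n using Gs(3)[of n] unfolding H_def by blast
  then have "B \<subseteq> Domain H" using Bb by blast
  ultimately have "span B \<subseteq> Domain H" by (rule span_minimal[rotated])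
  then have total: "Domain H = UNIV" using B by blast
  define V where "V n = {x. (x, scale n x) \<in> H}" for n
  have sub: "subspace (V n)" for n
  proof (rule subspaceI)
    show "0 \<in> V n" using H0 by (simp add: V_def)
    show "x + y \<in> V n" if "x \<in> V n" "y \<in> V n" for x y
      using that Hadd by (simp add: V_def scale_right_distrib)
    show "scale c x \<in> V n" if "x \<in> V n" for x c
      using that Hscale[of x "scale n x" c] by (simp add: V_def mult.commute)
  qed
  have uV: "u x \<in> V (- n)" if "x \<in> V n" for x n
    using Hact[of x "scale n x" "[:0, 1:]"] that
    by (simp add: V_def act_X tw_pCons act_pCons u_scale u_minus)
  show ?thesis
    unfolding exchange_property_def
  proof (intro exI conjI)
    show "subspace (V 1)" "subspace (V (- 1))" by (rule sub)+
    show "V 1 \<inter> V (- 1) = {0}"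
    proof
      show "V 1 \<inter> V (- 1) \<subseteq> {0}"
      proof
        fix x assume "x \<in> V 1 \<inter> V (- 1)"
        then have "(x, x) \<in> H" "(x, - x) \<in> H" by (auto simp: V_def)
        then obtain n where "(x, x) \<in> Gs n" "(x, - x) \<in> Gs n" using two by blast
        then have "x = - x" using partial_skew_unique[OF skew_invD(1)[OF Gs(1)]] by blast
        then have "x + x = 0" by (metis add.right_inverse)
        then show "x \<in> {0}" using two_nonzero by (simp add: double_eq_scale)
      qed
      show "{0} \<subseteq> V 1 \<inter> V (- 1)" using sub subspace_0 by blast
    qed
    show "{x + y |x y. x \<in> V 1 \<and> y \<in> V (- 1)} = UNIV"
    proof (intro equalityI subsetI UNIV_I)
      fix x :: 'b
      obtain y where "(x, y) \<in> H" using total by blast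
      then obtain n where n: "(x, y) \<in> Gs n" unfolding H_def by blast
      have "half 1 x y \<in> V 1" "half (- 1) x y \<in> V (- 1)"
        using half_mem[OF Gs(1) n, of 1] half_mem[OF Gs(1) n, of "- 1"] unfolding V_def H_def by auto
      then show "x \<in> {x + y |x y. x \<in> V 1 \<and> y \<in> V (- 1)}"
        using half_sum[of x y, symmetric] by blast
    qed
    show "u ` V 1 \<subseteq> V (- 1)" using uV[of _ 1] by auto
    show "u ` V (- 1) \<subseteq> V 1" using uV[of _ "- 1"] by auto
  qed
qed

end

section \<open>Kaplansky invariants as dimensions of subquotients\<close>

context endo_space
begin

text \<open>\<open>R\<close> is the quotient of \<open>U\<close> by \<open>N\<close> through
  \<open>q\<close>. One notion serves both kinds of invariants: for \<open>kappa\<close> the map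
  forms cosets, for \<open>kappa_inf\<close> it is the identity.\<close>

definition presents :: "('f poly, 'm) module \<Rightarrow> ('v \<Rightarrow> 'm) \<Rightarrow> 'v set \<Rightarrow> 'v set \<Rightarrow> bool" where
  "presents R q U N \<longleftrightarrow> carrier R = q ` U \<and> (\<forall>x\<in>U. \<forall>y\<in>U. q x = q y \<longleftrightarrow> x - y \<in> N) \<and>
     (\<forall>x\<in>U. \<forall>y\<in>U. q x \<oplus>\<^bsub>R\<^esub> q y = q (x + y)) \<and> \<zero>\<^bsub>R\<^esub> = q 0 \<and>
     (\<forall>r. \<forall>x\<in>U. r \<odot>\<^bsub>R\<^esub> q x = q (r \<cdot> x))"

context
  fixes R :: "('f poly, 'm) module" and q U N
  assumes pres: "presents R q U N" and U: "m.subspace U" and N: "m.subspace N"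
begin

lemma pres_carrier: "carrier R = q ` U"
  and pres_eq: "x \<in> U \<Longrightarrow> y \<in> U \<Longrightarrow> q x = q y \<longleftrightarrow> x - y \<in> N"
  and pres_add: "x \<in> U \<Longrightarrow> y \<in> U \<Longrightarrow> q x \<oplus>\<^bsub>R\<^esub> q y = q (x + y)"
  and pres_zero: "\<zero>\<^bsub>R\<^esub> = q 0"
  and pres_smult: "x \<in> U \<Longrightarrow> r \<odot>\<^bsub>R\<^esub> q x = q (r \<cdot> x)"
  using pres unfolding presents_def by auto

lemma pres_abelian_monoid: "abelian_monoid R"
proof (rule abelian_monoidI)
  show "\<zero>\<^bsub>R\<^esub> \<in> carrier R" using m.subspace_0[OF U] by (simp add: pres_carrier pres_zero)
qed (auto simp: pres_carrier pres_add pres_zero ac_simps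
    m.subspace_add[OF U] m.subspace_0[OF U])

lemma pres_finsum:
  assumes "finite I" "\<And>i. i \<in> I \<Longrightarrow> f i = q (g i) \<and> g i \<in> U"
  shows "finsum R f I = q (\<Sum>i\<in>I. g i) \<and> (\<Sum>i\<in>I. g i) \<in> U"
  using assms
proof (induction I)
  case empty
  then show ?case
    using abelian_monoid.finsum_empty[OF pres_abelian_monoid] m.subspace_0[OF U] by (simp add: pres_zero)
next
  case (insert i I)
  have IH: "finsum R f I = q (\<Sum>i\<in>I. g i)" "(\<Sum>i\<in>I. g i) \<in> U" using insert by auto
  have i: "f i = q (g i)" "g i \<in> U" using insert.prems[of i] by auto
  have fc: "f \<in> I \<rightarrow> carrier R" "f i \<in> carrier R"
    using insert.prems by (auto simp: pres_carrier)
  have "finsum R f (insert i I) = f i \<oplus>\<^bsub>R\<^esub> finsum R f I"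
    by (rule abelian_monoid.finsum_insert[OF pres_abelian_monoid insert.hyps fc])
  also have "\<dots> = q (g i + (\<Sum>i\<in>I. g i))" unfolding i(1) IH(1) by (rule pres_add[OF i(2) IH(2)])
  finally show ?case using insert.hyps i IH m.subspace_add[OF U] by simp
qed

lemma pres_finsum_smult:
  assumes "finite S" "\<And>X. X \<in> S \<Longrightarrow> q (g X) = X \<and> g X \<in> U"
  shows "(\<Oplus>\<^bsub>R\<^esub>X\<in>S. r X \<odot>\<^bsub>R\<^esub> X) = q (\<Sum>X\<in>S. r X \<cdot> g X)" "(\<Sum>X\<in>S. r X \<cdot> g X) \<in> U"
proof -
  have "r X \<odot>\<^bsub>R\<^esub> X = q (r X \<cdot> g X) \<and> r X \<cdot> g X \<in> U" if "X \<in> S" for X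
    using pres_smult[of "g X" "r X"] assms(2)[OF that] m.subspace_scale[OF U] by simp
  from pres_finsum[OF assms(1) this]
  show "(\<Oplus>\<^bsub>R\<^esub>X\<in>S. r X \<odot>\<^bsub>R\<^esub> X) = q (\<Sum>X\<in>S. r X \<cdot> g X)" "(\<Sum>X\<in>S. r X \<cdot> g X) \<in> U"
    by auto
qed

lemma pres_eq_zero: "x \<in> U \<Longrightarrow> q x = \<zero>\<^bsub>R\<^esub> \<longleftrightarrow> x \<in> N"
  using pres_eq[of x 0] m.subspace_0[OF U] by (simp add: pres_zero)

lemma residue_basis_image:
  assumes p: "irreducible p" and B: "basis_mod U N p B"
  shows "residue_basis R p (q ` B)"
proof -
  note BD = basis_modD[OF B]
  have inj: "inj_on q B"
  proof (rule inj_onI)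
    fix b c assume bc: "b \<in> B" "c \<in> B" "q b = q c"
    then have "b - c \<in> N" using pres_eq BD(1) by blast
    then show "b = c" by (rule basis_mod_distinct[OF p B bc(1,2)])
  qed
  define h where "h = inv_into B q"
  have h: "q (h X) = X" "h X \<in> B" if "X \<in> q ` B" for X
    using that by (auto simp: h_def f_inv_into_f inv_into_into)
  have hq: "h (q b) = b" if "b \<in> B" for b using inj that by (simp add: h_def)
  have hU: "q (h X) = X \<and> h X \<in> U" if "X \<in> q ` B" for X using h that BD(1) by blast
  show ?thesis
    unfolding residue_basis_def
  proof (intro conjI allI impI ballI)
    show "q ` B \<subseteq> carrier R" using BD(1) by (auto simp: pres_carrier)
  next
    fix S r X
    assume a: "finite S \<and> S \<subseteq> q ` B \<and> (\<Oplus>\<^bsub>R\<^esub>b\<in>S. r b \<odot>\<^bsub>R\<^esub> b) = \<zero>\<^bsub>R\<^esub>" and X: "X \<in> S"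
    then have S: "finite S" "S \<subseteq> q ` B" by auto
    have hS: "q (h X) = X \<and> h X \<in> U" if "X \<in> S" for X using hU S that by blast
    note fs = pres_finsum_smult[where g = h and r = r, OF S(1) hS]
    have "(\<Sum>X\<in>S. r X \<cdot> h X) \<in> N" using a fs pres_eq_zero by metis
    moreover have "inj_on h S" using h(1) S(2) by (metis inj_on_def subsetD)
    then have "(\<Sum>X\<in>S. r X \<cdot> h X) = (\<Sum>b\<in>h ` S. r (q b) \<cdot> b)"
      using S(2) h(1) by (subst sum.reindex) (auto intro!: sum.cong simp: subset_iff)
    ultimately have "p dvd r (q (h X))"
      using BD(2)[of "h ` S" "\<lambda>b. r (q b)" "h X"] S h(2) X by auto
    then show "p dvd r X" using h(1) S(2) X by auto
  next
    fix X assume "X \<in> carrier R"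
    then obtain x where x: "x \<in> U" "X = q x" by (auto simp: pres_carrier)
    obtain S r where S: "finite S" "S \<subseteq> B" "x - (\<Sum>b\<in>S. r b \<cdot> b) \<in> N" using BD(3)[OF x(1)] by blast
    have hS: "q (h X) = X \<and> h X \<in> U" if "X \<in> q ` S" for X using hU S that by blast
    note fs = pres_finsum_smult[where S = "q ` S" and g = h and r = "\<lambda>X. r (h X)",
        OF finite_imageI[OF S(1)] hS]
    have "inj_on q S" using inj S(2) inj_on_subset by blast
    then have e: "(\<Sum>X\<in>q ` S. r (h X) \<cdot> h X) = (\<Sum>b\<in>S. r b \<cdot> b)"
      using S(2) hq by (subst sum.reindex) (auto intro!: sum.cong simp: subset_iff)
    have "X = q (\<Sum>b\<in>S. r b \<cdot> b)" using pres_eq[OF x(1) fs(2)] S(3) x(2) unfolding e by simp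
    then have "X = (\<Oplus>\<^bsub>R\<^esub>b\<in>q ` S. r (h b) \<odot>\<^bsub>R\<^esub> b)" using fs(1) e by simp
    then show "\<exists>S r. finite S \<and> S \<subseteq> q ` B \<and> X = (\<Oplus>\<^bsub>R\<^esub>b\<in>S. r b \<odot>\<^bsub>R\<^esub> b)"
      using S by (intro exI[of _ "q ` S"] exI[of _ "\<lambda>X. r (h X)"]) auto
  qed
qed

lemma residue_basis_lift:
  assumes B: "residue_basis R p \<B>"
  obtains B where "basis_mod U N p B" "|\<B>| =o |B|"
proof -
  have B1: "\<B> \<subseteq> q ` U" using B unfolding residue_basis_def pres_carrier by blast
  have B2: "p dvd r b" if "finite S" "S \<subseteq> \<B>" "(\<Oplus>\<^bsub>R\<^esub>b\<in>S. r b \<odot>\<^bsub>R\<^esub> b) = \<zero>\<^bsub>R\<^esub>" "b \<in> S" for S r b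
    using B that unfolding residue_basis_def by blast
  have B3: "\<exists>S r. finite S \<and> S \<subseteq> \<B> \<and> q x = (\<Oplus>\<^bsub>R\<^esub>b\<in>S. r b \<odot>\<^bsub>R\<^esub> b)" if "x \<in> U" for x
    using B that unfolding residue_basis_def pres_carrier by blast
  define h where "h = inv_into U q"
  have h: "q (h X) = X \<and> h X \<in> U" if "X \<in> \<B>" for X
    using that B1 by (auto simp: h_def f_inv_into_f inv_into_into)
  have inj: "inj_on h \<B>" using h by (metis inj_on_def)
  have "basis_mod U N p (h ` \<B>)"
    unfolding basis_mod_def
  proof (intro conjI allI impI ballI)
    show "h ` \<B> \<subseteq> U" using h by blast
  next
    fix S r b assume S: "finite S" "S \<subseteq> h ` \<B>" "(\<Sum>b\<in>S. r b \<cdot> b) \<in> N" "b \<in> S"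
    obtain T where T: "T \<subseteq> \<B>" "finite T" "S = h ` T" using finite_subset_image[OF S(1,2)] by blast
    have hT: "q (h X) = X \<and> h X \<in> U" if "X \<in> T" for X using h T that by blast
    note fs = pres_finsum_smult[where g = h and r = "\<lambda>X. r (h X)", OF T(2) hT]
    have "inj_on h T" using inj T inj_on_subset by blast
    then have "(\<Sum>b\<in>S. r b \<cdot> b) = (\<Sum>X\<in>T. r (h X) \<cdot> h X)" unfolding T by (subst sum.reindex) auto
    then have "(\<Oplus>\<^bsub>R\<^esub>X\<in>T. r (h X) \<odot>\<^bsub>R\<^esub> X) = \<zero>\<^bsub>R\<^esub>" using fs S(3) pres_eq_zero by simp
    then show "p dvd r b" using B2[OF T(2,1), of "\<lambda>X. r (h X)"] S(4) T(3) by blast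
  next
    fix x assume x: "x \<in> U"
    obtain T r where T: "finite T" "T \<subseteq> \<B>" "q x = (\<Oplus>\<^bsub>R\<^esub>b\<in>T. r b \<odot>\<^bsub>R\<^esub> b)" using B3[OF x] by blast
    have hT: "q (h X) = X \<and> h X \<in> U" if "X \<in> T" for X using h T that by blast
    note fs = pres_finsum_smult[where g = h and r = r, OF T(1) hT]
    have "inj_on h T" using inj T inj_on_subset by blast
    then have "(\<Sum>b\<in>h ` T. r (q b) \<cdot> b) = (\<Sum>X\<in>T. r X \<cdot> h X)"
      using hT by (subst sum.reindex) (auto intro!: sum.cong)
    moreover have "x - (\<Sum>X\<in>T. r X \<cdot> h X) \<in> N" using pres_eq[OF x fs(2)] T(3) fs(1) by simp
    ultimately show "\<exists>S r. finite S \<and> S \<subseteq> h ` \<B> \<and> x - (\<Sum>b\<in>S. r b \<cdot> b) \<in> N"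
      using T by (intro exI[of _ "h ` T"] exI[of _ "\<lambda>b. r (q b)"]) auto
  qed
  moreover have "|\<B>| =o |h ` \<B>|" using inj card_of_ordIsoI inj_on_imp_bij_betw by blast
  ultimately show ?thesis by (rule that)
qed

text \<open>\<open>residue_dim\<close> chooses a basis, so a basis must exist and its cardinality
  must not depend on the choice. Both facts are transported along \<open>q\<close> from the
  representatives in V.\<close>

lemma residue_dim_eq:
  assumes cd: "countable_dim scale" and p: "irreducible p" and pU: "\<And>x. x \<in> U \<Longrightarrow> p \<cdot> x \<in> N"
    and B: "basis_mod U N p B"
  shows "residue_dim R p =o |B|"
proof -
  define \<B> where "\<B> = (SOME B. residue_basis R p B)"
  have "residue_basis R p \<B>"
    unfolding \<B>_def by (rule someI, rule residue_basis_image[OF p B])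
  then obtain B' where B': "basis_mod U N p B'" "|\<B>| =o |B'|" by (rule residue_basis_lift)
  have "|B'| =o |B|" by (rule basis_mod_unique[OF cd p N pU U B'(1) B])
  then show ?thesis unfolding residue_dim_def \<B>_def[symmetric] using B'(2) ordIso_transitive by blast
qed

end

end

section \<open>The kernels that define the invariants\<close>

context countable_endo
begin

text \<open>The preimage in \<open>P p \<alpha>\<close> of the kernel that defines the invariant at
  \<alpha>; the kernel is its quotient by \<open>P p (sc \<alpha>)\<close>.\<close>

definition kernel_level :: "'a poly \<Rightarrow> nat set \<Rightarrow> 'b set" where
  "kernel_level p \<alpha> = {x \<in> P p \<alpha>. p \<cdot> x \<in> P p (sc (sc \<alpha>))}"

lemma kernel_level_subspace: "m.subspace (kernel_level p \<alpha>)"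
  unfolding kernel_level_def
  by (intro m.subspaceI)
    (auto simp: act_add_right act_commute[of p c for c] intro: m.subspace_add[OF P_subspace]
      m.subspace_scale[OF P_subspace])

lemma act_scale_right: "c \<noteq> 0 \<Longrightarrow> scale c x \<in> P p \<alpha> \<longleftrightarrow> x \<in> P p \<alpha>"
proof -
  assume c: "c \<noteq> 0"
  have "scale (inverse c) (scale c x) = x" using c by simp
  then show ?thesis using subspace_scale[OF subspace_pm[OF P_subspace]] by metis
qed

lemma kernel_level_smult: "c \<noteq> 0 \<Longrightarrow> kernel_level (smultp c p) \<alpha> = kernel_level p \<alpha>"
  by (simp add: kernel_level_def P_smult act_smult act_scale_right)

lemma act_kernel_level: "\<alpha> \<in> Field omega1 \<Longrightarrow> x \<in> kernel_level p \<alpha> \<Longrightarrow> p \<cdot> x \<in> P p (sc \<alpha>)"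
  by (auto simp: kernel_level_def P_suc)

text \<open>The operations on cosets are unions over representatives. Each union collapses to a
  single coset because the maps respect the submodules, and the kernel condition becomes membership
  of p x in stage \<alpha> + 2.\<close>

lemma presents_kernel_module:
  assumes \<alpha>: "\<alpha> \<in> Field omega1"
  shows "presents (kernel_module omega1 (end_module scale u) p \<alpha>) (\<lambda>x. (\<lambda>h. h + x) ` P p (sc \<alpha>))
    (kernel_level p \<alpha>) (P p (sc \<alpha>))"
proof -
  let ?M = "end_module scale u"
  define W0 W1 W2 where W: "W0 = P p \<alpha>" "W1 = P p (sc \<alpha>)" "W2 = P p (sc (sc \<alpha>))"
  define cs :: "'b set \<Rightarrow> 'b \<Rightarrow> 'b set" where "cs N x = (\<lambda>h. h + x) ` N" for N x
  have coset: "N +>\<^bsub>submodule_of ?M W\<^esub> x = cs N x" "N +>\<^bsub>?M\<^esub> x = cs N x" for N W x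
    by (auto simp: a_r_coset_def r_coset_def submodule_of_def cs_def)
  have sW: "m.subspace W0" "m.subspace W1" "m.subspace W2" by (simp_all add: W P_subspace)
  have cs_eq: "cs N x = cs N y \<longleftrightarrow> x - y \<in> N" if N: "m.subspace N" for N x y
  proof
    assume e: "cs N x = cs N y"
    have "0 + x \<in> cs N x" unfolding cs_def using m.subspace_0[OF N] by blast
    then have "0 + x \<in> (\<lambda>h. h + y) ` N" unfolding e unfolding cs_def .
    then obtain h where h: "0 + x = h + y" "h \<in> N" by (rule imageE)
    then have "x - y = h" by simp
    then show "x - y \<in> N" using h(2) by simp
  next
    have "cs N x \<subseteq> cs N y" if d: "x - y \<in> N" for x y
    proof
      fix z assume "z \<in> cs N x"
      then obtain h where h: "h \<in> N" "z = h + x" unfolding cs_def by blast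
      then have "z = (h + (x - y)) + y" by simp
      then show "z \<in> cs N y" unfolding cs_def using m.subspace_add[OF N h(1) d] by blast
    qed
    moreover assume d: "x - y \<in> N"
    moreover have "y - x \<in> N" using m.subspace_neg[OF N d] by simp
    ultimately show "cs N x = cs N y" by blast
  qed
  have cs0: "cs N 0 = N" for N by (simp add: cs_def)
  have csself: "x \<in> cs N x" if "m.subspace N" for N x
    unfolding cs_def using m.subspace_0[OF that] by force
  have csmem: "y - x \<in> N" if "y \<in> cs N x" for N x y using that unfolding cs_def by auto
  have map_cs: "(\<Union>y\<in>cs N x. cs N' (r \<cdot> y)) = cs N' (r \<cdot> x)"
    if N: "m.subspace N" "m.subspace N'" and r: "\<And>h. h \<in> N \<Longrightarrow> r \<cdot> h \<in> N'" for N N' r x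
  proof -
    have "cs N' (r \<cdot> y) = cs N' (r \<cdot> x)" if "y \<in> cs N x" for y
      using r[OF csmem[OF that]] by (simp add: cs_eq[OF N(2)] m.scale_right_diff_distrib)
    then show ?thesis using csself[OF N(1), of x] by blast
  qed
  have addcs: "(\<Union>h\<in>cs N x. \<Union>k\<in>cs N y. {h + k}) = cs N (x + y)" if N: "m.subspace N" for N x y
  proof (intro equalityI subsetI)
    fix z assume "z \<in> (\<Union>h\<in>cs N x. \<Union>k\<in>cs N y. {h + k})"
    then obtain h k where "h \<in> N" "k \<in> N" "z = (h + k) + (x + y)"
      unfolding cs_def by (auto simp: algebra_simps)
    then show "z \<in> cs N (x + y)" unfolding cs_def using m.subspace_add[OF N] by blast
  next
    fix z assume "z \<in> cs N (x + y)"
    then obtain h where h: "h \<in> N" "z = (h + x) + (0 + y)" unfolding cs_def by (auto simp: algebra_simps)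
    then show "z \<in> (\<Union>h\<in>cs N x. \<Union>k\<in>cs N y. {h + k})"
      unfolding cs_def using m.subspace_0[OF N] by blast
  qed
  have W12: "p \<cdot> h \<in> W2" if "h \<in> W1" for h using that \<alpha> by (simp add: W P_suc)
  let ?K = "kernel_module omega1 ?M p \<alpha>"
  let ?Q0 = "quotient_module (submodule_of ?M W0) W1"
  let ?Q1 = "quotient_module (submodule_of ?M W1) W2"
  have K: "?K = submodule_of ?Q0 (a_kernel ?Q0 ?Q1 (\<lambda>X. \<Union>x\<in>X. W2 +>\<^bsub>?M\<^esub> (p \<odot>\<^bsub>?M\<^esub> x)))"
    unfolding kernel_module_def Let_def W P_def ..
  have cQ: "carrier ?Q0 = cs W1 ` W0"
    by (auto simp: quotient_module_def A_RCOSETS_def' coset) (auto simp: submodule_of_def)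
  have zQ: "\<zero>\<^bsub>?Q1\<^esub> = W2" by (simp add: quotient_module_def)
  have csub: "carrier (submodule_of R A) = A" for R :: "('a poly, 'b set) module" and A
    by (simp add: submodule_of_def)
  have "carrier ?K = {X \<in> cs W1 ` W0. (\<Union>x\<in>X. cs W2 (p \<cdot> x)) = W2}"
    unfolding K csub a_kernel_def kernel_def by (simp add: cQ coset zQ)
  also have "\<dots> = cs W1 ` kernel_level p \<alpha>"
  proof -
    have "(\<Union>y\<in>cs W1 x. cs W2 (p \<cdot> y)) = W2 \<longleftrightarrow> p \<cdot> x \<in> W2" for x
    proof -
      have "(\<Union>y\<in>cs W1 x. cs W2 (p \<cdot> y)) = cs W2 (p \<cdot> x)" by (rule map_cs[OF sW(2,3)]) (rule W12)
      then show ?thesis using cs_eq[OF sW(3), of "p \<cdot> x" 0] by (simp add: cs0)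
    qed
    then show ?thesis unfolding kernel_level_def W[symmetric] by blast
  qed
  finally have car: "carrier ?K = cs W1 ` kernel_level p \<alpha>" .
  have add: "cs W1 x \<oplus>\<^bsub>?K\<^esub> cs W1 y = cs W1 (x + y)" for x y
    unfolding K addcs[OF sW(2), symmetric]
    by (simp add: submodule_of_def quotient_module_def set_add_def set_mult_def)
  have zero: "\<zero>\<^bsub>?K\<^esub> = cs W1 0"
    unfolding K by (simp add: submodule_of_def quotient_module_def cs0)
  have sm: "r \<odot>\<^bsub>?K\<^esub> cs W1 x = cs W1 (r \<cdot> x)" for r x
  proof -
    have "r \<odot>\<^bsub>?K\<^esub> cs W1 x = (\<Union>y\<in>cs W1 x. W1 +>\<^bsub>submodule_of ?M W0\<^esub> (r \<cdot> y))"
      unfolding K by (simp add: submodule_of_def quotient_module_def)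
    also have "\<dots> = cs W1 (r \<cdot> x)"
      unfolding coset using m.subspace_scale[OF sW(2)] by (intro map_cs[OF sW(2,2)])
    finally show ?thesis .
  qed
  show ?thesis
    unfolding presents_def using car add zero sm cs_eq[OF sW(2)]
    unfolding cs_def W by simp
qed

lemma kappa_eq:
  assumes \<alpha>: "\<alpha> \<in> Field omega1" and p: "irreducible p"
    and B: "basis_mod (kernel_level p \<alpha>) (P p (sc \<alpha>)) p B"
  shows "kappa scale \<alpha> u p =o |B|"
  unfolding kappa_def
  by (rule residue_dim_eq[OF presents_kernel_module[OF \<alpha>] kernel_level_subspace P_subspace
        countable_dim p act_kernel_level[OF \<alpha>] B])

definition kernel_inf :: "'a poly \<Rightarrow> 'b set" where
  "kernel_inf p = {x \<in> D p. p \<cdot> x = 0}"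

lemma kernel_inf_subspace: "m.subspace (kernel_inf p)"
  unfolding kernel_inf_def
  by (intro m.subspaceI)
    (auto simp: act_add_right act_commute[of p c for c] intro: m.subspace_0[OF D_subspace]
      m.subspace_add[OF D_subspace] m.subspace_scale[OF D_subspace])

lemma kernel_inf_smult: "c \<noteq> 0 \<Longrightarrow> kernel_inf (smultp c p) = kernel_inf p"
  by (simp add: kernel_inf_def D_smult act_smult)

lemma kappa_inf_eq:
  assumes p: "irreducible p" and B: "basis_mod (kernel_inf p) {0} p B"
  shows "kappa_inf scale u p =o |B|"
proof -
  have "presents (submodule_of (end_module scale u)
      {x \<in> p_power_inf (end_module scale u) p. p \<odot>\<^bsub>end_module scale u\<^esub> x = \<zero>\<^bsub>end_module scale u\<^esub>})
      (\<lambda>x. x) (kernel_inf p) {0}"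
    unfolding presents_def p_power_inf_eq kernel_inf_def submodule_of_def by simp
  from residue_dim_eq[OF this kernel_inf_subspace m.subspace_single_0 countable_dim p _ B]
  show ?thesis unfolding kappa_inf_def Let_def by (simp add: kernel_inf_def)
qed

end

section \<open>Equality of the invariants and matching of levels\<close>

context countable_endo
begin

lemma partial_skew_sum:
  assumes G: "partial_skew G" and J: "\<And>j. j \<in> J \<Longrightarrow> (a j, b j) \<in> G"
  shows "((\<Sum>j\<in>J. scale (c j) (a j)), (\<Sum>j\<in>J. scale (c j) (b j))) \<in> G"
  using J
proof (induction J rule: infinite_finite_induct)
  case (insert j J)
  then show ?case
    using partial_skewD(2)[OF G partial_skew_scale[OF G insert.prems[of j], of "c j"]] by simp
qed (simp_all add: partial_skewD(1)[OF G])

text \<open>\<open>G\<close> induces an isomorphism between the images of its domain in U/N and of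
  its range in U'/N'. If the range covered U'/N', that space would have finite dimension, which by
  \<open>BB\<close> and equal degrees is also the dimension of U/N. So the domain would cover U/N,
  against the choice of \<open>k\<close>.\<close>

lemma transfer_residue_basis:
  assumes G: "partial_skew G" and fR: "fin_span (Range G)"
    and p: "irreducible p" "irreducible p'" "degree p' = degree p"
    and U: "m.subspace U" "m.subspace U'" and N: "m.subspace N" "m.subspace N'" "N' \<subseteq> U'"
    and pU: "\<And>x. x \<in> U \<Longrightarrow> p \<cdot> x \<in> N" "\<And>x. x \<in> U' \<Longrightarrow> p' \<cdot> x \<in> N'"
    and iffU: "\<And>a b. (a, b) \<in> G \<Longrightarrow> a \<in> U \<longleftrightarrow> b \<in> U'"
    and iffN: "\<And>a b. (a, b) \<in> G \<Longrightarrow> a \<in> N \<longleftrightarrow> b \<in> N'"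
    and B: "basis_mod U N p B" and B': "basis_mod U' N' p' B'" and BB: "|B| =o |B'|"
    and k: "k \<in> U" "\<And>s. s \<in> Domain G \<Longrightarrow> k + s \<notin> N"
  shows "\<exists>k'\<in>U'. \<forall>s\<in>Range G. k' + s \<notin> N'"
proof (rule ccontr)
  assume "\<not> ?thesis"
  then have cover: "\<And>k'. k' \<in> U' \<Longrightarrow> \<exists>s\<in>Range G. k' + s \<in> N'" by blast
  obtain g where g: "endo scale g" "\<forall>x. g x = 0 \<longleftrightarrow> x \<in> N"
    by (rule linear_with_kernel[OF subspace_pm[OF N(1)]])
  obtain g' where g': "endo scale g'" "\<forall>x. g' x = 0 \<longleftrightarrow> x \<in> N'"
    by (rule linear_with_kernel[OF subspace_pm[OF N(2)]])
  interpret g: Vector_Spaces.linear scale scale g by (rule g(1))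
  interpret g': Vector_Spaces.linear scale scale g' by (rule g'(1))
  define d where "d = degree p"
  have d: "0 < d" unfolding d_def by (rule irreducible_degree_pos[OF p(1)])
  define f where "f = (\<lambda>(b, i). g ((u ^^ i) b))"
  define f' where "f' = (\<lambda>(b, i). g' ((u ^^ i) b))"
  define E where "E = f ` (B \<times> {..<d})"
  define E' where "E' = f' ` (B' \<times> {..<d})"
  note F = basis_mod_family[OF p(1) N(1) pU(1) B U(1) g, folded f_def d_def, folded E_def]
  note F' = basis_mod_family[OF p(2) N(2) pU(2) B' U(2) g', unfolded p(3), folded f'_def d_def, folded E'_def]
  note SR = partial_skew_Range[OF G] and SD = partial_skew_Domain[OF G]
  \<comment> \<open>By \<open>cover\<close>, every basis vector of the copy of U'/N' comes from the
    range of \<open>G\<close>, and the partner lies in \<open>U\<close>.\<close>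
  have ex: "\<exists>a b. (a, b) \<in> G \<and> a \<in> U \<and> g' b = e" if e: "e \<in> E'" for e
  proof -
    obtain k' where k': "k' \<in> U'" "e = g' k'" using F'(3) e by blast
    obtain s where s: "s \<in> Range G" "k' + s \<in> N'" using cover[OF k'(1)] by blast
    have "- s \<in> Range G" by (rule m.subspace_neg[OF SR s(1)])
    then obtain a where a: "(a, - s) \<in> G" by blast
    have "k' - (k' + s) \<in> U'" using k'(1) s(2) N(3) by (intro m.subspace_diff[OF U(2)]) auto
    then have "a \<in> U" using iffU[OF a] by simp
    moreover have "g' (k' + s) = 0" using g'(2) s(2) by blast
    then have "g' (- s) = e" using k'(2) by (simp add: g'.add g'.neg add_eq_0_iff)
    ultimately show ?thesis using a by blast
  qed
  then obtain a b where ab: "\<And>e. e \<in> E' \<Longrightarrow> (a e, b e) \<in> G \<and> a e \<in> U \<and> g' (b e) = e" by metis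
  have finE': "finite E'"
  proof -
    obtain Fs where Fs: "finite Fs" "Range G \<subseteq> span Fs" using fR unfolding fin_span_def by blast
    have "E' \<subseteq> g' ` span Fs"
    proof
      fix e assume "e \<in> E'"
      then have "(a e, b e) \<in> G" "g' (b e) = e" using ab by blast+
      moreover from this have "b e \<in> span Fs" using Fs(2) by blast
      ultimately show "e \<in> g' ` span Fs" by force
    qed
    also have "\<dots> = span (g' ` Fs)" by (rule g'.span_image[symmetric])
    finally have "E' \<subseteq> span (g' ` Fs)" .
    from independent_span_bound[OF finite_imageI[OF Fs(1)] F'(2) this] show ?thesis ..
  qed
  have finB': "finite B'"
  proof -
    have "finite (B' \<times> {..<d})" using finE' F'(1) unfolding E'_def by (simp add: finite_image_iff)
    then show ?thesis using finite_times_index[OF d] by blast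
  qed
  obtain h where "bij_betw h B B'" using BB card_of_ordIso by blast
  then have finB: "finite B" "card B = card B'" using finB' by (simp_all add: bij_betw_finite bij_betw_same_card)
  then have finE: "finite E" and cardE: "card E = card E'"
    using F(1) F'(1) unfolding E_def E'_def by (simp_all add: card_image card_cartesian_product)
  \<comment> \<open>The partners form a family in the copy of U/N that is independent, because
    \<open>G\<close> matches \<open>N\<close> with \<open>N'\<close>, and has the size of a basis;
    hence it spans.\<close>
  define f2 where "f2 e = g (a e)" for e
  have key: "\<forall>e\<in>J. c e = 0"
    if J: "finite J" "J \<subseteq> E'" and z: "(\<Sum>e\<in>J. scale (c e) (f2 e)) = 0" for J c
  proof -
    have "g (\<Sum>e\<in>J. scale (c e) (a e)) = 0" using z by (simp add: f2_def g.sum g.scale)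
    then have "(\<Sum>e\<in>J. scale (c e) (a e)) \<in> N" using g(2) by blast
    moreover have "((\<Sum>e\<in>J. scale (c e) (a e)), (\<Sum>e\<in>J. scale (c e) (b e))) \<in> G"
      by (rule partial_skew_sum[OF G]) (use ab J in blast)
    ultimately have "(\<Sum>e\<in>J. scale (c e) (b e)) \<in> N'" using iffN by blast
    then have "g' (\<Sum>e\<in>J. scale (c e) (b e)) = 0" using g'(2) by blast
    moreover have "g' (\<Sum>e\<in>J. scale (c e) (b e)) = (\<Sum>e\<in>J. scale (c e) e)"
      unfolding g'.sum g'.scale using ab J(2) by (intro sum.cong) auto
    ultimately have "(\<Sum>e\<in>J. scale (c e) e) = 0" by simp
    then show ?thesis using independentD[OF F'(2) J] by blast
  qed
  note F2 = independent_family[OF key]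
  have card2: "card (f2 ` E') = card E" using F2(1) cardE by (simp add: card_image)
  have sub2: "f2 ` E' \<subseteq> span E" using ab F(4) by (auto simp: f2_def)
  have "g k \<in> span (f2 ` E')"
  proof (rule ccontr)
    assume n: "g k \<notin> span (f2 ` E')"
    then have i: "independent (insert (g k) (f2 ` E'))" using F2(2) by (rule independent_insertI)
    have "insert (g k) (f2 ` E') \<subseteq> span E" using sub2 F(4) k(1) by blast
    from independent_span_bound[OF finE i this]
    have "card (insert (g k) (f2 ` E')) \<le> card E" by simp
    moreover have "g k \<notin> f2 ` E'" using n span_base by blast
    ultimately show False using card2 finE' by simp
  qed
  also have "span (f2 ` E') = g ` span (a ` E')" by (simp add: f2_def image_image flip: g.span_image)
  finally obtain s where s: "s \<in> span (a ` E')" "g k = g s" by blast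
  have "a ` E' \<subseteq> Domain G" using ab by blast
  then have "span (a ` E') \<subseteq> Domain G" using subspace_pm[OF SD] by (rule span_minimal)
  then have "- s \<in> Domain G" using s(1) m.subspace_neg[OF SD] by blast
  moreover have "g (k - s) = 0" using s(2) by (simp add: g.diff)
  then have "k + - s \<in> N" using g(2) by simp
  ultimately show False using k(2) by blast
qed

section \<open>Skew maps and the invariants\<close>

lemma basis_mod_skew:
  assumes w: "\<And>x y. w (x + y) = w x + w y" "\<And>s x. w (s \<cdot> x) = tw s \<cdot> w x"
    and U: "m.subspace U" and N: "m.subspace N'" and p: "irreducible p"
    and wU: "\<And>x. x \<in> U \<Longrightarrow> w x \<in> U'" and wN: "\<And>x. x \<in> U \<Longrightarrow> w x \<in> N' \<longleftrightarrow> x \<in> N"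
    and surj: "\<And>y. y \<in> U' \<Longrightarrow> \<exists>x\<in>U. y - w x \<in> N'"
    and B: "basis_mod U N p B"
  shows "basis_mod U' N' (tw p) (w ` B)" "|w ` B| =o |B|"
proof -
  note BD = basis_modD[OF B]
  have w0: "w 0 = 0" using w(2)[of 0 0] by simp
  have wm: "w (x - y) = w x - w y" for x y using w(1)[of "x - y" y] by (simp add: algebra_simps)
  have ws: "w (\<Sum>t\<in>T. r t \<cdot> t) = (\<Sum>t\<in>T. tw (r t) \<cdot> w t)" for T r
    by (induction T rule: infinite_finite_induct) (simp_all add: w0 w)
  have TU: "(\<Sum>t\<in>T. r t \<cdot> t) \<in> U" if "T \<subseteq> B" for T r
    using that BD(1) by (intro m.subspace_sum[OF U] m.subspace_scale[OF U]) auto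
  have inj: "inj_on w B"
  proof (rule inj_onI)
    fix b c assume bc: "b \<in> B" "c \<in> B" "w b = w c"
    have "w (b - c) \<in> N'" using bc m.subspace_0[OF N] by (simp add: wm)
    then have "b - c \<in> N" using wN m.subspace_diff[OF U] BD(1) bc by blast
    then show "b = c" by (rule basis_mod_distinct[OF p B bc(1,2)])
  qed
  show "|w ` B| =o |B|"
    using inj card_of_ordIsoI inj_on_imp_bij_betw ordIso_symmetric by blast
  show "basis_mod U' N' (tw p) (w ` B)"
    unfolding basis_mod_def
  proof (intro conjI allI impI ballI)
    show "w ` B \<subseteq> U'" using wU BD(1) by blast
  next
    fix S r b assume S: "finite S" "S \<subseteq> w ` B" "(\<Sum>b\<in>S. r b \<cdot> b) \<in> N'" "b \<in> S"
    obtain T where T: "T \<subseteq> B" "finite T" "S = w ` T" using finite_subset_image[OF S(1,2)] by blast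
    have "inj_on w T" using inj T inj_on_subset by blast
    then have "(\<Sum>b\<in>S. r b \<cdot> b) = (\<Sum>t\<in>T. r (w t) \<cdot> w t)" unfolding T by (simp add: sum.reindex)
    also have "\<dots> = w (\<Sum>t\<in>T. tw (r (w t)) \<cdot> t)" by (simp add: ws)
    finally have "(\<Sum>t\<in>T. tw (r (w t)) \<cdot> t) \<in> N" using wN[OF TU[OF T(1)]] S(3) by metis
    moreover obtain t where t: "t \<in> T" "b = w t" using S(4) T(3) by blast
    ultimately have "p dvd tw (r (w t))" using BD(2)[OF T(2,1), of "\<lambda>t. tw (r (w t))" t] by blast
    then show "tw p dvd r b" using t(2) by (simp add: tw_dvd_iff)
  next
    fix y assume "y \<in> U'"
    then obtain x where x: "x \<in> U" "y - w x \<in> N'" using surj by blast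
    obtain T r where T: "finite T" "T \<subseteq> B" "x - (\<Sum>t\<in>T. r t \<cdot> t) \<in> N" using BD(3)[OF x(1)] by blast
    have "w (x - (\<Sum>t\<in>T. r t \<cdot> t)) \<in> N'" using wN[OF m.subspace_diff[OF U x(1) TU[OF T(2)]]] T(3) by blast
    then have "(y - w x) + w (x - (\<Sum>t\<in>T. r t \<cdot> t)) \<in> N'" by (rule m.subspace_add[OF N x(2)])
    then have m: "y - (\<Sum>t\<in>T. tw (r t) \<cdot> w t) \<in> N'" by (simp add: wm ws)
    have injT: "inj_on w T" using inj T inj_on_subset by blast
    then have "(\<Sum>b\<in>w ` T. tw (r (inv_into T w b)) \<cdot> b) = (\<Sum>t\<in>T. tw (r t) \<cdot> w t)"
      by (simp add: sum.reindex)
    then show "\<exists>S r. finite S \<and> S \<subseteq> w ` B \<and> y - (\<Sum>b\<in>S. r b \<cdot> b) \<in> N'"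
      using m T by (intro exI[of _ "w ` T"] exI[of _ "\<lambda>b. tw (r (inv_into T w b))"]) auto
  qed
qed

text \<open>\<open>w\<close> and \<open>w'\<close> are inverse to each other up to multiplication by
  \<open>g\<close>, which is invertible modulo \<open>p\<close>. Hence \<open>w\<close> induces
  bijections between the subquotients at \<open>p\<close> and those at \<open>tw p\<close>. A
  similarity has g = 1, and a sum of two square-zero maps has g = -t^2.\<close>

lemma kappa_skew:
  assumes w: "\<And>x y. w (x + y) = w x + w y" "\<And>s x. w (s \<cdot> x) = tw s \<cdot> w x"
    and w': "\<And>s x. w' (s \<cdot> x) = tw s \<cdot> w' x"
    and ww: "\<And>x. w' (w x) = g \<cdot> x" "\<And>x. w (w' x) = g \<cdot> x" and g: "tw g = g"
    and p: "irreducible p" "\<not> p dvd g"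
  shows "\<alpha> \<in> Field omega1 \<Longrightarrow> kappa scale \<alpha> u (H_poly (- 1) p) =o kappa scale \<alpha> u p"
    and "kappa_inf scale u (H_poly (- 1) p) =o kappa_inf scale u p"
proof -
  define p1 where "p1 = H_poly (- 1) p"
  define c where "c = (- 1 :: 'a) ^ degree p"
  have c: "c \<noteq> 0" "p1 = smultp c (tw p)" by (simp_all add: c_def p1_def H_poly_tw)
  have tp: "irreducible (tw p)" by (rule irreducible_tw[OF p(1)])
  have p1: "irreducible p1" unfolding c(2) by (rule irreducible_smult[OF c(1) tp])
  have "\<not> tw p dvd g" using p(2) g by (simp add: tw_dvd_iff)
  then obtain A Q where AQ: "A * g + Q * tw p = 1" by (rule irreducible_bezout[OF tp])
  obtain A' Q' where AQ': "A' * g + Q' * p = 1" by (rule irreducible_bezout[OF p])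
  have basis: "basis_mod U' N' p1 (w ` B) \<and> |w ` B| =o |B|"
    if U: "m.subspace U" "m.subspace U'" and N: "m.subspace N" "m.subspace N'"
      and pU: "\<And>x. x \<in> U \<Longrightarrow> p \<cdot> x \<in> N" "\<And>x. x \<in> U' \<Longrightarrow> tw p \<cdot> x \<in> N'"
      and wU: "\<And>x. x \<in> U \<Longrightarrow> w x \<in> U'" "\<And>x. x \<in> U' \<Longrightarrow> w' x \<in> U"
      and wN: "\<And>x. x \<in> N \<Longrightarrow> w x \<in> N'" "\<And>x. x \<in> N' \<Longrightarrow> w' x \<in> N"
      and B: "basis_mod U N p B" for U U' N N' B
  proof -
    have iff: "w x \<in> N' \<longleftrightarrow> x \<in> N" if x: "x \<in> U" for x
    proof
      assume "w x \<in> N'"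
      then have "g \<cdot> x \<in> N" using wN(2) ww(1) by metis
      then have "A' \<cdot> g \<cdot> x + Q' \<cdot> p \<cdot> x \<in> N" using pU(1)[OF x]
        by (intro m.subspace_add[OF N(1)] m.subspace_scale[OF N(1), of _ A'] m.subspace_scale[OF N(1), of _ Q'])
      then show "x \<in> N" unfolding bezout_act[OF AQ'] .
    qed (rule wN(1))
    have surj: "\<exists>x\<in>U. y - w x \<in> N'" if y: "y \<in> U'" for y
    proof
      \<comment> \<open>The witness is w' y divided by \<open>g\<close> modulo the prime;
        \<open>tw A\<close> becomes \<open>A\<close> when it is moved through
        \<open>w\<close>.\<close>
      show "tw A \<cdot> w' y \<in> U" using wU(2)[OF y] by (rule m.subspace_scale[OF U(1)])
      have "y - w (tw A \<cdot> w' y) = Q \<cdot> tw p \<cdot> y"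
        using bezout_act[OF AQ, of y] by (simp add: w(2) ww(2) algebra_simps)
      then show "y - w (tw A \<cdot> w' y) \<in> N'" using m.subspace_scale[OF N(2) pU(2)[OF y]] by simp
    qed
    show ?thesis
      using basis_mod_skew[OF w U(1) N(2) p(1) wU(1) iff surj B] c(1)
      by (simp add: c(2) basis_mod_smult)
  qed
  have wP: "w x \<in> P (tw p) \<alpha>" if "x \<in> P p \<alpha>" for x \<alpha> by (rule P_skew[of w, OF w(2) that])
  have w'P: "w' x \<in> P p \<alpha>" if "x \<in> P (tw p) \<alpha>" for x \<alpha> using P_skew[of w', OF w' that] by simp
  show "kappa scale \<alpha> u (H_poly (- 1) p) =o kappa scale \<alpha> u p" if \<alpha>: "\<alpha> \<in> Field omega1"
  proof -
    have kl: "kernel_level p1 \<alpha> = kernel_level (tw p) \<alpha>" "P p1 (sc \<alpha>) = P (tw p) (sc \<alpha>)"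
      using c by (simp_all add: kernel_level_smult P_smult)
    obtain B where B: "basis_mod (kernel_level p \<alpha>) (P p (sc \<alpha>)) p B"
      by (rule ex_basis_mod[OF p(1) kernel_level_subspace P_subspace act_kernel_level[OF \<alpha>]])
    have "basis_mod (kernel_level (tw p) \<alpha>) (P (tw p) (sc \<alpha>)) p1 (w ` B) \<and> |w ` B| =o |B|"
    proof (rule basis[OF kernel_level_subspace kernel_level_subspace P_subspace P_subspace _ _ _ _ _ _ B])
      show "w x \<in> kernel_level (tw p) \<alpha>" if "x \<in> kernel_level p \<alpha>" for x
        using that wP[of x \<alpha>] wP[of "p \<cdot> x"] by (simp add: kernel_level_def w(2))
      show "w' x \<in> kernel_level p \<alpha>" if "x \<in> kernel_level (tw p) \<alpha>" for x
        using that w'P[of x \<alpha>] w'P[of "tw p \<cdot> x"] by (simp add: kernel_level_def w')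
    qed (use act_kernel_level[OF \<alpha>] wP w'P in auto)
    then have k: "kappa scale \<alpha> u p1 =o |w ` B|" "|w ` B| =o |B|"
      using kappa_eq[OF \<alpha> p1, of "w ` B"] by (simp_all add: kl)
    show ?thesis
      by (fold p1_def, rule ordIso_transitive[OF ordIso_transitive[OF k]
            ordIso_symmetric[OF kappa_eq[OF \<alpha> p(1) B]]])
  qed
  show "kappa_inf scale u (H_poly (- 1) p) =o kappa_inf scale u p"
  proof -
    have kl: "kernel_inf p1 = kernel_inf (tw p)" using c by (simp add: kernel_inf_smult)
    have z: "p \<cdot> x \<in> {0}" if "x \<in> kernel_inf p" for x p using that by (simp add: kernel_inf_def)
    obtain B where B: "basis_mod (kernel_inf p) {0} p B"
      by (rule ex_basis_mod[OF p(1) kernel_inf_subspace m.subspace_single_0 z])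
    have w0: "w 0 = 0" "w' 0 = 0" using w(2)[of 0 0] w'[of 0 0] by simp_all
    have wD: "w x \<in> D (tw p)" if "x \<in> D p" for x using that wP by (auto simp: D_def)
    have w'D: "w' x \<in> D p" if "x \<in> D (tw p)" for x using that w'P by (auto simp: D_def)
    have "basis_mod (kernel_inf (tw p)) {0} p1 (w ` B) \<and> |w ` B| =o |B|"
    proof (rule basis[OF kernel_inf_subspace kernel_inf_subspace m.subspace_single_0 m.subspace_single_0 _ _ _ _ _ _ B])
      show "w x \<in> kernel_inf (tw p)" if "x \<in> kernel_inf p" for x
        using that wD[of x] w(2)[of p x, symmetric] by (simp add: kernel_inf_def w0)
      show "w' x \<in> kernel_inf p" if "x \<in> kernel_inf (tw p)" for x
        using that w'D[of x] w'[of "tw p" x, symmetric] by (simp add: kernel_inf_def w0)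
    qed (use z w0 in auto)
    then have k: "kappa_inf scale u p1 =o |w ` B|" "|w ` B| =o |B|"
      using kappa_inf_eq[OF p1, of "w ` B"] by (simp_all add: kl)
    show ?thesis
      by (fold p1_def, rule ordIso_transitive[OF ordIso_transitive[OF k]
            ordIso_symmetric[OF kappa_inf_eq[OF p(1) B]]])
  qed
qed

lemma skew_act:
  assumes "\<And>x y. w (x + y) = w x + w y" "\<And>c x. w (scale c x) = scale c (w x)" "\<And>x. w (u x) = - u (w x)"
  shows "w (s \<cdot> x) = tw s \<cdot> w x"
proof -
  have w0: "w 0 = 0" using assms(2)[of 0 0] by simp
  show ?thesis
    by (induction s) (simp_all add: w0 u_minus assms act_pCons tw_pCons m.scale_left_diff_distrib)
qed

end

section \<open>From equal invariants to the transfer condition\<close>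

context countable_endo_odd
begin

text \<open>The hypotheses concern monic primes, so \<open>p\<close> is normalised to
  \<open>p0\<close>, and \<open>p1\<close> is then associated to \<open>tw p\<close>. Heights and
  kernels do not see the constants, and the comparison of dimensions is applied once at each ordinal
  and once at infinity.\<close>

lemma transfer_if_kappa_eq:
  assumes kap: "\<And>p \<alpha>. p \<in> Irr \<Longrightarrow> \<alpha> \<in> Field omega1 \<Longrightarrow> kappa scale \<alpha> u (H_poly (- 1) p) =o kappa scale \<alpha> u p"
    and kapi: "\<And>p. p \<in> Irr \<Longrightarrow> kappa_inf scale u (H_poly (- 1) p) =o kappa_inf scale u p"
    and G: "skew_inv G" and p: "irreducible p"
  shows "transfer G p"
proof -
  note GP = skew_invD(1)[OF G]
  note RD = skew_inv_Range[OF G]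
  have fR: "fin_span (Range G)" unfolding RD by (rule partial_skewD(7)[OF GP])
  define l where "l = inverse (lead_coeff p)"
  have l: "l \<noteq> 0" using p by (auto simp: l_def irreducible_def)
  define p0 where "p0 = smultp l p"
  have ip0: "irreducible p0" unfolding p0_def by (rule irreducible_smult[OF l p])
  have p0: "p0 \<in> Irr" using ip0 l p by (auto simp: Irr_def p0_def l_def irreducible_def)
  define p1 where "p1 = H_poly (- 1) p0"
  define c where "c = (- 1) ^ degree p0 * l"
  have c: "c \<noteq> 0" "p1 = smultp c (tw p)"
    using l by (simp_all add: c_def p1_def H_poly_tw p0_def tw_smult)
  have ip1: "irreducible p1" unfolding c(2) by (rule irreducible_smult[OF c(1) irreducible_tw[OF p]])
  have deg: "degree p1 = degree p0" using c l by (simp add: p0_def)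
  have eq: "kernel_level p0 \<alpha> = kernel_level p \<alpha>" "kernel_level p1 \<alpha> = kernel_level (tw p) \<alpha>"
    "P p0 \<alpha> = P p \<alpha>" "P p1 \<alpha> = P (tw p) \<alpha>" "kernel_inf p0 = kernel_inf p" "kernel_inf p1 = kernel_inf (tw p)" for \<alpha>
    using l c by (simp_all add: p0_def kernel_level_smult P_smult kernel_inf_smult)
  have ht: "a \<in> P p \<alpha> \<longleftrightarrow> b \<in> P (tw p) \<alpha>" if "\<alpha> \<in> Field omega1" "(a, b) \<in> G" for a b \<alpha>
    by (rule partial_skewD(6)[OF GP p that])
  have pG: "(p \<cdot> a, tw p \<cdot> b) \<in> G" if "(a, b) \<in> G" for a b by (rule partial_skewD(3)[OF GP that])
  have zero: "a = 0 \<longleftrightarrow> b = 0" if "(a, b) \<in> G" for a b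
    using partial_skewD(4,5)[OF GP] that by blast
  have "\<exists>k\<in>P (tw p) \<alpha>. tw p \<cdot> k \<in> P (tw p) (sc (sc \<alpha>)) \<and> (\<forall>s\<in>Domain G. k + s \<notin> P (tw p) (sc \<alpha>))"
    if \<alpha>: "\<alpha> \<in> Field omega1" and k: "k \<in> P p \<alpha>" "p \<cdot> k \<in> P p (sc (sc \<alpha>))" "\<forall>s\<in>Domain G. k + s \<notin> P p (sc \<alpha>)" for \<alpha> k
  proof -
    let ?K0 = "kernel_level p0 \<alpha>"
    let ?K1 = "kernel_level p1 \<alpha>"
    let ?N0 = "P p0 (sc \<alpha>)"
    let ?N1 = "P p1 (sc \<alpha>)"
    have pk0: "p0 \<cdot> x \<in> ?N0" if "x \<in> ?K0" for x by (rule act_kernel_level[OF \<alpha> that])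
    have pk1: "p1 \<cdot> x \<in> ?N1" if "x \<in> ?K1" for x by (rule act_kernel_level[OF \<alpha> that])
    obtain B where B: "basis_mod (?K0) (?N0) p0 B"
      by (rule ex_basis_mod[OF ip0 kernel_level_subspace P_subspace pk0])
    obtain B' where B': "basis_mod (?K1) (?N1) p1 B'"
      by (rule ex_basis_mod[OF ip1 kernel_level_subspace P_subspace pk1])
    have "kappa scale \<alpha> u p1 =o kappa scale \<alpha> u p0" unfolding p1_def by (rule kap[OF p0 \<alpha>])
    from ordIso_transitive[OF ordIso_symmetric[OF kappa_eq[OF \<alpha> ip0 B]] ordIso_symmetric[OF this]]
    have BB: "|B| =o |B'|" by (rule ordIso_transitive) (rule kappa_eq[OF \<alpha> ip1 B'])
    have sub: "?N1 \<subseteq> ?K1"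
      using P_suc_subset[OF \<alpha>] P_suc[OF sc_Field[OF \<alpha>]] unfolding kernel_level_def by blast
    have "\<exists>k'\<in>?K1. \<forall>s\<in>Range G. k' + s \<notin> ?N1"
    proof (rule transfer_residue_basis[OF GP fR ip0 ip1 deg kernel_level_subspace kernel_level_subspace
          P_subspace P_subspace sub pk0 pk1 _ _ B B' BB])
      show "a \<in> ?K0 \<longleftrightarrow> b \<in> ?K1" if "(a, b) \<in> G" for a b
        unfolding eq using ht[OF \<alpha> that] ht[OF _ pG[OF that], of "sc (sc \<alpha>)"] \<alpha> by (simp add: kernel_level_def)
      show "a \<in> ?N0 \<longleftrightarrow> b \<in> ?N1" if "(a, b) \<in> G" for a b
        unfolding eq using ht[OF _ that] \<alpha> by simp
      show "k \<in> ?K0" unfolding eq using k by (simp add: kernel_level_def)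
      show "k + s \<notin> ?N0" if "s \<in> Domain G" for s unfolding eq using k(3) that by blast
    qed
    then show ?thesis unfolding eq RD by (auto simp: kernel_level_def)
  qed
  moreover have "\<exists>k\<in>D (tw p). tw p \<cdot> k = 0 \<and> k \<notin> Domain G"
    if k: "k \<in> D p" "p \<cdot> k = 0" "k \<notin> Domain G" for k
  proof -
    have z: "q \<cdot> x \<in> {0}" if "x \<in> kernel_inf q" for x q using that by (simp add: kernel_inf_def)
    obtain B where B: "basis_mod (kernel_inf p0) {0} p0 B"
      by (rule ex_basis_mod[OF ip0 kernel_inf_subspace m.subspace_single_0 z])
    obtain B' where B': "basis_mod (kernel_inf p1) {0} p1 B'"
      by (rule ex_basis_mod[OF ip1 kernel_inf_subspace m.subspace_single_0 z])
    have "kappa_inf scale u p1 =o kappa_inf scale u p0" unfolding p1_def by (rule kapi[OF p0])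
    from ordIso_transitive[OF ordIso_symmetric[OF kappa_inf_eq[OF ip0 B]] ordIso_symmetric[OF this]]
    have BB: "|B| =o |B'|" by (rule ordIso_transitive) (rule kappa_inf_eq[OF ip1 B'])
    have sub: "{0} \<subseteq> kernel_inf p1" using m.subspace_0[OF kernel_inf_subspace] by simp
    have Dm: "- s \<in> Domain G" if "s \<in> Domain G" for s
      by (rule m.subspace_neg[OF partial_skew_Domain[OF GP] that])
    have "\<exists>k'\<in>kernel_inf p1. \<forall>s\<in>Range G. k' + s \<notin> {0}"
    proof (rule transfer_residue_basis[OF GP fR ip0 ip1 deg kernel_inf_subspace kernel_inf_subspace
          m.subspace_single_0 m.subspace_single_0 sub z z _ _ B B' BB])
      show "a \<in> kernel_inf p0 \<longleftrightarrow> b \<in> kernel_inf p1" if "(a, b) \<in> G" for a b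
        unfolding eq using partial_skew_D[OF GP p that] zero[OF pG[OF that]] by (simp add: kernel_inf_def)
      show "a \<in> {0} \<longleftrightarrow> b \<in> {0}" if "(a, b) \<in> G" for a b using zero[OF that] by simp
      show "k \<in> kernel_inf p0" unfolding eq using k by (simp add: kernel_inf_def)
      show "k + s \<notin> {0}" if "s \<in> Domain G" for s
        using k(3) Dm[OF that] by (auto simp: add_eq_0_iff2)
    qed
    then obtain k' where k': "k' \<in> kernel_inf (tw p)" "\<And>s. s \<in> Domain G \<Longrightarrow> k' + s \<noteq> 0" unfolding eq RD by auto
    have "k' \<notin> Domain G" using k'(2)[OF Dm, of k'] by auto
    then show ?thesis using k'(1) by (auto simp: kernel_inf_def)
  qed
  ultimately show ?thesis unfolding transfer_def by blast
qed

end

section \<open>The four conditions\<close>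

context endo_space
begin

text \<open>For the projection \<open>q\<close> onto V1 along V2, the exchange property becomes the
  identity u q = (1 - q) u. From it, u q and u (1 - q) are seen to have square zero by
  calculation.\<close>

lemma exchange_splitting:
  assumes "exchange_property scale u"
  obtains q where "endo scale q" "\<forall>x. q (q x) = q x" "\<forall>x. u (q x) = u x - q (u x)"
proof -
  obtain V1 V2 where V: "subspace V1" "subspace V2" "V1 \<inter> V2 = {0}"
    "{x + y | x y. x \<in> V1 \<and> y \<in> V2} = UNIV" "u ` V1 \<subseteq> V2" "u ` V2 \<subseteq> V1"
    using assms unfolding exchange_property_def by (elim exE conjE) (rule that)
  have "\<exists>y. y \<in> V1 \<and> x - y \<in> V2" for x
  proof -
    have "x \<in> {x + y | x y. x \<in> V1 \<and> y \<in> V2}" using V(4) by simp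
    then obtain a b where "x = a + b" "a \<in> V1" "b \<in> V2" by blast
    then show ?thesis by (intro exI[of _ a]) simp
  qed
  then obtain q where q: "\<And>x. q x \<in> V1" "\<And>x. x - q x \<in> V2" by metis
  have q_eq: "q x = y" if y: "y \<in> V1" "x - y \<in> V2" for x y
  proof -
    have "q x - y \<in> V1" by (rule subspace_diff[OF V(1) q(1) y(1)])
    moreover have "(x - y) - (x - q x) \<in> V2" by (rule subspace_diff[OF V(2) y(2) q(2)])
    then have "q x - y \<in> V2" by simp
    ultimately have "q x - y = 0" using V(3) by blast
    then show ?thesis by simp
  qed
  have "q (x + y) = q x + q y" for x y
    using subspace_add[OF V(2) q(2)[of x] q(2)[of y]]
    by (intro q_eq subspace_add[OF V(1)] q) (simp add: algebra_simps)
  moreover have "q (scale c x) = scale c (q x)" for c x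
    using subspace_scale[OF V(2) q(2)[of x], of c]
    by (intro q_eq subspace_scale[OF V(1)] q) (simp add: scale_right_diff_distrib)
  ultimately have "endo scale q" unfolding Vector_Spaces.linear_iff by (simp add: vector_space_axioms)
  moreover have "q (q x) = q x" for x using q_eq[OF q(1)] subspace_0[OF V(2)] by simp
  moreover have "u (q x) = u x - q (u x)" for x
  proof -
    have "u (x - q x) \<in> V1" "u (q x) \<in> V2" using V(5,6) q by blast+
    then have "q (u x) = u (x - q x)" by (intro q_eq) (simp_all add: u_diff)
    then show ?thesis by (simp add: u_diff)
  qed
  ultimately show ?thesis using that by blast
qed

lemma exchange_imp_square_zero:
  assumes "exchange_property scale u"
  shows "sum_of_two_square_zero scale u"
proof -
  obtain q where q: "endo scale q" "\<forall>x. q (q x) = q x" "\<forall>x. u (q x) = u x - q (u x)"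
    by (rule exchange_splitting[OF assms])
  interpret q: Vector_Spaces.linear scale scale q by (rule q(1))
  have lin: "endo scale (\<lambda>x. u (q x))" "endo scale (\<lambda>x. u (x - q x))"
    unfolding Vector_Spaces.linear_iff
    by (simp_all add: vector_space_axioms q.add q.scale u_add u_scale u_diff scale_right_diff_distrib)
  have "square_zero (\<lambda>x. u (q x))" "square_zero (\<lambda>x. u (x - q x))"
    unfolding square_zero_def by (simp_all add: q u_diff q.diff)
  moreover have "u = (\<lambda>x. u (q x) + u (x - q x))" by (simp add: u_diff)
  ultimately show ?thesis unfolding sum_of_two_square_zero_def using lin by blast
qed

lemma exchange_imp_similar:
  assumes "exchange_property scale u"
  shows "similar scale u (\<lambda>x. - u x)"
proof -
  obtain q where q: "endo scale q" "\<forall>x. q (q x) = q x" "\<forall>x. u (q x) = u x - q (u x)"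
    by (rule exchange_splitting[OF assms])
  interpret q: Vector_Spaces.linear scale scale q by (rule q(1))
  \<comment> \<open>The reflection that is 1 on V1 and -1 on V2; it conjugates \<open>u\<close> to
    its opposite.\<close>
  define \<phi> where "\<phi> x = q x - (x - q x)" for x
  have inv: "\<phi> (\<phi> x) = x" for x by (simp add: \<phi>_def q.diff q)
  have bij: "bij \<phi>" by (rule o_bij[of \<phi> \<phi>]) (auto simp: inv)
  have "inv_into UNIV \<phi> = \<phi>" using inv by (intro inv_equality)
  moreover have "\<phi> (u (\<phi> x)) = - u x" for x
  proof -
    have "u (\<phi> x) = u x - q (u x) - q (u x)" by (simp add: \<phi>_def u_diff q)
    then show ?thesis by (simp add: \<phi>_def q.diff q)
  qed
  ultimately have "(\<lambda>x. - u x) = \<phi> \<circ> u \<circ> inv_into UNIV \<phi>" by (simp add: fun_eq_iff)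
  moreover have "endo scale \<phi>"
    unfolding Vector_Spaces.linear_iff \<phi>_def
    by (simp add: vector_space_axioms q.add q.scale scale_right_diff_distrib algebra_simps)
  ultimately show ?thesis unfolding similar_def using bij by blast
qed

end

context countable_endo
begin

definition kappa_symmetric :: bool where
  "kappa_symmetric \<longleftrightarrow> (\<forall>p\<in>Irr.
     (\<forall>\<alpha>\<in>Field omega1. kappa scale \<alpha> u (H_poly (- 1) p) =o kappa scale \<alpha> u p) \<and>
     kappa_inf scale u (H_poly (- 1) p) =o kappa_inf scale u p)"

lemma similar_imp_kappa_symmetric:
  assumes "similar scale u (\<lambda>x. - u x)"
  shows kappa_symmetric
proof -
  obtain \<phi> where \<phi>: "endo scale \<phi>" "bij \<phi>" "(\<lambda>x. - u x) = \<phi> \<circ> u \<circ> inv_into UNIV \<phi>"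
    using assms unfolding similar_def by blast
  interpret f: Vector_Spaces.linear scale scale \<phi> by (rule \<phi>(1))
  define \<psi> where "\<psi> = inv_into UNIV \<phi>"
  have inv: "\<psi> (\<phi> x) = x" "\<phi> (\<psi> x) = x" for x
    using \<phi>(2) by (simp_all add: \<psi>_def bij_is_inj bij_is_surj surj_f_inv_f)
  have fu: "\<phi> (u x) = - u (\<phi> x)" for x
    using fun_cong[OF \<phi>(3), of "\<phi> x"] inv by (simp add: \<psi>_def[symmetric])
  have s1: "\<phi> (s \<cdot> x) = tw s \<cdot> \<phi> x" for s x by (rule skew_act) (simp_all add: f.add f.scale fu)
  have s2: "\<psi> (s \<cdot> x) = tw s \<cdot> \<psi> x" for s x
    using s1[of "tw s" "\<psi> x"] inv by (metis tw_tw)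
  show ?thesis
    unfolding kappa_symmetric_def
  proof (intro ballI conjI)
    fix p :: "'a poly" assume "p \<in> Irr"
    then have p: "irreducible p" by (simp add: Irr_def)
    show "kappa scale \<alpha> u (H_poly (- 1) p) =o kappa scale \<alpha> u p" if "\<alpha> \<in> Field omega1" for \<alpha>
      by (rule kappa_skew(1)[of \<phi> \<psi> 1]) (simp_all add: f.add s1 s2 inv p irreducible_not_dvd_one that)
    show "kappa_inf scale u (H_poly (- 1) p) =o kappa_inf scale u p"
      by (rule kappa_skew(2)[of \<phi> \<psi> 1]) (simp_all add: f.add s1 s2 inv p irreducible_not_dvd_one)
  qed
qed

text \<open>
  If \<open>u = a + b\<close> with \<open>a\<^sup>2 = b\<^sup>2 = 0\<close>, then \<open>a - b\<close> anticommutes with \<open>u\<close>, and its square is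
  \<open>- u\<^sup>2\<close>. So it is invertible away from the prime \<open>t\<close>, where the condition is void.
\<close>

lemma square_zero_imp_kappa_symmetric:
  assumes "sum_of_two_square_zero scale u"
  shows kappa_symmetric
proof -
  obtain a b where ab: "endo scale a" "endo scale b" "square_zero a" "square_zero b" "u = (\<lambda>x. a x + b x)"
    using assms unfolding sum_of_two_square_zero_def by blast
  interpret a: Vector_Spaces.linear scale scale a by (rule ab(1))
  interpret b: Vector_Spaces.linear scale scale b by (rule ab(2))
  have z: "a (a x) = 0" "b (b x) = 0" for x using ab by (simp_all add: square_zero_def)
  have ux: "u x = a x + b x" for x using ab(5) by simp
  define w where "w x = a x - b x" for x
  define g :: "'a poly" where "g = - ([:0, 1:] * [:0, 1:])"
  have w_add: "w (x + y) = w x + w y" for x y by (simp add: w_def a.add b.add)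
  have s: "w (s \<cdot> x) = tw s \<cdot> w x" for s x
    by (rule skew_act)
      (simp_all add: w_def ux a.add b.add a.scale b.scale a.diff b.diff z scale_right_diff_distrib)
  have ww: "w (w x) = g \<cdot> x" for x
  proof -
    have "g \<cdot> x = - u (u x)" unfolding g_def m.scale_minus_left act_mult act_X ..
    then show ?thesis by (simp add: w_def ux a.add b.add a.diff b.diff z)
  qed
  have g: "tw g = g" by (simp add: g_def tw_minus tw_mult tw_pCons)
  show ?thesis
    unfolding kappa_symmetric_def
  proof (intro ballI)
    fix p :: "'a poly" assume p: "p \<in> Irr"
    then have irr: "irreducible p" by (simp add: Irr_def)
    show "(\<forall>\<alpha>\<in>Field omega1. kappa scale \<alpha> u (H_poly (- 1) p) =o kappa scale \<alpha> u p) \<and>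
     kappa_inf scale u (H_poly (- 1) p) =o kappa_inf scale u p"
    proof (cases "p dvd [:0, 1:]")
      case True
      then show ?thesis
        using H_poly_divisor_of_X[OF p] by (simp add: kappa_def kappa_inf_def residue_dim_def Let_def card_of_refl)
    next
      case False
      have ng: "\<not> p dvd g"
      proof
        assume "p dvd g"
        then have d: "p dvd [:0, 1:] * [:0, 1:]" by (simp only: g_def dvd_minus_iff)
        obtain A B where AB: "A * [:0, 1:] + B * p = 1" by (rule irreducible_bezout[OF irr False])
        have "[:0, 1:] = (A * [:0, 1:] + B * p) * [:0, 1:]" by (simp only: AB mult_1_left)
        also have "\<dots> = A * ([:0, 1:] * [:0, 1:]) + B * [:0, 1:] * p" by (simp only: algebra_simps)
        finally have "p dvd [:0, 1:]" using d by (metis dvd_add dvd_mult dvd_triv_right)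
        then show False using False by blast
      qed
      show ?thesis
        using kappa_skew[of w w g p, OF w_add s s ww ww g irr ng] by blast
    qed
  qed
qed

end

lemma (in countable_endo_odd) kappa_symmetric_imp_exchange:
  assumes kappa_symmetric "locally_finite scale u"
  shows "exchange_property scale u"
proof (rule exchange_if_transfer[OF _ assms(2)])
  fix G and p :: "'a poly" assume "skew_inv G" "irreducible p"
  then show "transfer G p"
    using assms(1) unfolding kappa_symmetric_def by (intro transfer_if_kappa_eq) auto
qed

lemma two_neq_zero_if_CHAR:
  assumes "CHAR('f::field) \<noteq> 2"
  shows "(2 :: 'f) \<noteq> 0"
proof
  assume "(2 :: 'f) = 0"
  then have "of_nat 2 = (0 :: 'f)" by simp
  then have "CHAR('f) dvd 2" by (simp only: of_nat_eq_0_iff_char_dvd)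
  then have "CHAR('f) = 1 \<or> CHAR('f) = 2" using two_is_prime_nat prime_nat_iff by blast
  moreover have "CHAR('f) \<noteq> 1" by simp
  ultimately show False using assms by simp
qed

theorem corollary5p1:
  fixes scale :: "'f::field \<Rightarrow> 'v::ab_group_add \<Rightarrow> 'v"
    and u :: "'v \<Rightarrow> 'v"
  assumes "CHAR('f) \<noteq> 2"
    and "vector_space scale"
    and "countable_dim scale"
    and "endo scale u"
    and "locally_finite scale u"
  shows "(sum_of_two_square_zero scale u \<longleftrightarrow> exchange_property scale u) \<and>
         (exchange_property scale u \<longleftrightarrow> similar scale u (\<lambda>x. - u x)) \<and>
         (similar scale u (\<lambda>x. - u x) \<longleftrightarrow>
           (\<forall>p\<in>Irr.
              (\<forall>\<alpha>\<in>Field omega1. kappa scale \<alpha> u (H_poly (-1) p) =o kappa scale \<alpha> u p) \<and>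
              kappa_inf scale u (H_poly (-1) p) =o kappa_inf scale u p))"
proof -
  interpret countable_endo_odd scale u
    using assms two_neq_zero_if_CHAR[OF assms(1)]
    by (simp add: countable_endo_odd_def countable_endo_odd_axioms_def countable_endo_def
        countable_endo_axioms_def endo_space_def endo_space_axioms_def)
  show ?thesis
    using exchange_imp_square_zero exchange_imp_similar similar_imp_kappa_symmetric
      square_zero_imp_kappa_symmetric kappa_symmetric_imp_exchange[OF _ assms(5)]
    unfolding kappa_symmetric_def by blast
qed

end
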